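(* Let $\sigma$ be an algebraic almost closed 1-form on a Zariski open neighbourhood $U$ of the origin in $\mathbb{C}^2$, arising from the construction described in the context, whose zero scheme $\mathcal{Z}(\sigma)\subset U$ is $0$-dimensional and is not the critical locus of any holomorphic function near the origin in $\mathbb{C}^2$ (that is, there is no holomorphic function $\Phi$ on a Euclidean open neighbourhood $W\subset U$ of the origin with $\mathcal{Z}(d\Phi)=\mathcal{Z}(\sigma)\cap W$ as analytic subspaces of $W$). Then the scheme $\mathcal{Z}(\sigma)$ cannot be written as the critical locus of any holomorphic function on a nonsingular variety: there do not exist a nonsingular complex analytic variety $M$ of any dimension and a holomorphic function $\Phi$ on $M$ such that $\mathcal{Z}(\sigma)$ is isomorphic to $\mathcal{Z}(d\Phi)$ (as complex analytic spaces).
   Context: For a 1-form $\omega$ on a nonsingular variety or complex manifold, $\mathcal{Z}(\omega)$ is its zero scheme, whose ideal is locally generated by the coefficients of $\omega$; the critical locus of a holomorphic function $\Phi$ is $\mathcal{Z}(d\Phi)$. A 1-form $\omega$ is almost closed if $d\omega$ vanishes on $\mathcal{Z}(\omega)$; for $\omega=A\,dx+B\,dy$ on an open subset of $\mathbb{C}^2$ this means $A_y-B_x\in(A,B)$, where subscripts $x,y$ denote partial derivatives. Construction. Fix $d\ge 18$ and $C,D\in\mathbb{C}[\![x,y]\!]$ whose degree 1 homogeneous parts satisfy $C_{1,x}+D_{1,y}\neq 0$. Let $A=\sum_{k\ge d}A_k$, $B=\sum_{k\ge d}B_k$ in $\mathbb{C}[\![x,y]\!]$ (with $A_k,B_k$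 homogeneous of degree $k$) satisfy $A_y-B_x=CA+DB$. Suppose that $N$ is such that $\mathfrak{m}^N\subset(A,B)\subset\mathbb{C}[\![x,y]\!]$, where $\mathfrak{m}=(x,y)$. Then $\sigma$ is the polynomial 1-form $$\sigma=(A_d+A_{d+1}+\cdots+A_N)\,dx+(B_d+B_{d+1}+\cdots+B_N)\,dy$$ restricted to a Zariski open neighbourhood $U$ of the origin on which it is almost closed. *)

theory Defs
  imports
    "HOL-Analysis.Analysis"
    "HOL-Algebra.QuotRing"
    "HOL-Algebra.Ideal_Product"
    "HOL-Library.Extended_Nat"
    "HOL-Computational_Algebra.Formal_Power_Series"
    "HOL-Computational_Algebra.Polynomial"
begin

section \<open>Complex manifolds\<close>

text \<open>
  \<open>\<complex>\<^sup>n\<close> for a natural number \<open>n\<close> (possibly 0), following the library's Euclidean space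
  \<open>\<real>\<^sup>n\<close>: sequences that vanish from index \<open>n\<close> on, with the product topology.
\<close>

definition complex_space :: "nat \<Rightarrow> (nat \<Rightarrow> complex) topology" where
  "complex_space n = top_of_set {z. \<forall>i\<ge>n. z i = 0}"

text \<open>Holomorphic functions of \<open>n\<close> variables: continuous and holomorphic in each variable
  separately. The set \<open>S\<close> is meant to be open in \<open>\<complex>\<^sup>n\<close>.\<close>

definition holomorphic_n :: "nat \<Rightarrow> (nat \<Rightarrow> complex) set \<Rightarrow> ((nat \<Rightarrow> complex) \<Rightarrow> complex) \<Rightarrow> bool" where
  "holomorphic_n n S f \<longleftrightarrow>
     continuous_on S f \<and>
     (\<forall>z\<in>S. \<forall>i<n. (\<lambda>t. f (z(i := t))) field_differentiable (at (z i)))"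

record 'm chart =
  chart_dim :: nat
  chart_dom :: "'m set"
  chart_map :: "'m \<Rightarrow> nat \<Rightarrow> complex"

definition chart_inv :: "'m chart \<Rightarrow> (nat \<Rightarrow> complex) \<Rightarrow> 'm" where
  "chart_inv c = inv_into (chart_dom c) (chart_map c)"

record 'm manifold =
  man_top :: "'m topology"
  man_atlas :: "'m chart set"

text \<open>The dimension is attached to the charts, so that a manifold may have connected components
  of different dimensions.\<close>

definition complex_manifold :: "'m manifold \<Rightarrow> bool" where
  "complex_manifold M \<longleftrightarrow>
     Hausdorff_space (man_top M) \<and>
     second_countable (man_top M) \<and>
     (\<Union>c\<in>man_atlas M. chart_dom c) = topspace (man_top M) \<and>
     (\<forall>c\<in>man_atlas M.
        openin (man_top M) (chart_dom c) \<and>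
        openin (complex_space (chart_dim c)) (chart_map c ` chart_dom c) \<and>
        homeomorphic_map (subtopology (man_top M) (chart_dom c))
          (subtopology (complex_space (chart_dim c)) (chart_map c ` chart_dom c))
          (chart_map c)) \<and>
     (\<forall>c\<in>man_atlas M. \<forall>c'\<in>man_atlas M. \<forall>i<chart_dim c'.
        holomorphic_n (chart_dim c) (chart_map c ` (chart_dom c \<inter> chart_dom c'))
          (\<lambda>z. chart_map c' (chart_inv c z) i))"

definition holomorphic_fun :: "'m manifold \<Rightarrow> 'm set \<Rightarrow> ('m \<Rightarrow> complex) \<Rightarrow> bool" where
  "holomorphic_fun M W f \<longleftrightarrow>
     openin (man_top M) W \<and>
     (\<forall>c\<in>man_atlas M. holomorphic_n (chart_dim c) (chart_map c ` (chart_dom c \<inter> W))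
                        (\<lambda>z. f (chart_inv c z)))"

text \<open>The partial derivative with respect to the \<open>i\<close>-th coordinate function of the chart \<open>c\<close>.\<close>

definition chart_partial :: "'m chart \<Rightarrow> nat \<Rightarrow> ('m \<Rightarrow> complex) \<Rightarrow> 'm \<Rightarrow> complex" where
  "chart_partial c i f p =
     deriv (\<lambda>t. f (chart_inv c ((chart_map c p)(i := t)))) (chart_map c p i)"

section \<open>Germs of holomorphic functions\<close>

definition germ :: "'m manifold \<Rightarrow> 'm \<Rightarrow> ('m \<Rightarrow> complex) \<Rightarrow> ('m \<Rightarrow> complex) set" where
  "germ M p f = {g. eventually (\<lambda>x. g x = f x) (nhdsin (man_top M) p)}"

definition local_ring :: "'m manifold \<Rightarrow> 'm \<Rightarrow> ('m \<Rightarrow> complex) set ring" where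
  "local_ring M p =
     \<lparr>carrier = {germ M p f | f. \<exists>W. p \<in> W \<and> holomorphic_fun M W f},
      mult = (\<lambda>a b. \<Union>f\<in>a. \<Union>g\<in>b. germ M p (\<lambda>x. f x * g x)),
      one = germ M p (\<lambda>_. 1),
      zero = germ M p (\<lambda>_. 0),
      add = (\<lambda>a b. \<Union>f\<in>a. \<Union>g\<in>b. germ M p (\<lambda>x. f x + g x))\<rparr>"

section \<open>1-forms\<close>

text \<open>
  A 1-form is given by its coefficients in the charts: \<open>\<omega> = (\<Sum>i. \<omega> c i dz\<^sub>i)\<close> on the domain of the
  chart \<open>c\<close> with coordinates \<open>z\<^sub>i\<close>.
\<close>

type_synonym 'm one_form = "'m chart \<Rightarrow> nat \<Rightarrow> 'm \<Rightarrow> complex"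

definition differential :: "('m \<Rightarrow> complex) \<Rightarrow> 'm one_form" where
  "differential \<Phi> = (\<lambda>c i. chart_partial c i \<Phi>)"

text \<open>The stalk at \<open>p\<close> of the ideal sheaf of the zero scheme of \<open>\<omega>\<close>. The coefficients in all
  charts at \<open>p\<close> are used as generators; those of any single chart generate the same ideal.\<close>

definition zero_ideal :: "'m manifold \<Rightarrow> 'm one_form \<Rightarrow> 'm \<Rightarrow> ('m \<Rightarrow> complex) set set" where
  "zero_ideal M \<omega> p =
     genideal (local_ring M p)
       {germ M p (\<omega> c i) | c i. c \<in> man_atlas M \<and> p \<in> chart_dom c \<and> i < chart_dim c}"

definition almost_closed :: "'m manifold \<Rightarrow> 'm one_form \<Rightarrow> bool" where
  "almost_closed M \<omega> \<longleftrightarrow>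
     (\<forall>c\<in>man_atlas M. \<forall>p\<in>chart_dom c. \<forall>i<chart_dim c. \<forall>j<chart_dim c.
        germ M p (\<lambda>x. chart_partial c j (\<omega> c i) x - chart_partial c i (\<omega> c j) x)
          \<in> zero_ideal M \<omega> p)"

section \<open>Complex ringed spaces and zero schemes\<close>

text \<open>
  A space with a sheaf of \<open>\<complex>\<close>-algebras, whose sections over \<open>V\<close> are functions on \<open>V\<close> with values in
  the stalks; the restriction maps are restriction of functions, and \<open>crs_const V\<close> is the structure
  map from \<open>\<complex>\<close> to the sections over \<open>V\<close>.
\<close>

record ('a, 's) complex_ringed_space =
  crs_top :: "'a topology"
  crs_sheaf :: "'a set \<Rightarrow> ('a \<Rightarrow> 's) ring"
  crs_const :: "'a set \<Rightarrow> complex \<Rightarrow> 'a \<Rightarrow> 's"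

definition crs_isomorphic ::
  "('a, 's) complex_ringed_space \<Rightarrow> ('b, 't) complex_ringed_space \<Rightarrow> bool" where
  "crs_isomorphic X Y \<longleftrightarrow>
     (\<exists>h \<psi>. homeomorphic_map (crs_top X) (crs_top Y) h \<and>
        (\<forall>V. openin (crs_top Y) V \<longrightarrow>
           (let V' = {x \<in> topspace (crs_top X). h x \<in> V} in
              \<psi> V \<in> ring_iso (crs_sheaf Y V) (crs_sheaf X V') \<and>
              (\<forall>a. \<psi> V (crs_const Y V a) = crs_const X V' a))) \<and>
        (\<forall>V W. openin (crs_top Y) V \<and> openin (crs_top Y) W \<and> W \<subseteq> V \<longrightarrow>
           (\<forall>s\<in>carrier (crs_sheaf Y V).
              \<psi> W (restrict s W) = restrict (\<psi> V s) {x \<in> topspace (crs_top X). h x \<in> W})))"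

text \<open>The support of the zero scheme of \<open>\<omega>\<close>, with the topology of the ambient manifold.\<close>

definition zero_set :: "'m manifold \<Rightarrow> 'm one_form \<Rightarrow> 'm set" where
  "zero_set M \<omega> =
     {p \<in> topspace (man_top M). zero_ideal M \<omega> p \<noteq> carrier (local_ring M p)}"

text \<open>The class of a function in the local ring of the zero scheme of \<open>\<omega>\<close> at \<open>p\<close>.\<close>

definition zero_class ::
  "'m manifold \<Rightarrow> 'm one_form \<Rightarrow> ('m \<Rightarrow> complex) \<Rightarrow> 'm \<Rightarrow> ('m \<Rightarrow> complex) set set" where
  "zero_class M \<omega> f p = zero_ideal M \<omega> p +>\<^bsub>local_ring M p\<^esub> germ M p f"

text \<open>The zero scheme of \<open>\<omega>\<close> as a complex analytic space. Its structure sheaf is the sheafification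
  of \<open>\<O>\<^sub>M / I\<close>, so a section is a family of elements of the stalks that is locally the family of
  classes of a holomorphic function on the ambient manifold.\<close>

definition zero_scheme ::
  "'m manifold \<Rightarrow> 'm one_form \<Rightarrow> ('m, ('m \<Rightarrow> complex) set set) complex_ringed_space" where
  "zero_scheme M \<omega> =
     \<lparr>crs_top = subtopology (man_top M) (zero_set M \<omega>),
      crs_sheaf = (\<lambda>V.
        \<lparr>carrier = {s \<in> extensional V. \<forall>p\<in>V. \<exists>W f. p \<in> W \<and> holomorphic_fun M W f \<and>
                      (\<forall>q\<in>W \<inter> V. s q = zero_class M \<omega> f q)},
         mult = (\<lambda>s t. \<lambda>p\<in>V. s p \<otimes>\<^bsub>local_ring M p Quot zero_ideal M \<omega> p\<^esub> t p),
         one = (\<lambda>p\<in>V. \<one>\<^bsub>local_ring M p Quot zero_ideal M \<omega> p\<^esub>),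
         zero = (\<lambda>p\<in>V. \<zero>\<^bsub>local_ring M p Quot zero_ideal M \<omega> p\<^esub>),
         add = (\<lambda>s t. \<lambda>p\<in>V. s p \<oplus>\<^bsub>local_ring M p Quot zero_ideal M \<omega> p\<^esub> t p)\<rparr>),
      crs_const = (\<lambda>V a. restrict (zero_class M \<omega> (\<lambda>_. a)) V)\<rparr>"

section \<open>Open subsets of the complex plane \<open>\<complex>\<^sup>2\<close>\<close>

definition plane_chart :: "(complex \<times> complex) set \<Rightarrow> (complex \<times> complex) chart" where
  "plane_chart U =
     \<lparr>chart_dim = 2, chart_dom = U,
      chart_map = (\<lambda>(x, y) i. if i = 0 then x else if i = 1 then y else 0)\<rparr>"

definition plane_open :: "(complex \<times> complex) set \<Rightarrow> (complex \<times> complex) manifold" where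
  "plane_open U = \<lparr>man_top = top_of_set U, man_atlas = {plane_chart U}\<rparr>"

text \<open>The form \<open>a dx + b dy\<close>. The manifold \<open>plane_open U\<close> has a single chart, so the chart argument
  can be ignored.\<close>

definition plane_form ::
  "(complex \<times> complex \<Rightarrow> complex) \<Rightarrow> (complex \<times> complex \<Rightarrow> complex) \<Rightarrow> (complex \<times> complex) one_form"
  where "plane_form a b = (\<lambda>c i. if i = 0 then a else b)"

definition poly_xy :: "complex poly poly \<Rightarrow> complex \<times> complex \<Rightarrow> complex" where
  "poly_xy P = (\<lambda>(x, y). poly (poly P [:x:]) y)"

text \<open>The sets below are closed under finite intersections, so they are a basis of the Zariski
  topology.\<close>

definition zariski :: "(complex \<times> complex) topology" where
  "zariski = topology_generated_by (range (\<lambda>P. {p. poly_xy P p \<noteq> 0}))"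

section \<open>Krull dimension\<close>

definition irreducible_in :: "'a topology \<Rightarrow> 'a set \<Rightarrow> bool" where
  "irreducible_in T S \<longleftrightarrow>
     S \<subseteq> topspace T \<and> S \<noteq> {} \<and>
     (\<forall>F G. closedin T F \<and> closedin T G \<and> S \<subseteq> F \<union> G \<longrightarrow> S \<subseteq> F \<or> S \<subseteq> G)"

text \<open>The empty space gets dimension 0 rather than \<open>-\<infinity>\<close>.\<close>

definition krull_dim :: "'a topology \<Rightarrow> enat" where
  "krull_dim T =
     Sup {enat n | n. \<exists>F. (\<forall>i\<le>n. closedin T (F i) \<and> irreducible_in T (F i)) \<and>
                          (\<forall>i<n. F i \<subset> F (Suc i))}"

section \<open>Formal power series in two variables\<close>

text \<open>
  \<open>\<complex>[[x,y]]\<close> is represented as \<open>\<complex>[[y]][[x]]\<close>: the coefficient of \<open>x\<^sup>i y\<^sup>j\<close> in \<open>F\<close> is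
  \<open>fps_nth (fps_nth F i) j\<close>.
\<close>

type_synonym fps2 = "complex fps fps"

definition fps2_coeff :: "fps2 \<Rightarrow> nat \<Rightarrow> nat \<Rightarrow> complex" where
  "fps2_coeff F i j = fps_nth (fps_nth F i) j"

definition fps2_x :: fps2 where "fps2_x = fps_X"

definition fps2_y :: fps2 where "fps2_y = fps_const fps_X"

definition fps2_dx :: "fps2 \<Rightarrow> fps2" where "fps2_dx F = fps_deriv F"

definition fps2_dy :: "fps2 \<Rightarrow> fps2" where "fps2_dy F = Abs_fps (\<lambda>i. fps_deriv (fps_nth F i))"

definition hom_part :: "nat \<Rightarrow> fps2 \<Rightarrow> fps2" where
  "hom_part k F = Abs_fps (\<lambda>i. Abs_fps (\<lambda>j. if i + j = k then fps2_coeff F i j else 0))"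

text \<open>The polynomial function \<open>F\<^sub>d + F\<^sub>d\<^sub>+\<^sub>1 + \<dots> + F\<^sub>N\<close>, where \<open>F\<^sub>k\<close> is the homogeneous part of \<open>F\<close>
  of degree \<open>k\<close>.\<close>

definition fps2_section :: "nat \<Rightarrow> nat \<Rightarrow> fps2 \<Rightarrow> complex \<times> complex \<Rightarrow> complex" where
  "fps2_section d N F = (\<lambda>(x, y). \<Sum>k=d..N. \<Sum>i\<le>k. fps2_coeff F i (k - i) * x ^ i * y ^ (k - i))"

definition fps2_ring :: "fps2 ring" where
  "fps2_ring = \<lparr>carrier = UNIV, mult = (*), one = 1, zero = 0, add = (+)\<rparr>"

definition fps2_max_ideal :: "fps2 set" where
  "fps2_max_ideal = genideal fps2_ring {fps2_x, fps2_y}"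

definition ideal_power :: "('a, 'b) ring_scheme \<Rightarrow> 'a set \<Rightarrow> nat \<Rightarrow> 'a set" where
  "ideal_power R I n = ((ideal_prod R I) ^^ n) (carrier R)"

section \<open>Consistency checks\<close>

text \<open>The structures above are what their names say: germs form a commutative ring, open subsets of
  \<open>\<complex>\<^sup>2\<close> are complex manifolds, and \<open>\<complex>[[x,y]]\<close> is a commutative ring.\<close>

lemma holomorphic_n_const: "holomorphic_n n S (\<lambda>_. a)"
  by (simp add: holomorphic_n_def)

lemma holomorphic_n_add:
  "holomorphic_n n S f \<Longrightarrow> holomorphic_n n S g \<Longrightarrow> holomorphic_n n S (\<lambda>z. f z + g z)"
  by (auto simp: holomorphic_n_def intro!: continuous_intros field_differentiable_add)

lemma holomorphic_n_mult:
  "holomorphic_n n S f \<Longrightarrow> holomorphic_n n S g \<Longrightarrow> holomorphic_n n S (\<lambda>z. f z * g z)"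
  by (auto simp: holomorphic_n_def intro!: continuous_intros field_differentiable_mult)

lemma holomorphic_n_subset: "holomorphic_n n S f \<Longrightarrow> T \<subseteq> S \<Longrightarrow> holomorphic_n n T f"
  unfolding holomorphic_n_def by (meson continuous_on_subset subsetD)

lemma holomorphic_fun_subset:
  assumes "holomorphic_fun M W f" "openin (man_top M) V" "V \<subseteq> W"
  shows "holomorphic_fun M V f"
  using assms unfolding holomorphic_fun_def by (blast intro: holomorphic_n_subset)

lemma holomorphic_fun_const: "openin (man_top M) W \<Longrightarrow> holomorphic_fun M W (\<lambda>_. a)"
  by (simp add: holomorphic_fun_def holomorphic_n_const)

lemma holomorphic_fun_add:
  "holomorphic_fun M W f \<Longrightarrow> holomorphic_fun M W g \<Longrightarrow> holomorphic_fun M W (\<lambda>x. f x + g x)"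
  by (simp add: holomorphic_fun_def holomorphic_n_add)

lemma holomorphic_fun_mult:
  "holomorphic_fun M W f \<Longrightarrow> holomorphic_fun M W g \<Longrightarrow> holomorphic_fun M W (\<lambda>x. f x * g x)"
  by (simp add: holomorphic_fun_def holomorphic_n_mult)

lemma germ_self: "f \<in> germ M p f"
  by (simp add: germ_def)

lemma germ_eq_iff: "germ M p f = germ M p g \<longleftrightarrow> eventually (\<lambda>x. f x = g x) (nhdsin (man_top M) p)"
  (is "?L \<longleftrightarrow> ?R")
proof
  assume L: ?L
  have "f \<in> germ M p g" using germ_self[of f M p] unfolding L .
  then show ?R by (simp add: germ_def)
next
  assume R: ?R
  have "eventually (\<lambda>x. h x = f x) (nhdsin (man_top M) p) \<longleftrightarrow>
        eventually (\<lambda>x. h x = g x) (nhdsin (man_top M) p)" for h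
    by (rule eventually_subst, rule eventually_mono[OF R]) simp
  then show ?L unfolding germ_def by simp
qed

lemma germ_add: "(\<Union>f\<in>germ M p a. \<Union>g\<in>germ M p b. germ M p (\<lambda>x. f x + g x)) = germ M p (\<lambda>x. a x + b x)"
proof -
  have "germ M p (\<lambda>x. f x + g x) = germ M p (\<lambda>x. a x + b x)"
    if "f \<in> germ M p a" "g \<in> germ M p b" for f g
  proof -
    from that have "eventually (\<lambda>x. f x = a x \<and> g x = b x) (nhdsin (man_top M) p)"
      by (simp add: germ_def eventually_conj_iff)
    then show ?thesis unfolding germ_eq_iff by (rule eventually_mono) simp
  qed
  then have "(\<Union>f\<in>germ M p a. \<Union>g\<in>germ M p b. germ M p (\<lambda>x. f x + g x)) =
      (\<Union>f\<in>germ M p a. \<Union>g\<in>germ M p b. germ M p (\<lambda>x. a x + b x))"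
    by (intro SUP_cong refl)
  also have "\<dots> = germ M p (\<lambda>x. a x + b x)"
    using germ_self[of a M p] germ_self[of b M p] by (metis UN_constant empty_iff)
  finally show ?thesis .
qed

lemma germ_mult: "(\<Union>f\<in>germ M p a. \<Union>g\<in>germ M p b. germ M p (\<lambda>x. f x * g x)) = germ M p (\<lambda>x. a x * b x)"
proof -
  have "germ M p (\<lambda>x. f x * g x) = germ M p (\<lambda>x. a x * b x)"
    if "f \<in> germ M p a" "g \<in> germ M p b" for f g
  proof -
    from that have "eventually (\<lambda>x. f x = a x \<and> g x = b x) (nhdsin (man_top M) p)"
      by (simp add: germ_def eventually_conj_iff)
    then show ?thesis unfolding germ_eq_iff by (rule eventually_mono) simp
  qed
  then have "(\<Union>f\<in>germ M p a. \<Union>g\<in>germ M p b. germ M p (\<lambda>x. f x * g x)) =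
      (\<Union>f\<in>germ M p a. \<Union>g\<in>germ M p b. germ M p (\<lambda>x. a x * b x))"
    by (intro SUP_cong refl)
  also have "\<dots> = germ M p (\<lambda>x. a x * b x)"
    using germ_self[of a M p] germ_self[of b M p] by (metis UN_constant empty_iff)
  finally show ?thesis .
qed

lemma local_ring_closed:
  assumes "a \<in> carrier (local_ring M p)" "b \<in> carrier (local_ring M p)"
  obtains W f g where "p \<in> W" "holomorphic_fun M W f" "holomorphic_fun M W g"
    "a = germ M p f" "b = germ M p g"
proof -
  from assms obtain W f V g where "p \<in> W" "holomorphic_fun M W f" "a = germ M p f"
    "p \<in> V" "holomorphic_fun M V g" "b = germ M p g"
    by (auto simp: local_ring_def)
  then show ?thesis
    using that[of "W \<inter> V" f g] holomorphic_fun_subset[of M W f "W \<inter> V"]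
      holomorphic_fun_subset[of M V g "W \<inter> V"] openin_Int[of "man_top M" W V]
    by (simp add: holomorphic_fun_def)
qed

lemma cring_local_ring:
  assumes "p \<in> topspace (man_top M)"
  shows "cring (local_ring M p)"
proof (rule cringI)
  let ?R = "local_ring M p"
  have one: "\<exists>W. p \<in> W \<and> holomorphic_fun M W (\<lambda>_. a)" for a
    using assms holomorphic_fun_const openin_topspace by blast
  have c: "\<And>f W. p \<in> W \<Longrightarrow> holomorphic_fun M W f \<Longrightarrow> germ M p f \<in> carrier ?R"
    by (auto simp: local_ring_def)
  have A: "germ M p f \<oplus>\<^bsub>?R\<^esub> germ M p g = germ M p (\<lambda>x. f x + g x)" for f g
    by (simp add: local_ring_def germ_add)
  have T: "germ M p f \<otimes>\<^bsub>?R\<^esub> germ M p g = germ M p (\<lambda>x. f x * g x)" for f g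
    by (simp add: local_ring_def germ_mult)
  have Z: "\<zero>\<^bsub>?R\<^esub> = germ M p (\<lambda>_. 0)" "\<one>\<^bsub>?R\<^esub> = germ M p (\<lambda>_. 1)"
    by (simp_all add: local_ring_def)
  have cl: "x \<oplus>\<^bsub>?R\<^esub> y \<in> carrier ?R" "x \<otimes>\<^bsub>?R\<^esub> y \<in> carrier ?R"
    if xy: "x \<in> carrier ?R" "y \<in> carrier ?R" for x y
  proof -
    obtain W f g where w: "p \<in> W" "holomorphic_fun M W f" "holomorphic_fun M W g"
      "x = germ M p f" "y = germ M p g"
      using local_ring_closed[OF xy] by metis
    show "x \<oplus>\<^bsub>?R\<^esub> y \<in> carrier ?R"
      unfolding w(4,5) A by (rule c[OF w(1) holomorphic_fun_add[OF w(2,3)]])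
    show "x \<otimes>\<^bsub>?R\<^esub> y \<in> carrier ?R"
      unfolding w(4,5) T by (rule c[OF w(1) holomorphic_fun_mult[OF w(2,3)]])
  qed
  have ex: "\<exists>f. x = germ M p f" if "x \<in> carrier ?R" for x
    using that by (auto simp: local_ring_def)
  show "abelian_group ?R"
  proof (rule abelian_groupI)
    show "\<zero>\<^bsub>?R\<^esub> \<in> carrier ?R" using one c Z by metis
    fix x y z assume x: "x \<in> carrier ?R" and y: "y \<in> carrier ?R"
    show "x \<oplus>\<^bsub>?R\<^esub> y \<in> carrier ?R" using cl x y by blast
    show "x \<oplus>\<^bsub>?R\<^esub> y = y \<oplus>\<^bsub>?R\<^esub> x" using ex[OF x] ex[OF y] by (auto simp: A add.commute)
    show "\<zero>\<^bsub>?R\<^esub> \<oplus>\<^bsub>?R\<^esub> x = x" using ex[OF x] by (auto simp: A Z)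
    show "x \<oplus>\<^bsub>?R\<^esub> y \<oplus>\<^bsub>?R\<^esub> z = x \<oplus>\<^bsub>?R\<^esub> (y \<oplus>\<^bsub>?R\<^esub> z)" if "z \<in> carrier ?R"
      using ex[OF x] ex[OF y] ex[OF that] by (auto simp: A add.assoc)
    obtain W f where f: "p \<in> W" "holomorphic_fun M W f" "x = germ M p f"
      using x by (auto simp: local_ring_def)
    have "holomorphic_fun M W (\<lambda>x. (-1) * f x)"
      using f(2) by (intro holomorphic_fun_mult holomorphic_fun_const) (simp_all add: holomorphic_fun_def)
    then have "germ M p (\<lambda>x. (-1) * f x) \<in> carrier ?R" using c f(1) by blast
    moreover have "germ M p (\<lambda>x. (-1) * f x) \<oplus>\<^bsub>?R\<^esub> x = \<zero>\<^bsub>?R\<^esub>" unfolding f(3) A Z by simp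
    ultimately show "\<exists>y\<in>carrier ?R. y \<oplus>\<^bsub>?R\<^esub> x = \<zero>\<^bsub>?R\<^esub>" by blast
  qed
  show "comm_monoid ?R"
  proof (rule comm_monoidI)
    show "\<one>\<^bsub>?R\<^esub> \<in> carrier ?R" using one c Z by metis
    fix x y z assume x: "x \<in> carrier ?R" and y: "y \<in> carrier ?R"
    show "x \<otimes>\<^bsub>?R\<^esub> y \<in> carrier ?R" using cl x y by blast
    show "x \<otimes>\<^bsub>?R\<^esub> y = y \<otimes>\<^bsub>?R\<^esub> x" using ex[OF x] ex[OF y] by (auto simp: T mult.commute)
    show "\<one>\<^bsub>?R\<^esub> \<otimes>\<^bsub>?R\<^esub> x = x" using ex[OF x] by (auto simp: T Z)
    show "x \<otimes>\<^bsub>?R\<^esub> y \<otimes>\<^bsub>?R\<^esub> z = x \<otimes>\<^bsub>?R\<^esub> (y \<otimes>\<^bsub>?R\<^esub> z)" if "z \<in> carrier ?R"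
      using ex[OF x] ex[OF y] ex[OF that] by (auto simp: T mult.assoc)
  qed
  fix x y z assume x: "x \<in> carrier ?R" and y: "y \<in> carrier ?R" and z: "z \<in> carrier ?R"
  show "(x \<oplus>\<^bsub>?R\<^esub> y) \<otimes>\<^bsub>?R\<^esub> z = x \<otimes>\<^bsub>?R\<^esub> z \<oplus>\<^bsub>?R\<^esub> y \<otimes>\<^bsub>?R\<^esub> z"
    using ex[OF x] ex[OF y] ex[OF z] by (auto simp: A T distrib_right)
qed

lemma plane_chart_inv:
  assumes "p \<in> U"
  shows "chart_inv (plane_chart U) (chart_map (plane_chart U) p) = p"
  unfolding chart_inv_def
proof (rule inv_into_f_f)
  show "inj_on (chart_map (plane_chart U)) (chart_dom (plane_chart U))"
    by (rule inj_on_inverseI[where g = "\<lambda>z. (z 0, z 1)"]) (simp add: plane_chart_def split: prod.split)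
  show "p \<in> chart_dom (plane_chart U)"
    using assms by (simp add: plane_chart_def)
qed

lemma complex_manifold_plane_open:
  assumes "open U"
  shows "complex_manifold (plane_open U)"
proof -
  define c where "c = plane_chart U"
  define \<phi> where "\<phi> = (\<lambda>p::complex \<times> complex. \<lambda>i::nat. if i = 0 then fst p else if i = 1 then snd p else 0)"
  define \<theta> where "\<theta> = (\<lambda>z::nat \<Rightarrow> complex. (z 0, z 1))"
  have c: "chart_dim c = 2" "chart_dom c = U" "chart_map c = \<phi>"
    by (auto simp: c_def plane_chart_def \<phi>_def fun_eq_iff)
  have \<theta>: "\<theta> (\<phi> p) = p" for p by (simp add: \<theta>_def \<phi>_def)
  have \<phi>: "\<phi> (\<theta> z) = z" if "\<forall>i\<ge>2. z i = 0" for z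
    using that by (auto simp: \<theta>_def \<phi>_def fun_eq_iff)
  have cont: "continuous_on UNIV \<phi>"
  proof (rule continuous_on_coordinatewise_then_product)
    show "continuous_on UNIV (\<lambda>p. \<phi> p i)" for i
      unfolding \<phi>_def
      using continuous_on_fst[OF continuous_on_id] continuous_on_snd[OF continuous_on_id] by (cases "i = 0"; cases "i = 1") auto
  qed
  have cont0: "continuous_on UNIV (\<lambda>z::nat \<Rightarrow> complex. z i)" for i
    by (rule continuous_on_product_coordinates)
  have cont': "continuous_on UNIV \<theta>"
    unfolding \<theta>_def by (intro continuous_on_Pair cont0)
  have im: "\<phi> ` U = {z. \<forall>i\<ge>2. z i = 0} \<inter> \<theta> -` U"
    proof (intro subset_antisym subsetI)
    fix z assume "z \<in> \<phi> ` U"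
    then obtain p where "p \<in> U" "z = \<phi> p" by blast
    then show "z \<in> {z. \<forall>i\<ge>2. z i = 0} \<inter> \<theta> -` U" using \<theta>[of p] by (simp add: \<phi>_def)
  next
    fix z assume z: "z \<in> {z. \<forall>i\<ge>2. z i = 0} \<inter> \<theta> -` U"
    then show "z \<in> \<phi> ` U" using \<phi>[of z] by (intro image_eqI[of z \<phi> "\<theta> z"]) simp_all
  qed
  have op: "openin (complex_space 2) (\<phi> ` U)"
    unfolding im complex_space_def by (rule openin_open_Int) (rule open_vimage[OF assms cont'])
  have sub: "subtopology (complex_space 2) (\<phi> ` U) = top_of_set (\<phi> ` U)"
    unfolding complex_space_def subtopology_subtopology
    using im by (intro arg_cong[where f = top_of_set]) blast
  have homeo: "homeomorphic_map (top_of_set U) (top_of_set (\<phi> ` U)) \<phi>"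
  proof -
    have "homeomorphic_maps (top_of_set U) (top_of_set (\<phi> ` U)) \<phi> \<theta>"
      unfolding homeomorphic_maps_def
      using continuous_on_subset[OF cont] continuous_on_subset[OF cont'] \<theta> by auto
    then show ?thesis
      using homeomorphic_map_maps by blast
  qed
  have sc: "second_countable (top_of_set U)"
  proof (rule second_countable_subtopology)
    obtain B :: "(complex \<times> complex) set set" where B: "countable B" "topological_basis B"
      using ex_countable_basis by blast
    show "second_countable (euclidean :: (complex \<times> complex) topology)"
      unfolding second_countable_def
    proof (intro exI[of _ B] conjI ballI allI impI)
      show "openin euclidean V" if "V \<in> B" for V
        using topological_basis_open[OF B(2) that] by simp
      show "\<exists>V\<in>B. x \<in> V \<and> V \<subseteq> G" if "openin euclidean G \<and> x \<in> G" for G x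
        using topological_basisE[OF B(2), of G x] that by (metis open_openin)
    qed (rule B)
  qed
  have hol: "holomorphic_n 2 (\<phi> ` U) (\<lambda>z. \<phi> (chart_inv c z) i)" if "i < 2" for i
  proof -
    have eq: "\<phi> (chart_inv c z) i = z i" if "z \<in> \<phi> ` U" for z
      proof -
      from that obtain p where p: "p \<in> U" "z = \<phi> p" by blast
      then have "chart_inv c z = p" using plane_chart_inv[OF p(1)] c(3) unfolding c_def by metis
      then show ?thesis using p(2) by simp
    qed
    have "continuous_on (\<phi> ` U) (\<lambda>z. \<phi> (chart_inv c z) i)"
      using continuous_on_cong[OF refl eq] continuous_on_subset[OF cont0 subset_UNIV] by (rule iffD2)
    moreover have "(\<lambda>t. \<phi> (chart_inv c (z(j := t))) i) field_differentiable at (z j)"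
      if z: "z \<in> \<phi> ` U" and j: "j < 2" for z j
    proof -
      define S where "S = (\<lambda>t. \<theta> (z(j := t))) -` U"
      have ct: "continuous_on UNIV (\<lambda>t::complex. (z(j := t)) k)" for k
        by (cases "j = k") simp_all
      have "continuous_on UNIV (\<lambda>t. \<theta> (z(j := t)))"
        unfolding \<theta>_def by (intro continuous_on_Pair ct)
      then have oS: "open S" unfolding S_def by (rule open_vimage[OF assms])
      have zS: "z j \<in> S" using z unfolding S_def im by simp
      have e: "(z(j := t)) i = \<phi> (chart_inv c (z(j := t))) i" if "t \<in> S" for t
      proof -
        have "z(j := t) \<in> \<phi> ` U" using that z j unfolding im S_def by simp
        from eq[OF this] show ?thesis by simp
      qed
      have d: "((\<lambda>t. (z(j := t)) i) has_field_derivative (if i = j then 1 else 0)) (at (z j))"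
        by simp
      have "((\<lambda>t. \<phi> (chart_inv c (z(j := t))) i) has_field_derivative (if i = j then 1 else 0)) (at (z j))"
        by (rule has_field_derivative_transform_within_open[OF d oS zS e])
      then show ?thesis
        unfolding field_differentiable_def by blast
    qed
    ultimately show ?thesis by (simp add: holomorphic_n_def)
  qed
  have m: "man_top (plane_open U) = top_of_set U" "man_atlas (plane_open U) = {c}"
    by (simp_all add: plane_open_def c_def)
  have h: "Hausdorff_space (top_of_set U)"
    by (rule Hausdorff_space_subtopology) simp
  have tt: "subtopology (top_of_set U) U = top_of_set U"
    by (simp add: subtopology_subtopology)
  have oU: "openin (top_of_set U) U" by simp
  show ?thesis
    unfolding complex_manifold_def m
  proof (intro conjI ballI allI impI)
    show "(\<Union>c'\<in>{c}. chart_dom c') = topspace (top_of_set U)" by (simp add: c)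
  next
    fix c1 assume "c1 \<in> {c}"
    then have c1: "c1 = c" by blast
    show "openin (top_of_set U) (chart_dom c1)"
      "openin (complex_space (chart_dim c1)) (chart_map c1 ` chart_dom c1)"
      "homeomorphic_map (subtopology (top_of_set U) (chart_dom c1))
        (subtopology (complex_space (chart_dim c1)) (chart_map c1 ` chart_dom c1)) (chart_map c1)"
      unfolding c1 c tt sub by (rule oU op homeo)+
    fix c2 i assume "c2 \<in> {c}" and i: "i < chart_dim c2"
    then have c2: "c2 = c" by blast
    show "holomorphic_n (chart_dim c1) (chart_map c1 ` (chart_dom c1 \<inter> chart_dom c2))
        (\<lambda>z. chart_map c2 (chart_inv c1 z) i)"
      using hol[of i] i unfolding c1 c2 c by simp
  qed (rule h sc)+
qed

lemma cring_fps2_ring: "cring fps2_ring"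
proof (rule cringI)
  show "abelian_group fps2_ring"
  proof (rule abelian_groupI)
    show "\<exists>y\<in>carrier fps2_ring. y \<oplus>\<^bsub>fps2_ring\<^esub> x = \<zero>\<^bsub>fps2_ring\<^esub>" for x
      by (rule bexI[of _ "- x"]) (simp_all add: fps2_ring_def)
  qed (simp_all add: fps2_ring_def ac_simps)
  show "comm_monoid fps2_ring"
    by (rule comm_monoidI) (simp_all add: fps2_ring_def ac_simps)
qed (simp add: fps2_ring_def distrib_right)

end

theory Submission
  imports Defs "HOL-Complex_Analysis.Cauchy_Integral_Formula"
begin

text \<open>
  Near the origin the ideal \<open>I\<close> of \<open>\<Z>(\<sigma>)\<close> contains a power of the maximal ideal \<open>\<mm>\<close> of
  \<open>\<O> = \<complex>{x,y}\<close>, so the origin is an isolated point and an isomorphism with \<open>\<Z>(d\<Phi>)\<close> gives an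
  isomorphism \<open>S/J \<cong> \<O>/I\<close> of \<open>\<complex>\<close>-algebras, where \<open>S\<close> is the local ring of \<open>M\<close> at the corresponding
  point and \<open>J\<close> is generated by the partial derivatives \<open>\<Phi>\<^sub>i\<close>. Lifting the images of local
  coordinates gives a map germ \<open>g : \<complex>\<^sup>2 \<rightarrow> M\<close> with \<open>F \<mapsto> F \<circ> g\<close> inducing this isomorphism, and the
  function \<open>\<phi> = \<Phi> \<circ> g\<close> satisfies \<open>(d\<phi>) = I\<close>, contradicting the hypothesis on \<open>\<sigma>\<close>.

  No splitting lemma is needed for \<open>(d\<phi>) = I\<close>. For every lift \<open>g\<close> the functions \<open>e\<^sub>i = \<Phi>\<^sub>i \<circ> g\<close>
  generate \<open>I\<close>. Let \<open>H\<close> be the Hessian of \<open>\<Phi>\<close>, and let \<open>a\<close>, \<open>b\<close> be the columns of the differential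
  of \<open>g\<close> at the origin. Since \<open>I \<subseteq> \<mm>\<^sup>2\<close>, these are linearly independent, and the image of \<open>H\<close>
  contains all \<open>v\<close> with \<open>a \<cdot> v = b \<cdot> v = 0\<close>. Changing \<open>g\<close> by \<open>h \<in> I\<^sup>n\<close> changes \<open>e\<close> by \<open>H h\<close>
  modulo \<open>\<mm> I\<close>; a suitable \<open>h\<close> makes all \<open>e\<^sub>i\<close> combinations of \<open>a \<cdot> e\<close> and \<open>b \<cdot> e\<close>, which
  therefore generate \<open>I\<close>. But modulo \<open>\<mm> I\<close> these are the partial derivatives of \<open>\<phi>\<close>.
\<close>

section \<open>Integrals depending holomorphically on parameters\<close>

text \<open>The hypotheses mix formal series, polynomials and convergent germs, and the isomorphism
  is one of abstract algebras, so continuity of the quotient map is not given. Everything is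
  therefore reduced to finite order. Since m^N lies in I, Taylor expansion by Hadamard's lemma to
  order N settles congruences modulo I, and to order N + 1 congruences modulo mI. Nakayama's lemma
  turns the latter into equalities of ideals; it works with finitely many generators, hence the
  explicit finite combinations throughout. The delicate point is the passage from I to mI: an
  element of I is already zero in O/I, so its class modulo mI cannot be read off from the
  isomorphism. It is recovered by approximating the element to order N + 1 by a pullback F \<circ>
  g, for then F lies in J. The inclusion of I in m^2 makes values and first derivatives at the
  origin invariant under congruence modulo I; this yields a left inverse of the differential of g,
  and with it the independence of its columns.\<close>

lemma Cauchy_mean_has_integral:
  assumes "continuous_on (cball w r) f" "f holomorphic_on ball w r" "u \<in> ball w r"
  shows "((\<lambda>t. f (circlepath w r t) * (circlepath w r t - w) / (circlepath w r t - u)) has_integral f u) {0..1}"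
proof -
  have "((\<lambda>v. f v / (v - u)) has_contour_integral (2 * of_real pi * \<i> * f u)) (circlepath w r)"
    using Cauchy_integral_circlepath[of w r f u] assms by (simp add: dist_norm norm_minus_commute)
  then have "((\<lambda>t. f (circlepath w r t) / (circlepath w r t - u) *
      (2 * pi * \<i> * r * exp (2 * of_real pi * \<i> * t))) has_integral (2 * of_real pi * \<i> * f u)) {0..1}"
    unfolding has_contour_integral_def
    by (rule has_integral_cong[THEN iffD1, rotated]) (simp add: vector_derivative_circlepath01)
  \<comment> \<open>On the circle dv = 2 \<pi> i (v - w) dt, so division by 2 \<pi> i leaves the
    weight \<open>circlepath w r t - w\<close>.\<close>
  from has_integral_mult_right[OF this, of "1 / (2 * of_real pi * \<i>)"]
  show ?thesis
    by (simp add: circlepath field_simps)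
qed

lemma circlepath_ne: "u \<in> ball w r \<Longrightarrow> circlepath w r t \<noteq> u"
  by (auto simp: circlepath dist_norm norm_mult)

text \<open>In the difference of the two Cauchy integrals, 1/(v - u) - 1/(v - w) = (u - w)/((v -
  u)(v - w)), and the factor v - w cancels against the weight. The integral is a difference quotient
  that stays meaningful at u = w, as Hadamard's lemma requires.\<close>

lemma difference_quotient_integral:
  assumes "continuous_on (cball w r) f" "f holomorphic_on ball w r" "u \<in> ball w r"
  shows "f u = f w + (u - w) * integral {0..1} (\<lambda>t. f (circlepath w r t) / (circlepath w r t - u))"
proof -
  have w: "w \<in> ball w r" using assms(3) by (auto intro: le_less_trans[OF zero_le_dist])
  have "((\<lambda>t. f (circlepath w r t) * (circlepath w r t - w) / (circlepath w r t - u) -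
      f (circlepath w r t) * (circlepath w r t - w) / (circlepath w r t - w)) has_integral f u - f w) {0..1}"
    by (intro has_integral_diff Cauchy_mean_has_integral assms w)
  moreover have "f (circlepath w r t) * (circlepath w r t - w) / (circlepath w r t - u) -
      f (circlepath w r t) * (circlepath w r t - w) / (circlepath w r t - w) =
      (u - w) * (f (circlepath w r t) / (circlepath w r t - u))" for t
  proof -
    have "x * b / a - x * b / b = (u - w) * (x / a)" if "a \<noteq> 0" "b \<noteq> 0" "b - a = u - w" for a b x :: complex
    proof -
      have "x * b / a - x * b / b = x * (b - a) / a" using that(1,2) by (simp add: field_simps)
      then show ?thesis using that(3) by (simp add: mult.commute)
    qed
    then show ?thesis
      using circlepath_ne[OF assms(3), of t] circlepath_ne[OF w, of t] by simp
  qed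
  ultimately have "integral {0..1} (\<lambda>t. (u - w) * (f (circlepath w r t) / (circlepath w r t - u))) = f u - f w"
    by (simp add: integral_unique)
  then show ?thesis unfolding integral_mult_right by simp
qed

text \<open>With the derivative written as an integral, its dependence on parameters is governed by
  the integrand alone.\<close>

lemma deriv_integral:
  assumes "continuous_on (cball w r) f" "f holomorphic_on ball w r" "u \<in> ball w r"
  shows "deriv f u =
    integral {0..1} (\<lambda>t. f (circlepath w r t) * (circlepath w r t - w) / (circlepath w r t - u)^2)"
proof -
  have "deriv f u = 1 / (2 * of_real pi * \<i>) * contour_integral (circlepath w r) (\<lambda>v. f v / (v - u)^2)"
    by (rule DERIV_imp_deriv[OF Cauchy_derivative_integral_circlepath(2)[OF assms]])
  also have "\<dots> = 1 / (2 * of_real pi * \<i>) * integral {0..1} (\<lambda>t. f (circlepath w r t) / (circlepath w r t - u)^2 *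
      (2 * pi * \<i> * r * exp (2 * of_real pi * \<i> * t)))"
    by (simp add: contour_integral_integral vector_derivative_circlepath)
  also have "\<dots> = integral {0..1} (\<lambda>t. 1 / (2 * of_real pi * \<i>) * (f (circlepath w r t) / (circlepath w r t - u)^2 *
      (2 * pi * \<i> * r * exp (2 * of_real pi * \<i> * t))))"
    by (rule integral_mult_right[symmetric])
  also have "\<dots> = integral {0..1} (\<lambda>t. f (circlepath w r t) * (circlepath w r t - w) / (circlepath w r t - u)^2)"
    by (intro integral_cong) (simp add: circlepath field_simps)
  finally show ?thesis .
qed

lemma continuous_on_circlepath [continuous_intros]:
  "continuous_on S f \<Longrightarrow> continuous_on S (\<lambda>x. circlepath w r (f x))"
  unfolding circlepath by (intro continuous_intros)

lemma circlepath_in_cball: "r \<ge> 0 \<Longrightarrow> circlepath w r t \<in> cball w r"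
  by (auto simp: circlepath dist_norm norm_mult)

text \<open>By Cauchy's formula, joint continuity of the functions already gives joint continuity of
  their derivatives. This is what the Leibniz rule asks for in the next lemma.\<close>

lemma continuous_on_deriv_param:
  fixes f :: "'a::topological_space \<Rightarrow> complex \<Rightarrow> complex"
  assumes cont: "continuous_on (P \<times> cball w r) (\<lambda>(p, u). f p u)"
    and hol: "\<And>p. p \<in> P \<Longrightarrow> f p holomorphic_on ball w r" and r: "r \<ge> 0"
  shows "continuous_on (P \<times> ball w r) (\<lambda>(p, u). deriv (f p) u)"
proof -
  let ?K = "\<lambda>(p, u) t. f p (circlepath w r t) * (circlepath w r t - w) / (circlepath w r t - u)^2"
  have "continuous_on ((P \<times> ball w r) \<times> cbox 0 1) (\<lambda>(x, t). ?K x t)"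
    unfolding split_beta
  proof (intro continuous_intros)
    show "continuous_on ((P \<times> ball w r) \<times> cbox 0 1) (\<lambda>x. f (fst (fst x)) (circlepath w r (snd x)))"
      by (rule continuous_on_compose2[OF cont, of _ "\<lambda>x. (fst (fst x), circlepath w r (snd x))", simplified])
        (auto intro!: continuous_intros simp: circlepath_in_cball[OF r, simplified])
  qed (use circlepath_ne in force)
  from integral_continuous_on_param[OF this]
  have "continuous_on (P \<times> ball w r) (\<lambda>x. integral {0..1} (?K x))" by simp
  moreover have "integral {0..1} (?K x) = (case x of (p, u) \<Rightarrow> deriv (f p) u)" if "x \<in> P \<times> ball w r" for x
  proof -
    from that obtain p u where x: "x = (p, u)" "p \<in> P" "u \<in> ball w r" by blast
    have "continuous_on (cball w r) (f p)"
      by (rule continuous_on_compose2[OF cont, of _ "\<lambda>u. (p, u)", simplified])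
        (auto intro!: continuous_intros simp: x)
    then show ?thesis
      using deriv_integral[of w r "f p" u] hol[OF x(2)] x by simp
  qed
  ultimately show ?thesis by (simp cong: continuous_on_cong)
qed

text \<open>The Leibniz rule is applied on small discs, where the derivative of the kernel is
  jointly continuous by Cauchy's formula.\<close>

lemma holomorphic_on_integral_param:
  fixes K :: "complex \<Rightarrow> real \<Rightarrow> complex"
  assumes S: "open S" and cont: "continuous_on (S \<times> {0..1}) (\<lambda>(s, t). K s t)"
    and hol: "\<And>t. t \<in> {0..1} \<Longrightarrow> (\<lambda>s. K s t) holomorphic_on S"
  shows "(\<lambda>s. integral {0..1} (K s)) holomorphic_on S"
proof -
  have "(\<lambda>s. integral {0..1} (K s)) field_differentiable at s0" if s0: "s0 \<in> S" for s0
  proof -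
    obtain r where r: "r > 0" "cball s0 r \<subseteq> S" using S s0 open_contains_cball by blast
    have "continuous_on ({0..1} \<times> ball s0 r) (\<lambda>(t, s). deriv (\<lambda>s. K s t) s)"
    proof (rule continuous_on_deriv_param)
      show "continuous_on ({0..1} \<times> cball s0 r) (\<lambda>(p, u). K u p)"
        unfolding split_beta
        by (rule continuous_on_compose2[OF cont, of _ "\<lambda>x. (snd x, fst x)", simplified])
          (use r in \<open>auto intro!: continuous_intros\<close>)
      show "(\<lambda>s. K s p) holomorphic_on ball s0 r" if "p \<in> {0..1}" for p
        using hol[OF that] r ball_subset_cball holomorphic_on_subset by (metis subset_trans)
    qed (use r in simp)
    then have c: "continuous_on (ball s0 r \<times> cbox 0 1) (\<lambda>(s, t). deriv (\<lambda>s. K s t) s)"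
    proof -
      assume c: "continuous_on ({0..1} \<times> ball s0 r) (\<lambda>(t, s). deriv (\<lambda>s. K s t) s)"
      have "continuous_on (ball s0 r \<times> cbox 0 1) (\<lambda>x. (\<lambda>(t, s). deriv (\<lambda>s. K s t) s) (snd x, fst x))"
        by (rule continuous_on_compose2[OF c]) (auto intro!: continuous_intros)
      then show ?thesis by (simp add: split_beta)
    qed
    have sub: "ball s0 r \<subseteq> S" using r by auto
    have "(\<lambda>s. integral (cbox 0 1) (K s)) holomorphic_on ball s0 r"
    proof (rule leibniz_rule_holomorphic[OF _ _ c])
      fix s t assume s: "s \<in> ball s0 r"
      show "((\<lambda>s. K s t) has_field_derivative deriv (\<lambda>s. K s t) s) (at s within ball s0 r)"
        if t: "t \<in> cbox 0 1" for t
        using holomorphic_derivI[OF hol[of t] S, of s] s t sub by auto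
      have "continuous_on {0..1} (K s)"
        by (rule continuous_on_compose2[OF cont, of _ "\<lambda>t. (s, t)", simplified])
          (use s sub in \<open>auto intro!: continuous_intros\<close>)
      then show "K s integrable_on cbox 0 1" by (simp add: integrable_continuous_real)
    qed simp
    then show ?thesis using r(1) by (simp add: holomorphic_on_imp_differentiable_at)
  qed
  then show ?thesis using field_differentiable_at_within unfolding holomorphic_on_def by blast
qed

section \<open>Germs of holomorphic functions on complex number space\<close>

abbreviation coord_space :: "nat \<Rightarrow> (nat \<Rightarrow> complex) set" where
  "coord_space n \<equiv> {z. \<forall>i\<ge>n. z i = 0}"

abbreviation nbhds :: "nat \<Rightarrow> (nat \<Rightarrow> complex) \<Rightarrow> (nat \<Rightarrow> complex) filter" where
  "nbhds n q \<equiv> nhdsin (complex_space n) q"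

text \<open>Germs at \<open>q\<close> are represented by total functions, and equality of germs by
  eventual equality in \<open>nbhds n q\<close>. Quotients appear only when the local ring of a
  manifold is reached.\<close>

definition hol :: "nat \<Rightarrow> (nat \<Rightarrow> complex) \<Rightarrow> ((nat \<Rightarrow> complex) \<Rightarrow> complex) \<Rightarrow> bool" where
  "hol n q F \<longleftrightarrow> (\<exists>S. openin (complex_space n) S \<and> q \<in> S \<and> holomorphic_n n S F)"

definition pd :: "nat \<Rightarrow> ((nat \<Rightarrow> complex) \<Rightarrow> complex) \<Rightarrow> (nat \<Rightarrow> complex) \<Rightarrow> complex" where
  "pd i F z = deriv (\<lambda>t. F (z(i := t))) (z i)"

definition polydisc :: "nat \<Rightarrow> (nat \<Rightarrow> complex) \<Rightarrow> real \<Rightarrow> (nat \<Rightarrow> complex) set" where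
  "polydisc n q r = {z \<in> coord_space n. \<forall>i<n. z i \<in> ball (q i) r}"

section \<open>Polydiscs and one-variable slices of open sets\<close>

lemma topspace_complex_space [simp]: "topspace (complex_space n) = coord_space n"
  by (simp add: complex_space_def)

lemma openin_complex_space_subset: "openin (complex_space n) S \<Longrightarrow> S \<subseteq> coord_space n"
  using openin_subset by fastforce

lemma openin_polydisc: "openin (complex_space n) (polydisc n q r)"
proof -
  have "open (\<Inter>i<n. (\<lambda>z::nat \<Rightarrow> complex. z i) -` ball (q i) r)"
    by (intro open_INT) (auto intro!: open_vimage continuous_on_product_coordinates)
  then have "openin (complex_space n) (coord_space n \<inter> (\<Inter>i<n. (\<lambda>z. z i) -` ball (q i) r))"
    unfolding complex_space_def by (rule openin_open_Int)
  also have "coord_space n \<inter> (\<Inter>i<n. (\<lambda>z. z i) -` ball (q i) r) = polydisc n q r"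
    by (auto simp: polydisc_def)
  finally show ?thesis .
qed

text \<open>A basic neighbourhood in the product topology restricts coordinates by open sets; those
  from \<open>n\<close> on are zero anyway, so finitely many radii remain and have a positive
  minimum.\<close>

lemma closed_polydisc_in_open:
  assumes "openin (complex_space n) S" "q \<in> S"
  obtains r where "r > 0" "{z \<in> coord_space n. \<forall>i<n. z i \<in> cball (q i) r} \<subseteq> S"
proof -
  obtain T where T: "open T" "S = coord_space n \<inter> T"
    using assms(1) unfolding complex_space_def openin_open by blast
  have "openin (product_topology (\<lambda>_. euclidean) UNIV) T" "q \<in> T"
    using T assms(2) by (auto simp: open_fun_def)
  from product_topology_open_contains_basis[OF this]
  obtain X where X: "q \<in> PiE UNIV X" "\<forall>i. open (X i)" "PiE UNIV X \<subseteq> T"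
    by auto
  have "\<exists>r>0. cball (q i) r \<subseteq> X i" for i
    using X(1,2) open_contains_cball by (metis PiE_mem UNIV_I)
  then obtain \<rho> where \<rho>: "\<And>i. \<rho> i > 0" "\<And>i. cball (q i) (\<rho> i) \<subseteq> X i" by metis
  \<comment> \<open>The 1 keeps the minimum defined when \<open>n = 0\<close>.\<close>
  define r where "r = Min (insert 1 (\<rho> ` {..<n}))"
  have r: "r > 0" "r \<le> \<rho> i" if "i < n" for i
    using that \<rho>(1) by (auto simp: r_def)
  have "r > 0" using \<rho>(1) by (auto simp: r_def)
  moreover have "z \<in> S" if z: "z \<in> coord_space n" "\<forall>i<n. z i \<in> cball (q i) r" for z
  proof -
    have "z i \<in> X i" for i
    proof (cases "i < n")
      case True
      then show ?thesis using z(2) r(2)[OF True] \<rho>(2)[of i] by (meson order_trans mem_cball subsetD)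
    next
      case False
      have "q \<in> coord_space n" using assms T by blast
      then have "z i = q i" using False z by simp
      then show ?thesis using \<rho>[of i] by (auto simp: subset_iff less_imp_le)
    qed
    then show ?thesis using z(1) X(3) T(2) by (auto simp: PiE_def)
  qed
  ultimately show ?thesis using that by blast
qed

lemma continuous_on_fun_upd [continuous_intros]:
  fixes f :: "'a::topological_space \<Rightarrow> nat \<Rightarrow> complex"
  assumes "continuous_on S f" "continuous_on S g"
  shows "continuous_on S (\<lambda>x. (f x)(i := g x))"
proof (rule continuous_on_coordinatewise_then_product)
  show "continuous_on S (\<lambda>x. ((f x)(i := g x)) j)" for j
    using assms continuous_on_product_then_coordinatewise[OF assms(1), of j]
    by (cases "j = i") auto
qed

lemma open_slice:
  assumes "openin (complex_space n) S" "z \<in> S" "i < n"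
  shows "open {s. z(i := s) \<in> S}"
proof -
  obtain T where T: "open T" "S = coord_space n \<inter> T"
    using assms(1) unfolding complex_space_def openin_open by blast
  have "{s. z(i := s) \<in> S} = (\<lambda>s. z(i := s)) -` T"
    using assms T by auto
  moreover have "open ((\<lambda>s. z(i := s)) -` T)"
    by (rule open_vimage[OF T(1)]) (intro continuous_intros)
  ultimately show ?thesis by simp
qed

lemma holomorphic_n_slice:
  assumes "openin (complex_space n) S" "holomorphic_n n S f" "z \<in> S" "i < n"
  shows "(\<lambda>s. f (z(i := s))) holomorphic_on {s. z(i := s) \<in> S}"
proof -
  have "(\<lambda>s. f (z(i := s))) field_differentiable at s" if "z(i := s) \<in> S" for s
    using assms(2,4) that unfolding holomorphic_n_def by fastforce
  then show ?thesis
    unfolding holomorphic_on_def using field_differentiable_at_within by blast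
qed

section \<open>Holomorphic functions of several variables and Cauchy integrals\<close>

lemma holomorphic_n_integral:
  assumes S: "openin (complex_space n) S"
    and cont: "continuous_on (S \<times> {0..1}) (\<lambda>(z, t). K z t)"
    and hol: "\<And>t. t \<in> {0..1} \<Longrightarrow> holomorphic_n n S (\<lambda>z. K z t)"
  shows "holomorphic_n n S (\<lambda>z. integral {0..1::real} (K z))"
  unfolding holomorphic_n_def
proof (intro conjI ballI allI impI)
  show "continuous_on S (\<lambda>z. integral {0..1} (K z))"
    using integral_continuous_on_param[of S 0 1 K] cont by simp
  fix z i assume z: "z \<in> S" and i: "i < n"
  have "(\<lambda>s. integral {0..1} (K (z(i := s)))) holomorphic_on {s. z(i := s) \<in> S}"
  proof (rule holomorphic_on_integral_param)
    show "open {s. z(i := s) \<in> S}" by (rule open_slice[OF S z i])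
    show "continuous_on ({s. z(i := s) \<in> S} \<times> {0..1}) (\<lambda>(s, t). K (z(i := s)) t)"
    proof -
      have "continuous_on ({s. z(i := s) \<in> S} \<times> {0..1}) (\<lambda>x. (\<lambda>(z, t). K z t) (z(i := fst x), snd x))"
        by (rule continuous_on_compose2[OF cont], intro continuous_intros) auto
      then show ?thesis by (simp add: split_beta)
    qed
    show "(\<lambda>s. K (z(i := s)) t) holomorphic_on {s. z(i := s) \<in> S}" if "t \<in> {0..1}" for t
      by (rule holomorphic_n_slice[OF S hol[OF that] z i])
  qed
  then show "(\<lambda>s. integral {0..1} (K (z(i := s)))) field_differentiable at (z i)"
    using open_slice[OF S z i] z by (auto intro: holomorphic_on_imp_differentiable_at)
qed

lemma holomorphic_n_coord: "holomorphic_n n S (\<lambda>z. z i)"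
  unfolding holomorphic_n_def
proof (intro conjI ballI allI impI)
  show "continuous_on S (\<lambda>z. z i)"
    by (rule continuous_on_subset[OF continuous_on_product_coordinates subset_UNIV])
  show "(\<lambda>t. (z(j := t)) i) field_differentiable at (z j)" for z j
    by (cases "i = j") auto
qed

lemma holomorphic_n_inverse:
  "holomorphic_n n S f \<Longrightarrow> (\<And>z. z \<in> S \<Longrightarrow> f z \<noteq> 0) \<Longrightarrow> holomorphic_n n S (\<lambda>z. inverse (f z))"
  unfolding holomorphic_n_def
  by (auto intro!: continuous_on_inverse field_differentiable_inverse)

lemma holomorphic_n_power:
  "holomorphic_n n S f \<Longrightarrow> holomorphic_n n S (\<lambda>z. f z ^ k)"
  by (induction k) (auto intro: holomorphic_n_mult holomorphic_n_const)

lemma holomorphic_n_cong: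
  assumes S: "openin (complex_space n) S" and f: "holomorphic_n n S f"
    and eq: "\<And>z. z \<in> S \<Longrightarrow> f z = g z"
  shows "holomorphic_n n S g"
  unfolding holomorphic_n_def
proof (intro conjI ballI allI impI)
  have "continuous_on S f" using f by (simp add: holomorphic_n_def)
  then show "continuous_on S g" by (rule continuous_on_eq) (rule eq)
  fix z j assume z: "z \<in> S" and j: "j < n"
  obtain d where d: "((\<lambda>t. f (z(j := t))) has_field_derivative d) (at (z j))"
    using f z j unfolding holomorphic_n_def field_differentiable_def by blast
  have "((\<lambda>t. g (z(j := t))) has_field_derivative d) (at (z j))"
    by (rule has_field_derivative_transform_within_open[OF d open_slice[OF S z j]])
      (use z eq in auto)
  then show "(\<lambda>t. g (z(j := t))) field_differentiable at (z j)"
    unfolding field_differentiable_def by blast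
qed

lemma continuous_on_override_on:
  fixes f g :: "'a::topological_space \<Rightarrow> nat \<Rightarrow> complex"
  assumes "continuous_on S f" "continuous_on S g"
  shows "continuous_on S (\<lambda>x. override_on (f x) (g x) J)"
proof (rule continuous_on_coordinatewise_then_product)
  show "continuous_on S (\<lambda>x. override_on (f x) (g x) J j)" for j
    using continuous_on_product_then_coordinatewise[OF assms(1), of j]
      continuous_on_product_then_coordinatewise[OF assms(2), of j]
    by (cases "j \<in> J") (auto simp: override_on_def)
qed

text \<open>\<open>override_on a z J\<close> takes the coordinates in \<open>J\<close> from the
  variable \<open>z\<close> and freezes the others at \<open>a\<close>. This allows partial
  derivatives and successive changes of coordinates to be treated alike.\<close>

lemma holomorphic_n_override_on:
  assumes F: "holomorphic_n n S F" and sub: "\<And>z. z \<in> B \<Longrightarrow> override_on a z J \<in> S"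
  shows "holomorphic_n n B (\<lambda>z. F (override_on a z J))"
  unfolding holomorphic_n_def
proof (intro conjI ballI allI impI)
  show "continuous_on B (\<lambda>z. F (override_on a z J))"
  proof (rule continuous_on_compose2[of S F])
    show "continuous_on S F" using F by (simp add: holomorphic_n_def)
    show "continuous_on B (\<lambda>z. override_on a z J)"
      by (intro continuous_on_override_on continuous_on_const continuous_on_id)
  qed (use sub in auto)
  fix z i assume z: "z \<in> B" and i: "i < n"
  show "(\<lambda>t. F (override_on a (z(i := t)) J)) field_differentiable at (z i)"
  proof (cases "i \<in> J")
    case True
    have "override_on a (z(i := t)) J = (override_on a z J)(i := t)" for t
      using True by (auto simp: override_on_def fun_eq_iff)
    moreover have "override_on a z J i = z i" using True by simp
    moreover have "(\<lambda>t. F ((override_on a z J)(i := t))) field_differentiable at (override_on a z J i)"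
      using F sub[OF z] i by (simp add: holomorphic_n_def)
    ultimately show ?thesis by simp
  next
    case False
    then have "override_on a (z(i := t)) J = override_on a z J" for t
      by (auto simp: override_on_def fun_eq_iff)
    then show ?thesis by simp
  qed
qed

text \<open>One kernel for two purposes. With \<open>J = - {i}\<close>, weight v - q i and
  \<open>e = 2\<close> it is the \<open>i\<close>-th partial derivative; with
  \<open>J = {..<i}\<close>, weight 1 and \<open>e = 1\<close> it is a difference quotient.\<close>

lemma holomorphic_n_Cauchy_kernel:
  assumes F: "holomorphic_n n S F" and q: "q \<in> coord_space n" and i: "i < n" "i \<notin> J" and r: "r > 0"
    and sub: "{z \<in> coord_space n. \<forall>i<n. z i \<in> cball (q i) r} \<subseteq> S"
    and w: "continuous_on {0..1} w"
  shows "holomorphic_n n (polydisc n q r) (\<lambda>z. integral {0..1}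
    (\<lambda>t. F (override_on (q(i := circlepath (q i) r t)) z J) * w t / (circlepath (q i) r t - z i) ^ e))"
proof (rule holomorphic_n_integral[OF openin_polydisc])
  let ?c = "circlepath (q i) r"
  have c: "?c t \<in> cball (q i) r" for t using r by (intro circlepath_in_cball) simp
  have S: "override_on (q(i := ?c t)) z J \<in> S" if "z \<in> polydisc n q r" for z t
    using that q i c[of t] r
    by (intro subsetD[OF sub]) (auto simp: polydisc_def override_on_def less_imp_le)
  have ne: "?c t - z i \<noteq> 0" if "z \<in> polydisc n q r" for z t
    using that i circlepath_ne[of "z i" "q i" r t] by (auto simp: polydisc_def)
  have c1: "continuous_on (polydisc n q r \<times> {0..1}) (\<lambda>x. F (override_on (q(i := ?c (snd x))) (fst x) J))"
  proof (rule continuous_on_compose2[of S F])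
    show "continuous_on S F" using F by (simp add: holomorphic_n_def)
    show "continuous_on (polydisc n q r \<times> {0..1}) (\<lambda>x. override_on (q(i := ?c (snd x))) (fst x) J)"
      by (intro continuous_on_override_on continuous_on_fun_upd continuous_on_circlepath
        continuous_on_const continuous_on_fst continuous_on_snd continuous_on_id)
  qed (use S in auto)
  have c2: "continuous_on (polydisc n q r \<times> {0..1}) (\<lambda>x. w (snd x))"
    by (rule continuous_on_compose2[OF w]) (auto intro: continuous_intros)
  have c3: "continuous_on (polydisc n q r \<times> {0..1}) (\<lambda>x. fst x i)"
    by (rule continuous_on_compose2[OF continuous_on_product_coordinates]) (auto intro: continuous_intros)
  have c4: "continuous_on (polydisc n q r \<times> {0..1}) (\<lambda>x. ?c (snd x))"
    by (intro continuous_on_circlepath continuous_on_snd continuous_on_id)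
  have "continuous_on (polydisc n q r \<times> {0..1})
      (\<lambda>x. F (override_on (q(i := ?c (snd x))) (fst x) J) * w (snd x) / (?c (snd x) - fst x i) ^ e)"
    by (intro continuous_on_divide continuous_on_mult continuous_on_power continuous_on_diff c1 c2 c3 c4)
      (use ne in auto)
  then show "continuous_on (polydisc n q r \<times> {0..1})
      (\<lambda>(z, t). F (override_on (q(i := ?c t)) z J) * w t / (?c t - z i) ^ e)"
    by (simp add: split_beta)
  show "holomorphic_n n (polydisc n q r)
      (\<lambda>z. F (override_on (q(i := ?c t)) z J) * w t / (?c t - z i) ^ e)" for t
  proof -
    have "holomorphic_n n (polydisc n q r) (\<lambda>z. ?c t + (-1) * z i)"
      by (intro holomorphic_n_add holomorphic_n_mult holomorphic_n_const holomorphic_n_coord)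
    then have "holomorphic_n n (polydisc n q r) (\<lambda>z. inverse ((?c t - z i) ^ e))"
      using ne by (intro holomorphic_n_inverse holomorphic_n_power) auto
    then have "holomorphic_n n (polydisc n q r)
        (\<lambda>z. F (override_on (q(i := ?c t)) z J) * w t * inverse ((?c t - z i) ^ e))"
      by (intro holomorphic_n_mult holomorphic_n_const holomorphic_n_override_on[OF F S])
    then show ?thesis by (simp add: divide_inverse)
  qed
qed

lemma hol_imp_coord_space: "hol n q F \<Longrightarrow> q \<in> coord_space n"
  unfolding hol_def using openin_complex_space_subset by blast

lemma slice_continuous_holomorphic:
  assumes S: "openin (complex_space n) S" "holomorphic_n n S F" and i: "i < n" "i \<notin> J" and r: "r > 0"
    and q: "q \<in> coord_space n" and z: "z \<in> polydisc n q r"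
    and sub: "{z \<in> coord_space n. \<forall>i<n. z i \<in> cball (q i) r} \<subseteq> S"
  shows "continuous_on (cball (q i) r) (\<lambda>u. F (override_on (q(i := u)) z J))"
    "(\<lambda>u. F (override_on (q(i := u)) z J)) holomorphic_on ball (q i) r"
proof -
  let ?a = "override_on q z J"
  have a: "override_on (q(i := u)) z J = ?a(i := u)" for u
    using i by (auto simp: override_on_def)
  have S': "?a(i := u) \<in> S" if "u \<in> cball (q i) r" for u
    using z q i that r by (intro subsetD[OF sub]) (auto simp: polydisc_def override_on_def less_imp_le)
  show "continuous_on (cball (q i) r) (\<lambda>u. F (override_on (q(i := u)) z J))"
    unfolding a
  proof (rule continuous_on_compose2[of S F])
    show "continuous_on S F" using S by (simp add: holomorphic_n_def)
  qed (use S' in \<open>auto intro!: continuous_on_fun_upd continuous_on_const continuous_on_id\<close>)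
  have "?a(i := q i) \<in> S" using S' r by simp
  from holomorphic_n_slice[OF S this i(1)]
  have "(\<lambda>s. F (?a(i := s))) holomorphic_on {s. ?a(i := s) \<in> S}" by simp
  then show "(\<lambda>u. F (override_on (q(i := u)) z J)) holomorphic_on ball (q i) r"
    unfolding a by (rule holomorphic_on_subset) (use S' in auto)
qed

lemma hol_pd:
  assumes "hol n q F" "i < n"
  shows "hol n q (pd i F)"
proof -
  obtain S where S: "openin (complex_space n) S" "q \<in> S" "holomorphic_n n S F"
    using assms by (auto simp: hol_def)
  obtain r where r: "r > 0" "{z \<in> coord_space n. \<forall>i<n. z i \<in> cball (q i) r} \<subseteq> S"
    using closed_polydisc_in_open[OF S(1,2)] .
  have q: "q \<in> coord_space n" using hol_imp_coord_space assms by blast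
  let ?c = "circlepath (q i) r"
  let ?I = "\<lambda>z. integral {0..1}
    (\<lambda>t. F (override_on (q(i := ?c t)) z (- {i})) * (?c t - q i) / (?c t - z i) ^ 2)"
  have "holomorphic_n n (polydisc n q r) ?I"
    using r assms(2) S(3) q
    by (intro holomorphic_n_Cauchy_kernel[of n S F]) (auto intro!: continuous_intros)
  moreover have "?I z = pd i F z" if z: "z \<in> polydisc n q r" for z
  proof -
    have e: "override_on (q(i := u)) z (- {i}) = z(i := u)" for u
      by (auto simp: override_on_def fun_eq_iff)
    have "z i \<in> ball (q i) r" using z assms(2) by (simp add: polydisc_def)
    from deriv_integral[OF slice_continuous_holomorphic[OF S(1,3) assms(2) _ r(1) q z r(2), of "- {i}"] this]
    show ?thesis by (simp add: e pd_def)
  qed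
  ultimately have "holomorphic_n n (polydisc n q r) (pd i F)"
    using holomorphic_n_cong[OF openin_polydisc] by blast
  moreover have "q \<in> polydisc n q r" using q r by (simp add: polydisc_def)
  ultimately show ?thesis unfolding hol_def using openin_polydisc[of n q r] by blast
qed

lemma eventually_nbhds:
  "q \<in> coord_space n \<Longrightarrow> eventually P (nbhds n q) \<longleftrightarrow>
    (\<exists>S. openin (complex_space n) S \<and> q \<in> S \<and> (\<forall>z\<in>S. P z))"
  unfolding eventually_nhdsin by auto

text \<open>The point moves from \<open>q\<close> to \<open>z\<close> by changing one coordinate
  after another. Each increment is z i - q i times a difference quotient, and the increments
  telescope. As \<open>G i\<close> is given by a Cauchy integral, it is holomorphic also where z i =
  q i.\<close>

lemma Hadamard:
  assumes "hol n q F"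
  obtains G where "\<And>i. i < n \<Longrightarrow> hol n q (G i)"
    "eventually (\<lambda>z. F z = F q + (\<Sum>i<n. (z i - q i) * G i z)) (nbhds n q)"
proof -
  obtain S where S: "openin (complex_space n) S" "q \<in> S" "holomorphic_n n S F"
    using assms by (auto simp: hol_def)
  obtain r where r: "r > 0" "{z \<in> coord_space n. \<forall>i<n. z i \<in> cball (q i) r} \<subseteq> S"
    using closed_polydisc_in_open[OF S(1,2)] .
  have q: "q \<in> coord_space n" using hol_imp_coord_space assms by blast
  define G where "G = (\<lambda>i z. integral {0..1} (\<lambda>t.
    F (override_on (q(i := circlepath (q i) r t)) z {..<i}) * 1 / (circlepath (q i) r t - z i) ^ 1))"
  have qr: "q \<in> polydisc n q r" using q r by (simp add: polydisc_def)
  have "hol n q (G i)" if "i < n" for i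
  proof -
    have "holomorphic_n n (polydisc n q r) (G i)"
      unfolding G_def using r that S(3) q
      by (intro holomorphic_n_Cauchy_kernel[of n S F]) (auto intro!: continuous_intros)
    then show ?thesis unfolding hol_def using openin_polydisc[of n q r] qr by blast
  qed
  moreover have "F z = F q + (\<Sum>i<n. (z i - q i) * G i z)" if z: "z \<in> polydisc n q r" for z
  proof -
    have "F (override_on q z {..<Suc i}) - F (override_on q z {..<i}) = (z i - q i) * G i z" if i: "i < n" for i
    proof -
      have e: "override_on (q(i := z i)) z {..<i} = override_on q z {..<Suc i}"
        "override_on (q(i := q i)) z {..<i} = override_on q z {..<i}"
        by (auto simp: override_on_def fun_eq_iff less_Suc_eq)
      have "z i \<in> ball (q i) r" using z i by (simp add: polydisc_def)
      from difference_quotient_integral[OF slice_continuous_holomorphic[OF S(1,3) i _ r(1) q z r(2), of "{..<i}"] this]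
      show ?thesis unfolding e by (simp add: G_def)
    qed
    then have "(\<Sum>i<n. (z i - q i) * G i z) =
        (\<Sum>i<n. F (override_on q z {..<Suc i}) - F (override_on q z {..<i}))" by simp
    also have "\<dots> = F (override_on q z {..<n}) - F (override_on q z {..<0})"
      by (rule sum_lessThan_telescope)
    also have "override_on q z {..<n} = z"
      using z q by (auto simp: override_on_def fun_eq_iff polydisc_def not_less)
    finally show ?thesis by simp
  qed
  then have "eventually (\<lambda>z. F z = F q + (\<Sum>i<n. (z i - q i) * G i z)) (nbhds n q)"
    unfolding eventually_nbhds[OF q] using openin_polydisc[of n q r] qr by blast
  ultimately show ?thesis by (rule that)
qed

section \<open>Germs at a point: locality and closure properties\<close>

lemma hol_eventually:
  assumes "hol n q F"
  shows "eventually (\<lambda>z. hol n z F) (nbhds n q)"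
proof -
  have "q \<in> coord_space n" using hol_imp_coord_space assms by blast
  then show ?thesis using assms unfolding hol_def by (subst eventually_nbhds) auto
qed

lemma holomorphic_n_imp_hol:
  "holomorphic_n n S F \<Longrightarrow> openin (complex_space n) S \<Longrightarrow> z \<in> S \<Longrightarrow> hol n z F"
  unfolding hol_def by blast

text \<open>Holomorphy is local: continuity is checked on relatively open pieces of
  \<open>T\<close>, and the one-variable condition at \<open>z\<close> sees only values near
  \<open>z\<close>.\<close>

lemma hol_imp_holomorphic_n:
  assumes "\<And>z. z \<in> T \<Longrightarrow> hol n z F" 
  shows "holomorphic_n n T F"
  unfolding holomorphic_n_def
proof (intro conjI ballI allI impI)
  have U: "\<exists>U. open U \<and> z \<in> U \<and> continuous_on (T \<inter> U) F" if z: "z \<in> T" for z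
  proof -
    obtain S where S: "openin (complex_space n) S" "z \<in> S" "holomorphic_n n S F"
      using assms[OF z] by (auto simp: hol_def)
    obtain U where U: "open U" "S = coord_space n \<inter> U"
      using S(1) unfolding complex_space_def openin_open by blast
    have "T \<subseteq> coord_space n" using assms hol_imp_coord_space by blast
    then have "T \<inter> U \<subseteq> S" using U by blast
    moreover have "continuous_on S F" using S(3) by (simp add: holomorphic_n_def)
    ultimately have "continuous_on (T \<inter> U) F" by (rule continuous_on_subset[rotated])
    moreover have "z \<in> U" using U(2) S(2) by blast
    ultimately show ?thesis using U(1) by blast
  qed
  show "continuous_on T F"
    unfolding continuous_on_eq_continuous_within
  proof
    fix z assume z: "z \<in> T"
    then obtain U where "open U" "z \<in> U" "continuous_on (T \<inter> U) F" using U by blast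
    moreover from this have "at z within T = at z within (T \<inter> U)"
      by (intro at_within_nhd[of z U]) auto
    ultimately show "continuous (at z within T) F"
      using z by (simp add: continuous_on_eq_continuous_within)
  qed
  fix z i assume "z \<in> T" "i < n"
  then show "(\<lambda>t. F (z(i := t))) field_differentiable at (z i)"
    using assms[of z] unfolding hol_def holomorphic_n_def by blast
qed

lemma eventually_nbhds_self: "eventually P (nbhds n q) \<Longrightarrow> q \<in> coord_space n \<Longrightarrow> P q"
  by (auto simp: eventually_nbhds)

lemma eventually_nbhds_eventually:
  assumes "eventually P (nbhds n q)" "q \<in> coord_space n"
  shows "eventually (\<lambda>z. eventually P (nbhds n z)) (nbhds n q)"
proof -
  obtain S where S: "openin (complex_space n) S" "q \<in> S" "\<forall>z\<in>S. P z"
    using assms by (auto simp: eventually_nbhds)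
  have "eventually P (nbhds n z)" if "z \<in> S" for z
  proof -
    have "z \<in> coord_space n" using S(1) that openin_complex_space_subset by blast
    then show ?thesis using S that by (subst eventually_nbhds) auto
  qed
  then show ?thesis using S assms(2) by (subst eventually_nbhds) auto
qed

lemma eventually_nbhds_coord_space: "eventually (\<lambda>z. z \<in> coord_space n) (nbhds n q)"
  unfolding eventually_nhdsin using openin_topspace[of "complex_space n"] by auto

lemma hol_cong:
  assumes "hol n q F" "eventually (\<lambda>z. F z = G z) (nbhds n q)"
  shows "hol n q G"
proof -
  have q: "q \<in> coord_space n" using hol_imp_coord_space assms by blast
  obtain S where S: "openin (complex_space n) S" "q \<in> S" "holomorphic_n n S F"
    using assms by (auto simp: hol_def)
  obtain T where T: "openin (complex_space n) T" "q \<in> T" "\<forall>z\<in>T. F z = G z"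
    using assms(2) by (auto simp: eventually_nbhds[OF q])
  have o: "openin (complex_space n) (S \<inter> T)" using S T by blast
  have "holomorphic_n n (S \<inter> T) G"
    by (rule holomorphic_n_cong[OF o holomorphic_n_subset[OF S(3)]]) (use T in auto)
  then show ?thesis unfolding hol_def using o S T by blast
qed

lemma hol_const: "q \<in> coord_space n \<Longrightarrow> hol n q (\<lambda>_. a)"
  unfolding hol_def using holomorphic_n_const openin_topspace[of "complex_space n"] by fastforce

lemma hol_coord: "q \<in> coord_space n \<Longrightarrow> hol n q (\<lambda>z. z i)"
  unfolding hol_def using holomorphic_n_coord openin_topspace[of "complex_space n"] by fastforce

lemma hol_common_domain:
  assumes "hol n q F" "hol n q G"
  obtains S where "openin (complex_space n) S" "q \<in> S" "holomorphic_n n S F" "holomorphic_n n S G"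
proof -
  obtain S T where S: "openin (complex_space n) S" "q \<in> S" "holomorphic_n n S F"
    and T: "openin (complex_space n) T" "q \<in> T" "holomorphic_n n T G"
    using assms by (auto simp: hol_def)
  then show ?thesis
    using that[of "S \<inter> T"] holomorphic_n_subset[OF S(3), of "S \<inter> T"] holomorphic_n_subset[OF T(3), of "S \<inter> T"]
      openin_Int[OF S(1) T(1)] by auto
qed

lemma hol_add: "hol n q F \<Longrightarrow> hol n q G \<Longrightarrow> hol n q (\<lambda>z. F z + G z)"
  by (erule hol_common_domain, assumption) (auto simp: hol_def intro: holomorphic_n_add)

lemma hol_mult: "hol n q F \<Longrightarrow> hol n q G \<Longrightarrow> hol n q (\<lambda>z. F z * G z)"
  by (erule hol_common_domain, assumption) (auto simp: hol_def intro: holomorphic_n_mult)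

lemma hol_diff: "hol n q F \<Longrightarrow> hol n q G \<Longrightarrow> hol n q (\<lambda>z. F z - G z)"
  using hol_add[of n q F "\<lambda>z. (-1) * G z"] hol_mult[OF hol_const, of q n G "-1"] hol_imp_coord_space
  by fastforce

lemma hol_uminus: "hol n q F \<Longrightarrow> hol n q (\<lambda>z. - F z)"
  using hol_diff[OF hol_const, of q n F 0] hol_imp_coord_space by fastforce

lemma hol_sum:
  "q \<in> coord_space n \<Longrightarrow> (\<And>i. i \<in> A \<Longrightarrow> hol n q (F i)) \<Longrightarrow> hol n q (\<lambda>z. \<Sum>i\<in>A. F i z)"
  by (induction A rule: infinite_finite_induct) (auto intro: hol_add hol_const)

lemma hol_power: "hol n q F \<Longrightarrow> hol n q (\<lambda>z. F z ^ k)"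
  by (induction k) (auto intro: hol_mult hol_const dest: hol_imp_coord_space)

lemmas hol_intros = hol_const hol_coord hol_add hol_mult hol_diff hol_uminus hol_sum hol_power

lemma hol_tendsto_nbhds:
  assumes "hol n q F"
  shows "(F \<longlongrightarrow> F q) (nbhds n q)"
proof (rule tendstoI)
  fix e :: real assume e: "e > 0"
  have q: "q \<in> coord_space n" using hol_imp_coord_space assms by blast
  obtain S where S: "openin (complex_space n) S" "q \<in> S" "holomorphic_n n S F"
    using assms by (auto simp: hol_def)
  have "openin (top_of_set S) (S \<inter> F -` ball (F q) e)"
    using S(3) unfolding holomorphic_n_def by (intro continuous_openin_preimage_gen) auto
  then have "openin (complex_space n) (S \<inter> F -` ball (F q) e)"
    using S(1) unfolding complex_space_def by (rule openin_trans)
  then show "eventually (\<lambda>z. dist (F z) (F q) < e) (nbhds n q)"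
    unfolding eventually_nbhds[OF q] using S(2) e
    by (intro exI[of _ "S \<inter> F -` ball (F q) e"]) (auto simp: dist_commute)
qed

lemma hol_eventually_nonzero:
  assumes "hol n q F" "F q \<noteq> 0"
  shows "eventually (\<lambda>z. F z \<noteq> 0) (nbhds n q)"
  using hol_tendsto_nbhds[OF assms(1)] assms(2) by (rule tendsto_imp_eventually_ne)

lemma hol_inverse:
  assumes "hol n q F" "F q \<noteq> 0"
  shows "hol n q (\<lambda>z. inverse (F z))"
proof -
  have q: "q \<in> coord_space n" using hol_imp_coord_space assms by blast
  obtain T where T: "openin (complex_space n) T" "q \<in> T" "\<forall>z\<in>T. hol n z F \<and> F z \<noteq> 0"
    using eventually_conj[OF hol_eventually[OF assms(1)] hol_eventually_nonzero[OF assms]]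
    unfolding eventually_nbhds[OF q] by blast
  then have "holomorphic_n n T (\<lambda>z. inverse (F z))"
    by (intro holomorphic_n_inverse hol_imp_holomorphic_n) auto
  then show ?thesis using T holomorphic_n_imp_hol by blast
qed

lemma filterlim_nbhds:
  assumes q: "q \<in> coord_space n" and T: "\<And>i. i < n \<Longrightarrow> ((\<lambda>t. \<gamma> t i) \<longlongrightarrow> q i) T"
    and z: "\<And>t. \<gamma> t \<in> coord_space n"
  shows "filterlim \<gamma> (nbhds n q) T"
proof (rule filterlim_iff[THEN iffD2], intro allI impI)
  fix P assume "eventually P (nbhds n q)"
  then obtain S where S: "openin (complex_space n) S" "q \<in> S" "\<forall>z\<in>S. P z"
    unfolding eventually_nbhds[OF q] by blast
  obtain r where r: "r > 0" "{z \<in> coord_space n. \<forall>i<n. z i \<in> cball (q i) r} \<subseteq> S"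
    using closed_polydisc_in_open[OF S(1,2)] .
  have "eventually (\<lambda>t. \<forall>i\<in>{..<n}. dist (\<gamma> t i) (q i) < r) T"
    using tendstoD[OF T r(1)] by (intro eventually_ball_finite) auto
  then show "eventually (\<lambda>t. P (\<gamma> t)) T"
  proof (rule eventually_mono)
    fix t assume "\<forall>i\<in>{..<n}. dist (\<gamma> t i) (q i) < r"
    then have "\<gamma> t \<in> S" using z[of t] by (intro subsetD[OF r(2)]) (auto simp: dist_commute less_imp_le)
    then show "P (\<gamma> t)" using S by blast
  qed
qed

text \<open>A product rule for a second factor that is merely continuous, possible because the first
  factor vanishes at \<open>t0\<close>. In the chain rule the second factors are Hadamard quotients
  along a curve.\<close>

lemma DERIV_mult_vanishing:
  fixes f g :: "complex \<Rightarrow> complex"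
  assumes "(f has_field_derivative d) (at t0)" "f t0 = 0" "isCont g t0"
  shows "((\<lambda>t. f t * g t) has_field_derivative d * g t0) (at t0)"
proof -
  obtain h where h: "\<And>z. f z - f t0 = h z * (z - t0)" "isCont h t0" "h t0 = d"
    using assms(1) unfolding CARAT_DERIV by blast
  have "f z * g z - f t0 * g t0 = (h z * g z) * (z - t0)" for z
    using h(1)[of z] assms(2) by (simp add: ac_simps)
  moreover have "isCont (\<lambda>z. h z * g z) t0" using h assms by (intro isCont_mult)
  ultimately show ?thesis unfolding CARAT_DERIV using h(3) by (intro exI[of _ "\<lambda>z. h z * g z"]) auto
qed

section \<open>Partial derivatives and the chain rule\<close>

lemma pdI: "((\<lambda>t. F (q(i := t))) has_field_derivative D) (at (q i)) \<Longrightarrow> pd i F q = D"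
  unfolding pd_def by (rule DERIV_imp_deriv)

lemma hol_has_pd:
  "hol n q F \<Longrightarrow> i < n \<Longrightarrow> ((\<lambda>t. F (q(i := t))) has_field_derivative pd i F q) (at (q i))"
  unfolding hol_def holomorphic_n_def pd_def using field_differentiable_derivI by fastforce

lemma filterlim_slice:
  assumes "q \<in> coord_space n" "i < n"
  shows "filterlim (\<lambda>t. q(i := t)) (nbhds n q) (nhds (q i))"
proof (rule filterlim_nbhds[OF assms(1)])
  fix j
  show "((\<lambda>t. (q(i := t)) j) \<longlongrightarrow> q j) (nhds (q i))"
    by (cases "j = i") (auto intro: filterlim_ident)
qed (use assms in auto)

lemma pd_cong:
  assumes "eventually (\<lambda>z. F z = G z) (nbhds n q)" "q \<in> coord_space n" "i < n"
  shows "pd i F q = pd i G q"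
  unfolding pd_def
proof (rule deriv_cong_ev)
  show "eventually (\<lambda>t. F (q(i := t)) = G (q(i := t))) (nhds (q i))"
    using filterlim_slice[OF assms(2,3)] assms(1) by (rule eventually_compose_filterlim[rotated])
qed simp

lemma pd_cong_eventually:
  assumes "eventually (\<lambda>z. F z = G z) (nbhds n q)" "q \<in> coord_space n" "i < n"
  shows "eventually (\<lambda>z. pd i F z = pd i G z) (nbhds n q)"
  using eventually_nbhds_eventually[OF assms(1,2)] eventually_nbhds_coord_space[of n q]
  by eventually_elim (rule pd_cong[OF _ _ assms(3)])

lemma pd_const [simp]: "pd i (\<lambda>_. a) q = 0"
  by (rule pdI) simp

lemma pd_coord [simp]: "pd i (\<lambda>z. z j) q = (if i = j then 1 else 0)"
  by (rule pdI) (cases "i = j"; simp)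

lemma pd_add:
  "hol n q F \<Longrightarrow> hol n q G \<Longrightarrow> i < n \<Longrightarrow> pd i (\<lambda>z. F z + G z) q = pd i F q + pd i G q"
  by (rule pdI) (auto intro!: DERIV_add hol_has_pd)

lemma pd_diff:
  "hol n q F \<Longrightarrow> hol n q G \<Longrightarrow> i < n \<Longrightarrow> pd i (\<lambda>z. F z - G z) q = pd i F q - pd i G q"
  by (rule pdI) (auto intro!: DERIV_diff hol_has_pd)

lemma pd_mult:
  assumes "hol n q F" "hol n q G" "i < n"
  shows "pd i (\<lambda>z. F z * G z) q = pd i F q * G q + F q * pd i G q"
  using DERIV_mult[OF hol_has_pd[OF assms(1,3)] hol_has_pd[OF assms(2,3)]]
  by (intro pdI) (simp add: algebra_simps)

lemma pd_sum:
  "(\<And>j. j \<in> A \<Longrightarrow> hol n q (F j)) \<Longrightarrow> i < n \<Longrightarrow> pd i (\<lambda>z. \<Sum>j\<in>A. F j z) q = (\<Sum>j\<in>A. pd i (F j) q)"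
  by (rule pdI) (auto intro!: DERIV_sum hol_has_pd)

lemma pd_linear_combination:
  assumes "q \<in> coord_space n" "i < n" "\<And>j. j \<in> A \<Longrightarrow> hol n q (F j)" "\<And>j. j \<in> A \<Longrightarrow> hol n q (G j)"
  shows "pd i (\<lambda>z. \<Sum>j\<in>A. F j z * G j z) q = (\<Sum>j\<in>A. pd i (F j) q * G j q + F j q * pd i (G j) q)"
  using assms by (subst pd_sum[of _ n]) (auto intro!: hol_mult sum.cong pd_mult)

lemma pd_Hadamard_sum:
  assumes z: "z \<in> coord_space n" and j: "j < n" and G: "\<And>i. i < n \<Longrightarrow> hol n z (G i)" and F: "hol n z F"
  shows "pd j (\<lambda>z. F z + (\<Sum>i<n. (z i - q i) * G i z)) z =
    pd j F z + G j z + (\<Sum>i<n. (z i - q i) * pd j (G i) z)"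
proof -
  have "pd j (\<lambda>z. F z + (\<Sum>i<n. (z i - q i) * G i z)) z =
      pd j F z + pd j (\<lambda>z. \<Sum>i<n. (z i - q i) * G i z) z"
    using z G F by (intro pd_add[OF _ _ j] hol_intros) auto
  also have "pd j (\<lambda>z. \<Sum>i<n. (z i - q i) * G i z) z =
      (\<Sum>i<n. pd j (\<lambda>z. z i - q i) z * G i z + (z i - q i) * pd j (G i) z)"
    using z G by (intro pd_linear_combination[OF z j] hol_intros) auto
  also have "\<dots> = (\<Sum>i<n. (if j = i then G i z else 0) + (z i - q i) * pd j (G i) z)"
    using z j by (intro sum.cong refl) (auto simp: pd_diff[of n] hol_coord hol_const)
  finally show ?thesis using j by (simp add: sum.distrib)
qed

lemma Hadamard_pd:
  assumes F: "hol n q F"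
  obtains G where "\<And>i. i < n \<Longrightarrow> hol n q (G i)" "\<And>i. i < n \<Longrightarrow> G i q = pd i F q"
    "eventually (\<lambda>z. F z = F q + (\<Sum>i<n. (z i - q i) * G i z)) (nbhds n q)"
proof -
  have q: "q \<in> coord_space n" using hol_imp_coord_space F by blast
  obtain G where G: "\<And>i. i < n \<Longrightarrow> hol n q (G i)"
    "eventually (\<lambda>z. F z = F q + (\<Sum>i<n. (z i - q i) * G i z)) (nbhds n q)"
    using Hadamard[OF F] by blast
  moreover have "G j q = pd j F q" if j: "j < n" for j
  proof -
    have "pd j F q = pd j (\<lambda>z. F q + (\<Sum>i<n. (z i - q i) * G i z)) q"
      by (rule pd_cong[OF G(2) q j])
    also have "\<dots> = G j q" using pd_Hadamard_sum[OF q j G(1) hol_const[OF q]] by simp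
    finally show ?thesis by simp
  qed
  ultimately show ?thesis using that by blast
qed

text \<open>Substituting the curve into Hadamard's expansion leaves products of \<gamma> t i - q i,
  which vanishes at \<open>t0\<close>, with a continuous factor whose value at \<open>t0\<close> is
  the partial derivative.\<close>

lemma chain_rule:
  assumes F: "hol n q F" and d: "\<And>i. i < n \<Longrightarrow> ((\<lambda>t. \<gamma> t i) has_field_derivative d i) (at t0)"
    and \<gamma>: "\<gamma> t0 = q" "\<And>t. \<gamma> t \<in> coord_space n"
  shows "((\<lambda>t. F (\<gamma> t)) has_field_derivative (\<Sum>i<n. pd i F q * d i)) (at t0)"
proof -
  have q: "q \<in> coord_space n" using hol_imp_coord_space F by blast
  obtain G where G: "\<And>i. i < n \<Longrightarrow> hol n q (G i)" "\<And>i. i < n \<Longrightarrow> G i q = pd i F q"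
    "eventually (\<lambda>z. F z = F q + (\<Sum>i<n. (z i - q i) * G i z)) (nbhds n q)"
    using Hadamard_pd[OF F] by blast
  have lim: "filterlim \<gamma> (nbhds n q) (nhds t0)"
  proof (rule filterlim_nbhds[OF q])
    show "((\<lambda>t. \<gamma> t i) \<longlongrightarrow> q i) (nhds t0)" if "i < n" for i
      using DERIV_isCont[OF d[OF that]] \<gamma>(1) by (simp add: isCont_def tendsto_nhds_iff)
  qed (rule \<gamma>)
  have "((\<lambda>t. F q + (\<Sum>i<n. (\<gamma> t i - q i) * G i (\<gamma> t))) has_field_derivative
      (0 + (\<Sum>i<n. d i * G i (\<gamma> t0)))) (at t0)"
  proof (intro DERIV_add DERIV_const DERIV_sum DERIV_mult_vanishing)
    fix i assume "i \<in> {..<n}"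
    then have i: "i < n" by simp
    show "((\<lambda>t. \<gamma> t i - q i) has_field_derivative d i) (at t0)"
      using DERIV_diff[OF d[OF i] DERIV_const[of "q i"]] by simp
    show "isCont (\<lambda>t. G i (\<gamma> t)) t0"
      using filterlim_compose[OF hol_tendsto_nbhds[OF G(1)[OF i]] lim] \<gamma>(1)
      by (simp add: isCont_def tendsto_nhds_iff)
  qed (simp add: \<gamma>)
  moreover have "eventually (\<lambda>t. F (\<gamma> t) = F q + (\<Sum>i<n. (\<gamma> t i - q i) * G i (\<gamma> t))) (nhds t0)"
    using G(3) lim by (rule eventually_compose_filterlim)
  ultimately have "((\<lambda>t. F (\<gamma> t)) has_field_derivative (0 + (\<Sum>i<n. d i * G i (\<gamma> t0)))) (at t0)"
    by (subst DERIV_cong_ev[OF refl _ refl])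
  then show ?thesis by (simp add: \<gamma> G(2) mult.commute)
qed

text \<open>Differentiating Hadamard's expansion twice expresses the mixed derivative at
  \<open>q\<close> as the sum of \<open>pd i (G j) q\<close> and \<open>pd j (G i) q\<close>, which
  is symmetric.\<close>

lemma pd_commute:
  assumes F: "hol n q F" and i: "i < n" and j: "j < n"
  shows "pd i (pd j F) q = pd j (pd i F) q"
proof -
  have q: "q \<in> coord_space n" using hol_imp_coord_space F by blast
  obtain G where G: "\<And>i. i < n \<Longrightarrow> hol n q (G i)"
    "eventually (\<lambda>z. F z = F q + (\<Sum>i<n. (z i - q i) * G i z)) (nbhds n q)"
    using Hadamard[OF F] by blast
  have "pd i (pd j F) q = pd i (G j) q + pd j (G i) q" if i: "i < n" and j: "j < n" for i j
  proof -
    have "eventually (\<lambda>z. \<forall>a\<in>{..<n}. hol n z (G a)) (nbhds n q)"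
      using G(1) by (intro eventually_ball_finite) (auto intro: hol_eventually)
    then have "eventually (\<lambda>z. pd j F z = G j z + (\<Sum>a<n. (z a - q a) * pd j (G a) z)) (nbhds n q)"
      using pd_cong_eventually[OF G(2) q j] eventually_nbhds_coord_space[of n q]
    proof eventually_elim
      fix z assume hol: "\<forall>a\<in>{..<n}. hol n z (G a)" and z: "z \<in> coord_space n"
        and eq: "pd j F z = pd j (\<lambda>z. F q + (\<Sum>i<n. (z i - q i) * G i z)) z"
      show "pd j F z = G j z + (\<Sum>a<n. (z a - q a) * pd j (G a) z)"
        unfolding eq using pd_Hadamard_sum[OF z j _ hol_const[OF z]] hol by simp
    qed
    then have "pd i (pd j F) q = pd i (\<lambda>z. G j z + (\<Sum>a<n. (z a - q a) * pd j (G a) z)) q"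
      by (rule pd_cong[OF _ q i])
    also have "\<dots> = pd i (G j) q + pd j (G i) q"
      using pd_Hadamard_sum[OF q i hol_pd[OF G(1) j] G(1)[OF j]] by simp
    finally show ?thesis .
  qed
  from this[OF i j] this[OF j i] show ?thesis by simp
qed

text \<open>Points of complex \<open>n\<close>-space are sequences that vanish from index
  \<open>n\<close> on; the cut-off makes any family of component functions land there.\<close>

definition tuple :: "nat \<Rightarrow> (nat \<Rightarrow> complex) \<Rightarrow> nat \<Rightarrow> complex" where
  "tuple n v = (\<lambda>i. if i < n then v i else 0)"

lemma tuple_in_coord_space: "tuple n v \<in> coord_space n"
  by (simp add: tuple_def)

lemma tuple_coord_space: "z \<in> coord_space n \<Longrightarrow> tuple n z = z"
  by (auto simp: tuple_def fun_eq_iff)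

lemma tuple_eqI: "q \<in> coord_space n \<Longrightarrow> (\<And>i. i < n \<Longrightarrow> v i = q i) \<Longrightarrow> tuple n v = q"
  by (auto simp: tuple_def fun_eq_iff)

lemma filterlim_tuple:
  assumes "q \<in> coord_space n" "\<And>i. i < n \<Longrightarrow> hol m p (g i)" "\<And>i. i < n \<Longrightarrow> g i p = q i"
  shows "filterlim (\<lambda>z. tuple n (\<lambda>i. g i z)) (nbhds n q) (nbhds m p)"
proof (rule filterlim_nbhds)
  fix i assume i: "i < n"
  then have "((\<lambda>z. g i z) \<longlongrightarrow> q i) (nbhds m p)"
    using hol_tendsto_nbhds[OF assms(2)[OF i]] assms(3) by simp
  then show "((\<lambda>z. tuple n (\<lambda>i. g i z) i) \<longlongrightarrow> q i) (nbhds m p)" using i by (simp add: tuple_def)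
qed (use assms tuple_in_coord_space in auto)

lemma chain_rule_tuple:
  assumes F: "hol n q F" and g: "\<And>i. i < n \<Longrightarrow> hol m p (g i)" "\<And>i. i < n \<Longrightarrow> g i p = q i" and j: "j < m"
  shows "((\<lambda>t. F (tuple n (\<lambda>i. g i (p(j := t))))) has_field_derivative
    (\<Sum>i<n. pd i F q * pd j (g i) p)) (at (p j))"
proof (rule chain_rule[OF F])
  have q: "q \<in> coord_space n" using hol_imp_coord_space F by blast
  show "((\<lambda>t. tuple n (\<lambda>i. g i (p(j := t))) i) has_field_derivative pd j (g i) p) (at (p j))"
    if "i < n" for i
    using hol_has_pd[OF g(1)[OF that] j] that by (simp add: tuple_def)
  show "tuple n (\<lambda>i. g i (p(j := p j))) = q" using g(2) q by (intro tuple_eqI) auto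
qed (rule tuple_in_coord_space)

lemma pd_compose:
  assumes F: "hol n q F" and g: "\<And>i. i < n \<Longrightarrow> hol m p (g i)" "\<And>i. i < n \<Longrightarrow> g i p = q i" and j: "j < m"
  shows "pd j (\<lambda>z. F (tuple n (\<lambda>i. g i z))) p = (\<Sum>i<n. pd i F q * pd j (g i) p)"
  by (rule pdI[OF chain_rule_tuple[OF assms]])

lemma hol_compose:
  assumes F: "hol n q F" and p: "p \<in> coord_space m"
    and g: "\<And>i. i < n \<Longrightarrow> hol m p (g i)" "\<And>i. i < n \<Longrightarrow> g i p = q i"
  shows "hol m p (\<lambda>z. F (tuple n (\<lambda>i. g i z)))"
proof -
  have q: "q \<in> coord_space n" using hol_imp_coord_space F by blast
  have lim: "filterlim (\<lambda>z. tuple n (\<lambda>i. g i z)) (nbhds n q) (nbhds m p)"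
    by (rule filterlim_tuple[OF q g])
  have "eventually (\<lambda>z. hol n (tuple n (\<lambda>i. g i z)) F) (nbhds m p)"
    using hol_eventually[OF F] lim by (rule eventually_compose_filterlim)
  moreover have "eventually (\<lambda>z. \<forall>i\<in>{..<n}. hol m z (g i)) (nbhds m p)"
    using g(1) by (intro eventually_ball_finite) (auto intro: hol_eventually)
  ultimately obtain T where T: "openin (complex_space m) T" "p \<in> T"
    "\<And>z. z \<in> T \<Longrightarrow> hol n (tuple n (\<lambda>i. g i z)) F" "\<And>z i. z \<in> T \<Longrightarrow> i < n \<Longrightarrow> hol m z (g i)"
    using eventually_conj[of _ "nbhds m p"] unfolding eventually_nbhds[OF p]
    by (smt (verit, best) IntE lessThan_iff openin_Int IntI)
  have "holomorphic_n m T (\<lambda>z. F (tuple n (\<lambda>i. g i z)))"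
    unfolding holomorphic_n_def
  proof (intro conjI ballI allI impI)
    let ?V = "(\<lambda>z. tuple n (\<lambda>i. g i z)) ` T"
    have "holomorphic_n n ?V F" using T(3) by (intro hol_imp_holomorphic_n) auto
    then have "continuous_on ?V F" by (simp add: holomorphic_n_def)
    moreover have "continuous_on T (\<lambda>z. tuple n (\<lambda>i. g i z))"
    proof (rule continuous_on_coordinatewise_then_product)
      fix i
      show "continuous_on T (\<lambda>z. tuple n (\<lambda>i. g i z) i)"
      proof (cases "i < n")
        case True
        then have "holomorphic_n m T (g i)" using T(4) by (intro hol_imp_holomorphic_n) auto
        then show ?thesis using True by (simp add: tuple_def holomorphic_n_def)
      qed (simp add: tuple_def)
    qed
    ultimately show "continuous_on T (\<lambda>z. F (tuple n (\<lambda>i. g i z)))"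
      by (rule continuous_on_compose2) auto
    fix z j assume z: "z \<in> T" and j: "j < m"
    have "((\<lambda>t. F (tuple n (\<lambda>i. g i (z(j := t))))) has_field_derivative
        (\<Sum>i<n. pd i F (tuple n (\<lambda>i. g i z)) * pd j (g i) z)) (at (z j))"
      by (rule chain_rule_tuple[OF T(3)[OF z] T(4)[OF z] _ j]) (simp_all add: tuple_def)
    then show "(\<lambda>t. F (tuple n (\<lambda>i. g i (z(j := t))))) field_differentiable at (z j)"
      unfolding field_differentiable_def by blast
  qed
  then show ?thesis unfolding hol_def using T by blast
qed

section \<open>Ideals of germs\<close>

text \<open>An ideal of the local ring, encoded as a predicate on representing functions. The axiom
  \<open>cong\<close> makes it depend on germs only.\<close>

locale germ_ideal =
  fixes n :: nat and q :: "nat \<Rightarrow> complex" and V :: "((nat \<Rightarrow> complex) \<Rightarrow> complex) \<Rightarrow> bool"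
  assumes q: "q \<in> coord_space n"
    and zero: "V (\<lambda>_. 0)"
    and add: "V f \<Longrightarrow> V g \<Longrightarrow> V (\<lambda>z. f z + g z)"
    and mult: "hol n q a \<Longrightarrow> V f \<Longrightarrow> V (\<lambda>z. a z * f z)"
    and cong: "V f \<Longrightarrow> eventually (\<lambda>z. f z = g z) (nbhds n q) \<Longrightarrow> V g"
begin

lemma ext: "V f \<Longrightarrow> (\<And>z. f z = g z) \<Longrightarrow> V g"
  by (erule cong) simp

lemma scale: "V f \<Longrightarrow> V (\<lambda>z. c * f z)"
  by (rule mult[OF hol_const[OF q]])

lemma uminus: "V f \<Longrightarrow> V (\<lambda>z. - f z)"
  by (rule ext[OF scale[of f "-1"]]) simp_all

lemma diff: "V f \<Longrightarrow> V g \<Longrightarrow> V (\<lambda>z. f z - g z)"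
  by (rule ext[OF add[OF _ uminus]]) simp_all

lemma sum: "(\<And>i. i \<in> A \<Longrightarrow> V (f i)) \<Longrightarrow> V (\<lambda>z. \<Sum>i\<in>A. f i z)"
  by (induction A rule: infinite_finite_induct) (auto intro: zero add)

lemma mult_right: "V f \<Longrightarrow> hol n q a \<Longrightarrow> V (\<lambda>z. f z * a z)"
  using mult[of a f] by (simp add: mult.commute)

end

definition cong_mod :: "(('a \<Rightarrow> complex) \<Rightarrow> bool) \<Rightarrow> ('a \<Rightarrow> complex) \<Rightarrow> ('a \<Rightarrow> complex) \<Rightarrow> bool" where
  "cong_mod V f g \<longleftrightarrow> V (\<lambda>z. f z - g z)"

context germ_ideal
begin

lemma cong_refl: "cong_mod V f f"
  by (simp add: cong_mod_def zero)

lemma cong_sym: "cong_mod V f g \<Longrightarrow> cong_mod V g f"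
  unfolding cong_mod_def by (drule uminus) simp

lemma cong_trans: "cong_mod V f g \<Longrightarrow> cong_mod V g h \<Longrightarrow> cong_mod V f h"
  unfolding cong_mod_def by (drule (1) add) simp

lemma cong_add: "cong_mod V f f' \<Longrightarrow> cong_mod V g g' \<Longrightarrow> cong_mod V (\<lambda>z. f z + g z) (\<lambda>z. f' z + g' z)"
  unfolding cong_mod_def by (drule (1) add) (simp add: algebra_simps)

lemma cong_sum:
  "(\<And>i. i \<in> A \<Longrightarrow> cong_mod V (f i) (g i)) \<Longrightarrow> cong_mod V (\<lambda>z. \<Sum>i\<in>A. f i z) (\<lambda>z. \<Sum>i\<in>A. g i z)"
  using sum[of A "\<lambda>i z. f i z - g i z"] by (simp add: cong_mod_def sum_subtractf)

lemma cong_mult: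
  assumes "cong_mod V f f'" "cong_mod V g g'" "hol n q f" "hol n q g'"
  shows "cong_mod V (\<lambda>z. f z * g z) (\<lambda>z. f' z * g' z)"
  unfolding cong_mod_def
  using add[OF mult[OF assms(3)] mult[OF assms(4)], of "\<lambda>z. g z - g' z" "\<lambda>z. f z - f' z"] assms(1,2)
  by (simp add: cong_mod_def algebra_simps)

lemma cong_eventually: "eventually (\<lambda>z. f z = g z) (nbhds n q) \<Longrightarrow> cong_mod V f g"
  unfolding cong_mod_def by (rule cong[OF zero]) (erule eventually_mono, simp)

lemma cong_mem: "cong_mod V f g \<Longrightarrow> V f \<longleftrightarrow> V g"
  unfolding cong_mod_def using ext[OF add, of g "\<lambda>z. f z - g z" f] ext[OF diff, of f "\<lambda>z. f z - g z" g]
  by auto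

text \<open>Nakayama's lemma; the generators are eliminated one at a time.\<close>

lemma Nakayama_coefficients:
  fixes k :: nat
  assumes "\<And>i j. i < k \<Longrightarrow> j < k \<Longrightarrow> hol n q (\<mu> i j) \<and> \<mu> i j q = 0"
    and "\<And>i. i < k \<Longrightarrow> V (\<lambda>z. w i z - (\<Sum>j<k. \<mu> i j z * w j z))"
  shows "\<forall>i<k. V (w i)"
  using assms
proof (induction k arbitrary: \<mu>)
  case (Suc k)
  \<comment> \<open>The function 1 - \<mu> k k has value 1 at \<open>q\<close>, so it is a unit and
    the last relation can be solved for \<open>w k\<close>.\<close>
  let ?u = "\<lambda>z. inverse (1 - \<mu> k k z)"
  have h: "hol n q (\<lambda>z. 1 - \<mu> k k z)"
    using Suc.prems(1)[of k k] q by (intro hol_intros) auto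
  have u: "hol n q ?u" using hol_inverse[OF h] Suc.prems(1)[of k k] by simp
  have "eventually (\<lambda>z. 1 - \<mu> k k z \<noteq> 0) (nbhds n q)"
    using hol_eventually_nonzero[OF h] Suc.prems(1)[of k k] by simp
  then have "eventually (\<lambda>z. ?u z * (w k z - (\<Sum>j<Suc k. \<mu> k j z * w j z)) =
      w k z - (\<Sum>j<k. ?u z * \<mu> k j z * w j z)) (nbhds n q)"
  proof eventually_elim
    case (elim z)
    have "?u z * (w k z - (\<Sum>j<Suc k. \<mu> k j z * w j z)) =
        ?u z * (1 - \<mu> k k z) * w k z - ?u z * (\<Sum>j<k. \<mu> k j z * w j z)"
      by (simp add: algebra_simps)
    then show ?case using elim by (simp add: sum_distrib_left mult.assoc)
  qed
  then have k: "V (\<lambda>z. w k z - (\<Sum>j<k. ?u z * \<mu> k j z * w j z))"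
    by (rule cong[OF mult[OF u Suc.prems(2)], rotated]) simp
  \<comment> \<open>Coefficients after substituting the solved relation for \<open>w k\<close>. They
    still vanish at \<open>q\<close>, so the induction hypothesis applies to the remaining
    generators.\<close>
  let ?\<nu> = "\<lambda>i j z. \<mu> i j z + \<mu> i k z * (?u z * \<mu> k j z)"
  have IH: "\<forall>i<k. V (w i)"
  proof (rule Suc.IH[of ?\<nu>])
    show "hol n q (?\<nu> i j) \<and> ?\<nu> i j q = 0" if "i < k" "j < k" for i j
    proof -
      have a: "hol n q (\<mu> i j)" "hol n q (\<mu> i k)" "hol n q (\<mu> k j)" "\<mu> i j q = 0" "\<mu> i k q = 0"
        using that Suc.prems(1)[of i j] Suc.prems(1)[of i k] Suc.prems(1)[of k j] by auto
      show ?thesis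
        using hol_add[OF a(1) hol_mult[OF a(2) hol_mult[OF u a(3)]]] a by simp
    qed
    fix i assume i: "i < k"
    have "V (\<lambda>z. (w i z - (\<Sum>j<Suc k. \<mu> i j z * w j z)) +
        \<mu> i k z * (w k z - (\<Sum>j<k. ?u z * \<mu> k j z * w j z)))"
      using i Suc.prems(1)[of i k] by (intro add mult k Suc.prems(2)) auto
    then show "V (\<lambda>z. w i z - (\<Sum>j<k. ?\<nu> i j z * w j z))"
      by (rule ext) (simp add: algebra_simps sum.distrib sum_distrib_left)
  qed
  moreover have "V (w k)"
  proof -
    have "V (\<lambda>z. \<Sum>j<k. ?u z * \<mu> k j z * w j z)"
      using IH u Suc.prems(1) by (intro sum mult hol_mult) auto
    from add[OF k this] show ?thesis by simp
  qed
  ultimately show ?case by (auto simp: less_Suc_eq)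
qed simp

lemma Nakayama:
  fixes k :: nat
  assumes "\<And>i. i < k \<Longrightarrow> \<exists>\<mu>. (\<forall>j<k. hol n q (\<mu> j) \<and> \<mu> j q = 0) \<and> V (\<lambda>z. w i z - (\<Sum>j<k. \<mu> j z * w j z))"
    and "i < k"
  shows "V (w i)"
proof -
  have "\<exists>\<mu>. \<forall>i. i < k \<longrightarrow> (\<forall>j<k. hol n q (\<mu> i j) \<and> \<mu> i j q = 0) \<and>
      V (\<lambda>z. w i z - (\<Sum>j<k. \<mu> i j z * w j z))"
    by (rule choice) (use assms(1) in blast)
  then obtain \<mu> where "\<And>i. i < k \<Longrightarrow> (\<forall>j<k. hol n q (\<mu> i j) \<and> \<mu> i j q = 0) \<and>
      V (\<lambda>z. w i z - (\<Sum>j<k. \<mu> i j z * w j z))"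
    by blast
  then have "\<forall>i<k. V (w i)" by (intro Nakayama_coefficients[of k \<mu>]) auto
  then show ?thesis using assms(2) by blast
qed

end

section \<open>Finitely generated ideals and their products with the maximal ideal\<close>

definition ideal_gen :: "nat \<Rightarrow> (nat \<Rightarrow> complex) \<Rightarrow> nat \<Rightarrow> (nat \<Rightarrow> (nat \<Rightarrow> complex) \<Rightarrow> complex) \<Rightarrow>
    ((nat \<Rightarrow> complex) \<Rightarrow> complex) \<Rightarrow> bool" where
  "ideal_gen n q k w f \<longleftrightarrow> (\<exists>a. (\<forall>i<k. hol n q (a i)) \<and>
     eventually (\<lambda>z. f z = (\<Sum>i<k. a i z * w i z)) (nbhds n q))"

text \<open>This is the product of the maximal ideal at \<open>q\<close> with the ideal generated by
  \<open>w\<close>.\<close>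

definition max_ideal_gen :: "nat \<Rightarrow> (nat \<Rightarrow> complex) \<Rightarrow> nat \<Rightarrow> (nat \<Rightarrow> (nat \<Rightarrow> complex) \<Rightarrow> complex) \<Rightarrow>
    ((nat \<Rightarrow> complex) \<Rightarrow> complex) \<Rightarrow> bool" where
  "max_ideal_gen n q k w f \<longleftrightarrow> (\<exists>a. (\<forall>i<k. hol n q (a i) \<and> a i q = 0) \<and>
     eventually (\<lambda>z. f z = (\<Sum>i<k. a i z * w i z)) (nbhds n q))"

lemma germ_ideal_combinations:
  assumes q: "q \<in> coord_space n"
    and C0: "C (\<lambda>_. 0)" and C1: "\<And>a b. C a \<Longrightarrow> C b \<Longrightarrow> C (\<lambda>z. a z + b z)"
    and C2: "\<And>a b. hol n q a \<Longrightarrow> C b \<Longrightarrow> C (\<lambda>z. a z * b z)"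
  shows "germ_ideal n q (\<lambda>f. \<exists>a. (\<forall>i<k. C (a i)) \<and>
     eventually (\<lambda>z. f z = (\<Sum>i<k. a i z * w i z)) (nbhds n q))" (is "germ_ideal n q ?V")
proof
  show "?V (\<lambda>_. 0)" by (intro exI[of _ "\<lambda>_ _. 0"]) (simp add: C0)
  fix f g assume "?V f" and "?V g"
  then obtain a b where ab: "\<forall>i<k. C (a i)" "\<forall>i<k. C (b i)"
    "eventually (\<lambda>z. f z = (\<Sum>i<k. a i z * w i z)) (nbhds n q)"
    "eventually (\<lambda>z. g z = (\<Sum>i<k. b i z * w i z)) (nbhds n q)" by blast
  show "?V (\<lambda>z. f z + g z)"
  proof (intro exI[of _ "\<lambda>i z. a i z + b i z"] conjI)
    show "\<forall>i<k. C (\<lambda>z. a i z + b i z)" using ab C1 by blast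
    show "eventually (\<lambda>z. f z + g z = (\<Sum>i<k. (a i z + b i z) * w i z)) (nbhds n q)"
      using ab(3,4) by eventually_elim (simp add: algebra_simps sum.distrib)
  qed
next
  fix c f assume c: "hol n q c" and "?V f"
  then obtain a where ab: "\<forall>i<k. C (a i)"
    "eventually (\<lambda>z. f z = (\<Sum>i<k. a i z * w i z)) (nbhds n q)" by blast
  show "?V (\<lambda>z. c z * f z)"
  proof (intro exI[of _ "\<lambda>i z. c z * a i z"] conjI)
    show "\<forall>i<k. C (\<lambda>z. c z * a i z)" using ab C2 c by blast
    show "eventually (\<lambda>z. c z * f z = (\<Sum>i<k. (c z * a i z) * w i z)) (nbhds n q)"
      using ab(2) by eventually_elim (simp add: algebra_simps sum_distrib_left)
  qed
next
  fix f g assume "?V f" and fg: "eventually (\<lambda>z. f z = g z) (nbhds n q)"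
  then obtain a where ab: "\<forall>i<k. C (a i)"
    "eventually (\<lambda>z. f z = (\<Sum>i<k. a i z * w i z)) (nbhds n q)" by blast
  have "eventually (\<lambda>z. g z = (\<Sum>i<k. a i z * w i z)) (nbhds n q)"
    using ab(2) fg by eventually_elim simp
  then show "?V g" using ab(1) by blast
qed (rule q)

lemma germ_ideal_ideal_gen: "q \<in> coord_space n \<Longrightarrow> germ_ideal n q (ideal_gen n q k w)"
  unfolding ideal_gen_def[abs_def] by (rule germ_ideal_combinations) (auto intro: hol_intros)

lemma germ_ideal_max_ideal_gen: "q \<in> coord_space n \<Longrightarrow> germ_ideal n q (max_ideal_gen n q k w)"
  unfolding max_ideal_gen_def[abs_def] by (rule germ_ideal_combinations) (auto intro: hol_intros)

lemma ideal_gen_generator: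
  assumes q: "q \<in> coord_space n" and i: "i < k"
  shows "ideal_gen n q k w (w i)"
  unfolding ideal_gen_def
proof (intro exI[of _ "\<lambda>j _. if i = j then 1 else 0"] conjI)
  show "\<forall>j<k. hol n q (\<lambda>_. if i = j then 1 else 0)" using q by (auto intro: hol_const)
  have "(\<Sum>j<k. (if i = j then 1 else 0) * w j z) = w i z" for z
  proof -
    have "(\<Sum>j<k. (if i = j then 1 else 0) * w j z) = (\<Sum>j<k. if i = j then w j z else 0)"
      by (intro sum.cong) auto
    then show ?thesis using i by simp
  qed
  then show "eventually (\<lambda>z. w i z = (\<Sum>j<k. (if i = j then 1 else 0) * w j z)) (nbhds n q)" by simp
qed

lemma max_ideal_gen_imp_ideal_gen: "max_ideal_gen n q k w f \<Longrightarrow> ideal_gen n q k w f"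
  unfolding max_ideal_gen_def ideal_gen_def by blast

lemma max_ideal_gen_mult:
  assumes g: "hol n q g" "g q = 0" and f: "ideal_gen n q k w f"
  shows "max_ideal_gen n q k w (\<lambda>z. g z * f z)"
proof -
  obtain a where ab: "\<forall>i<k. hol n q (a i)"
    "eventually (\<lambda>z. f z = (\<Sum>i<k. a i z * w i z)) (nbhds n q)"
    using f unfolding ideal_gen_def by blast
  show ?thesis
    unfolding max_ideal_gen_def
  proof (intro exI[of _ "\<lambda>i z. g z * a i z"] conjI)
    show "\<forall>i<k. hol n q (\<lambda>z. g z * a i z) \<and> g q * a i q = 0" using ab g hol_mult by simp
    show "eventually (\<lambda>z. g z * f z = (\<Sum>i<k. (g z * a i z) * w i z)) (nbhds n q)"
      using ab(2) by eventually_elim (simp add: algebra_simps sum_distrib_left)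
  qed
qed

lemma ideal_gen_trans:
  assumes q: "q \<in> coord_space n" and v: "\<And>i. i < k \<Longrightarrow> ideal_gen n q l w (v i)" and F: "ideal_gen n q k v F"
  shows "ideal_gen n q l w F"
proof -
  interpret V: germ_ideal n q "ideal_gen n q l w" by (rule germ_ideal_ideal_gen[OF q])
  obtain a where a: "\<forall>i<k. hol n q (a i)" "eventually (\<lambda>z. F z = (\<Sum>i<k. a i z * v i z)) (nbhds n q)"
    using F unfolding ideal_gen_def by blast
  have "ideal_gen n q l w (\<lambda>z. \<Sum>i<k. a i z * v i z)" using a v by (intro V.sum V.mult) auto
  then show ?thesis by (rule V.cong) (use a(2) in \<open>auto elim: eventually_mono\<close>)
qed

text \<open>The finitely many coefficients and the equation between them live on a common
  neighbourhood. In this way relations found at the origin spread to the nearby stalks.\<close>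

lemma ideal_gen_eventually:
  assumes q: "q \<in> coord_space n" and F: "ideal_gen n q k w F"
  shows "eventually (\<lambda>z. ideal_gen n z k w F) (nbhds n q)"
proof -
  obtain a where a: "\<forall>i<k. hol n q (a i)" "eventually (\<lambda>z. F z = (\<Sum>i<k. a i z * w i z)) (nbhds n q)"
    using F unfolding ideal_gen_def by blast
  have "eventually (\<lambda>z. \<forall>i\<in>{..<k}. hol n z (a i)) (nbhds n q)"
    using a(1) by (intro eventually_ball_finite) (auto intro: hol_eventually)
  then show ?thesis using eventually_nbhds_eventually[OF a(2) q]
    by eventually_elim (auto simp: ideal_gen_def intro!: exI[of _ a])
qed

section \<open>Powers of the maximal ideal at the origin of the plane\<close>

abbreviation origin :: "nat \<Rightarrow> complex" where "origin \<equiv> \<lambda>_. 0"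

abbreviation hol0 :: "((nat \<Rightarrow> complex) \<Rightarrow> complex) \<Rightarrow> bool" where "hol0 \<equiv> hol 2 origin"

text \<open>The \<open>k\<close>-th power of the maximal ideal m of convergent series, encoded
  through the recursion m^(k+1) = x m^k + y m^k.\<close>

primrec max_pow :: "nat \<Rightarrow> ((nat \<Rightarrow> complex) \<Rightarrow> complex) \<Rightarrow> bool" where
  "max_pow 0 f \<longleftrightarrow> hol0 f"
| "max_pow (Suc k) f \<longleftrightarrow> (\<exists>a b. max_pow k a \<and> max_pow k b \<and>
     eventually (\<lambda>z. f z = z 0 * a z + z 1 * b z) (nbhds 2 origin))"

lemma origin_in_coord_space: "origin \<in> coord_space 2" by simp

lemma germ_ideal_hol: "q \<in> coord_space n \<Longrightarrow> germ_ideal n q (hol n q)"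
  by standard (auto intro: hol_intros hol_cong)

lemma germ_ideal_max_pow: "germ_ideal 2 origin (max_pow k)"
proof (induction k)
  case 0
  have "max_pow 0 = hol0" by (simp add: fun_eq_iff)
  then show ?case using germ_ideal_hol[OF origin_in_coord_space] by simp
next
  case (Suc k)
  interpret k: germ_ideal 2 origin "max_pow k" by (rule Suc.IH)
  show ?case
  proof
    show "max_pow (Suc k) (\<lambda>_. 0)" using k.zero by (auto intro!: exI[of _ "\<lambda>_. 0"])
    fix f g assume "max_pow (Suc k) f" and "max_pow (Suc k) g"
    then obtain a b c d where *: "max_pow k a" "max_pow k b" "max_pow k c" "max_pow k d"
      "eventually (\<lambda>z. f z = z 0 * a z + z 1 * b z) (nbhds 2 origin)"
      "eventually (\<lambda>z. g z = z 0 * c z + z 1 * d z) (nbhds 2 origin)" by auto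
    have "eventually (\<lambda>z. f z + g z = z 0 * (a z + c z) + z 1 * (b z + d z)) (nbhds 2 origin)"
      using *(5,6) by eventually_elim (simp add: algebra_simps)
    then show "max_pow (Suc k) (\<lambda>z. f z + g z)"
      using k.add[OF *(1,3)] k.add[OF *(2,4)] unfolding max_pow.simps by blast
  next
    fix c f assume c: "hol0 c" and "max_pow (Suc k) f"
    then obtain a b where *: "max_pow k a" "max_pow k b"
      "eventually (\<lambda>z. f z = z 0 * a z + z 1 * b z) (nbhds 2 origin)" by auto
    have "eventually (\<lambda>z. c z * f z = z 0 * (c z * a z) + z 1 * (c z * b z)) (nbhds 2 origin)"
      using *(3) by eventually_elim (simp add: algebra_simps)
    then show "max_pow (Suc k) (\<lambda>z. c z * f z)"
      using k.mult[OF c *(1)] k.mult[OF c *(2)] unfolding max_pow.simps by blast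
  next
    fix f g assume "max_pow (Suc k) f" and fg: "eventually (\<lambda>z. f z = g z) (nbhds 2 origin)"
    then obtain a b where *: "max_pow k a" "max_pow k b"
      "eventually (\<lambda>z. f z = z 0 * a z + z 1 * b z) (nbhds 2 origin)" by auto
    have "eventually (\<lambda>z. g z = z 0 * a z + z 1 * b z) (nbhds 2 origin)"
      using *(3) fg by eventually_elim simp
    then show "max_pow (Suc k) g" using * unfolding max_pow.simps by blast
  qed simp
qed

interpretation max_pow: germ_ideal 2 origin "max_pow k" for k
  by (rule germ_ideal_max_pow)

lemma max_pow_Suc_imp: "max_pow (Suc k) f \<Longrightarrow> max_pow k f"
proof (induction k arbitrary: f)
  case 0
  then obtain a b where *: "hol0 a" "hol0 b"
    "eventually (\<lambda>z. f z = z 0 * a z + z 1 * b z) (nbhds 2 origin)" by auto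
  have "hol0 (\<lambda>z. z 0 * a z + z 1 * b z)" using * by (intro hol_intros) auto
  moreover have "eventually (\<lambda>z. z 0 * a z + z 1 * b z = f z) (nbhds 2 origin)"
    using *(3) by eventually_elim simp
  ultimately show ?case by (auto intro: hol_cong)
next
  case (Suc k)
  then show ?case unfolding max_pow.simps(2)[of "Suc k"] max_pow.simps(2)[of k] by blast
qed

lemma max_pow_mono: "max_pow k f \<Longrightarrow> l \<le> k \<Longrightarrow> max_pow l f"
  by (induction k) (auto simp: le_Suc_eq simp del: max_pow.simps dest: max_pow_Suc_imp)

lemma max_pow_hol: "max_pow k f \<Longrightarrow> hol0 f"
  using max_pow_mono[of k f 0] by simp

lemma Hadamard_plane:
  assumes "hol0 f"
  obtains G where "\<And>i. i < 2 \<Longrightarrow> hol0 (G i)" "\<And>i. i < 2 \<Longrightarrow> G i origin = pd i f origin"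
    "eventually (\<lambda>z. f z = f origin + z 0 * G 0 z + z 1 * G 1 z) (nbhds 2 origin)"
proof -
  obtain G where "\<And>i. i < 2 \<Longrightarrow> hol0 (G i)" "\<And>i. i < 2 \<Longrightarrow> G i origin = pd i f origin"
    "eventually (\<lambda>z. f z = f origin + (\<Sum>i<2. (z i - 0) * G i z)) (nbhds 2 origin)"
    using Hadamard_pd[OF assms] by blast
  then show ?thesis using that[of G] by (simp add: numeral_2_eq_2 add.assoc)
qed

text \<open>Hadamard's lemma writes a germ that vanishes at the origin as x a + y b, which is the
  shape demanded by the recursion of \<open>max_pow\<close>.\<close>

lemma max_pow_vanishing_mult:
  assumes g: "hol0 g" "g origin = 0" and f: "max_pow k f"
  shows "max_pow (Suc k) (\<lambda>z. g z * f z)"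
proof -
  obtain G where G: "\<And>i::nat. i < 2 \<Longrightarrow> hol0 (G i)" "\<And>i. i < 2 \<Longrightarrow> G i origin = pd i g origin"
    "eventually (\<lambda>z. g z = g origin + z 0 * G 0 z + z 1 * G 1 z) (nbhds 2 origin)"
    using Hadamard_plane[OF g(1)] by blast
  have "eventually (\<lambda>z. g z * f z = z 0 * (G 0 z * f z) + z 1 * (G 1 z * f z)) (nbhds 2 origin)"
    using G(3) by eventually_elim (simp add: g algebra_simps)
  then show ?thesis
    using max_pow.mult[OF G(1) f, of 0] max_pow.mult[OF G(1) f, of 1] unfolding max_pow.simps by auto
qed

lemma max_pow_1_iff: "max_pow 1 f \<longleftrightarrow> hol0 f \<and> f origin = 0"
proof
  assume f: "max_pow 1 f"
  then obtain a b where "eventually (\<lambda>z. f z = z 0 * a z + z 1 * b z) (nbhds 2 origin)" by auto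
  from eventually_nbhds_self[OF this] have "f origin = 0" by simp
  then show "hol0 f \<and> f origin = 0" using f max_pow_hol by blast
next
  assume "hol0 f \<and> f origin = 0"
  then show "max_pow 1 f"
    using max_pow_vanishing_mult[of f 0 "\<lambda>_. 1"] by (simp add: hol_const del: max_pow.simps(2))
qed

text \<open>Congruence modulo an ideal inside m^2 therefore preserves the value and both first
  derivatives at the origin.\<close>

lemma max_pow_2_iff: "max_pow 2 f \<longleftrightarrow> hol0 f \<and> f origin = 0 \<and> (\<forall>i<2. pd i f origin = 0)"
proof
  assume f: "max_pow 2 f"
  then obtain a b where ab: "max_pow 1 a" "max_pow 1 b"
    and ev: "eventually (\<lambda>z. f z = z 0 * a z + z 1 * b z) (nbhds 2 origin)"
    unfolding numeral_2_eq_2 One_nat_def max_pow.simps(2)[of "Suc 0"] by blast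
  have h: "hol0 a" "hol0 b" "a origin = 0" "b origin = 0" using ab max_pow_1_iff by auto
  have "pd i f origin = 0" if i: "i < 2" for i
  proof -
    have "pd i f origin = pd i (\<lambda>z. z 0 * a z + z 1 * b z) origin"
      by (rule pd_cong[OF ev _ i]) simp
    also have "\<dots> = 0"
      using i h by (subst pd_add[of 2] pd_mult[of 2]; (intro hol_intros)?; simp)+
    finally show ?thesis .
  qed
  moreover have "f origin = 0" using max_pow_mono[OF f, of 1] max_pow_1_iff by simp
  ultimately show "hol0 f \<and> f origin = 0 \<and> (\<forall>i<2. pd i f origin = 0)"
    using max_pow_hol[OF f] by blast
next
  assume f: "hol0 f \<and> f origin = 0 \<and> (\<forall>i<2. pd i f origin = 0)"
  then obtain G where G: "\<And>i. i < 2 \<Longrightarrow> hol0 (G i)" "\<And>i. i < 2 \<Longrightarrow> G i origin = pd i f origin"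
    "eventually (\<lambda>z. f z = f origin + z 0 * G 0 z + z 1 * G 1 z) (nbhds 2 origin)"
    using Hadamard_plane[of f] by blast
  have "max_pow 1 (G i)" if "i < 2" for i using G f that max_pow_1_iff by simp
  moreover have "eventually (\<lambda>z. f z = z 0 * G 0 z + z 1 * G 1 z) (nbhds 2 origin)"
    using G(3) f by simp
  ultimately have "max_pow (Suc 1) f"
    unfolding max_pow.simps(2)[of 1] by (intro exI[of _ "G 0"] exI[of _ "G 1"]) simp
  then show "max_pow 2 f" by (simp add: numeral_2_eq_2)
qed

section \<open>Comparing a Milnor algebra with a plane algebra\<close>

text \<open>\<open>\<pi> F\<close> represents the image of the class of \<open>F\<close> under an isomorphism \<open>S/J \<cong> \<O>/I\<close>; only
  congruences modulo \<open>I\<close> are required of this choice of representatives.\<close>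

locale milnor_lift =
  fixes n :: nat and q :: "nat \<Rightarrow> complex" and \<Phi> :: "(nat \<Rightarrow> complex) \<Rightarrow> complex"
    and w :: "nat \<Rightarrow> (nat \<Rightarrow> complex) \<Rightarrow> complex" and N :: nat
    and \<pi> :: "((nat \<Rightarrow> complex) \<Rightarrow> complex) \<Rightarrow> (nat \<Rightarrow> complex) \<Rightarrow> complex"
  assumes Phi: "hol n q \<Phi>"
    and w: "i < 2 \<Longrightarrow> max_pow 2 (w i)"
    and N: "max_pow N f \<Longrightarrow> ideal_gen 2 origin 2 w f"
    and pi_hol: "hol n q F \<Longrightarrow> hol0 (\<pi> F)"
    and pi_const: "cong_mod (ideal_gen 2 origin 2 w) (\<pi> (\<lambda>_. a)) (\<lambda>_. a)"
    and pi_add: "hol n q F \<Longrightarrow> hol n q G \<Longrightarrow>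
      cong_mod (ideal_gen 2 origin 2 w) (\<pi> (\<lambda>z. F z + G z)) (\<lambda>z. \<pi> F z + \<pi> G z)"
    and pi_mult: "hol n q F \<Longrightarrow> hol n q G \<Longrightarrow>
      cong_mod (ideal_gen 2 origin 2 w) (\<pi> (\<lambda>z. F z * G z)) (\<lambda>z. \<pi> F z * \<pi> G z)"
    and pi_ker: "hol n q F \<Longrightarrow>
      ideal_gen 2 origin 2 w (\<pi> F) \<longleftrightarrow> ideal_gen n q n (\<lambda>i. pd i \<Phi>) F"
    and pi_surj: "hol0 f \<Longrightarrow> \<exists>F. hol n q F \<and> cong_mod (ideal_gen 2 origin 2 w) (\<pi> F) f"
begin

abbreviation "I \<equiv> ideal_gen 2 origin 2 w"
abbreviation "mI \<equiv> max_ideal_gen 2 origin 2 w"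
abbreviation "J \<equiv> ideal_gen n q n (\<lambda>i. pd i \<Phi>)"

lemma q: "q \<in> coord_space n"
  using Phi hol_imp_coord_space by blast

sublocale I: germ_ideal 2 origin I
  by (rule germ_ideal_ideal_gen) simp

sublocale mI: germ_ideal 2 origin mI
  by (rule germ_ideal_max_ideal_gen) simp

sublocale J: germ_ideal n q J
  by (rule germ_ideal_ideal_gen[OF q])

lemma I_imp_max_pow_2:
  assumes "I f"
  shows "max_pow 2 f"
proof -
  obtain a where a: "\<forall>i<2. hol0 (a i)" "eventually (\<lambda>z. f z = (\<Sum>i<2. a i z * w i z)) (nbhds 2 origin)"
    using assms unfolding ideal_gen_def by blast
  have "max_pow 2 (\<lambda>z. \<Sum>i<2. a i z * w i z)"
    using a w by (intro max_pow.sum max_pow.mult) auto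
  moreover have "eventually (\<lambda>z. (\<Sum>i<2. a i z * w i z) = f z) (nbhds 2 origin)"
    using a(2) by eventually_elim simp
  ultimately show ?thesis by (rule max_pow.cong)
qed

lemma I_hol: "I f \<Longrightarrow> hol0 f"
  using I_imp_max_pow_2 max_pow_hol by blast

lemma cong_I_origin: "cong_mod I f g \<Longrightarrow> f origin = g origin"
  using I_imp_max_pow_2 max_pow_2_iff unfolding cong_mod_def by fastforce

text \<open>m^(N+1) = m m^N is contained in mI. Hence approximation to order N + 1 is precise enough
  for Nakayama's lemma.\<close>

lemma max_pow_Suc_imp_mI:
  assumes "max_pow (Suc N) f"
  shows "mI f"
proof -
  obtain a b where ab: "max_pow N a" "max_pow N b"
    "eventually (\<lambda>z. f z = z 0 * a z + z 1 * b z) (nbhds 2 origin)"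
    using assms by auto
  have "mI (\<lambda>z. z 0 * a z + z 1 * b z)"
    using ab N by (intro mI.add max_ideal_gen_mult) (auto intro: hol_coord)
  moreover have "eventually (\<lambda>z. z 0 * a z + z 1 * b z = f z) (nbhds 2 origin)"
    using ab(3) by eventually_elim simp
  ultimately show ?thesis by (rule mI.cong)
qed

text \<open>\<open>\<pi>\<close> is chosen on functions, not on germs. The difference of two
  representatives of a germ is the zero germ, which lies in J and is thus sent into I.\<close>

lemma pi_cong:
  assumes F: "hol n q F" "hol n q G" and ev: "eventually (\<lambda>z. F z = G z) (nbhds n q)"
  shows "cong_mod I (\<pi> F) (\<pi> G)"
proof -
  have d: "hol n q (\<lambda>z. F z - G z)" using F by (rule hol_diff)
  have "eventually (\<lambda>z. 0 = F z - G z) (nbhds n q)" using ev by eventually_elim simp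
  then have "J (\<lambda>z. F z - G z)" by (rule J.cong[OF J.zero])
  then have "I (\<pi> (\<lambda>z. F z - G z))" using pi_ker[OF d] by simp
  moreover have "cong_mod I (\<pi> F) (\<lambda>z. \<pi> G z + \<pi> (\<lambda>z. F z - G z) z)"
    using pi_add[OF F(2) d] by simp
  then have "cong_mod I (\<lambda>z. \<pi> F z - \<pi> G z) (\<pi> (\<lambda>z. F z - G z))"
    by (simp add: cong_mod_def algebra_simps)
  ultimately have "I (\<lambda>z. \<pi> F z - \<pi> G z)" using I.cong_mem by blast
  then show ?thesis by (simp add: cong_mod_def)
qed

text \<open>The sum has the shape of Hadamard's expansion, to which the lemma is applied with z i -
  q i as one of the factors.\<close>

lemma pi_combination:
  fixes m :: nat
  assumes "hol n q c" "\<And>i. i < m \<Longrightarrow> hol n q (a i)" "\<And>i. i < m \<Longrightarrow> hol n q (b i)"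
  shows "cong_mod I (\<pi> (\<lambda>z. c z + (\<Sum>i<m. a i z * b i z))) (\<lambda>z. \<pi> c z + (\<Sum>i<m. \<pi> (a i) z * \<pi> (b i) z))"
  using assms
proof (induction m)
  case (Suc m)
  have "cong_mod I (\<pi> (\<lambda>z. (c z + (\<Sum>i<m. a i z * b i z)) + a m z * b m z))
      (\<lambda>z. \<pi> (\<lambda>z. c z + (\<Sum>i<m. a i z * b i z)) z + \<pi> (\<lambda>z. a m z * b m z) z)"
    using Suc.prems q by (intro pi_add hol_intros) auto
  then have "cong_mod I (\<pi> (\<lambda>z. (c z + (\<Sum>i<m. a i z * b i z)) + a m z * b m z))
      (\<lambda>z. (\<pi> c z + (\<Sum>i<m. \<pi> (a i) z * \<pi> (b i) z)) + \<pi> (a m) z * \<pi> (b m) z)"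
    by (rule I.cong_trans) (use Suc in \<open>intro I.cong_add pi_mult; simp\<close>)
  then show ?case by (simp add: add.assoc)
qed (simp add: I.cong_refl)

text \<open>The usual argument that homomorphisms of local algebras are local: if c = \<pi> F origin
  differed from F q, then F - c would be a unit at \<open>q\<close>, while its image vanishes at the
  origin.\<close>

lemma pi_value:
  assumes F: "hol n q F"
  shows "\<pi> F origin = F q"
proof (rule ccontr)
  assume ne: "\<pi> F origin \<noteq> F q"
  define c where "c = \<pi> F origin"
  have H: "hol n q (\<lambda>z. F z + (- c))" using F q by (intro hol_intros)
  have G: "hol n q (\<lambda>z. inverse (F z + (- c)))" using hol_inverse[OF H] ne c_def by auto
  have "eventually (\<lambda>z. F z + (- c) \<noteq> 0) (nbhds n q)"
    using hol_eventually_nonzero[OF H] ne c_def by auto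
  then have "eventually (\<lambda>z. (F z + (- c)) * inverse (F z + (- c)) = 1) (nbhds n q)"
    by eventually_elim simp
  then have c1: "cong_mod I (\<pi> (\<lambda>z. (F z + (- c)) * inverse (F z + (- c)))) (\<pi> (\<lambda>_. 1))"
    by (intro pi_cong hol_mult H G hol_const q)
  have "\<pi> (\<lambda>z. F z + (- c)) origin * \<pi> (\<lambda>z. inverse (F z + (- c))) origin = 1"
    using cong_I_origin[OF pi_mult[OF H G]] cong_I_origin[OF pi_const[of 1]] cong_I_origin[OF c1] by simp
  moreover have "\<pi> (\<lambda>z. F z + (- c)) origin = 0"
    using cong_I_origin[OF pi_add[OF F hol_const[OF q]], of "- c"] cong_I_origin[OF pi_const[of "- c"]]
    by (simp add: c_def)
  ultimately show False by simp
qed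

definition lift :: "(nat \<Rightarrow> (nat \<Rightarrow> complex) \<Rightarrow> complex) \<Rightarrow> bool" where
  "lift g \<longleftrightarrow> (\<forall>i<n. hol0 (g i) \<and> cong_mod I (\<pi> (\<lambda>z. z i)) (g i))"

definition pull :: "(nat \<Rightarrow> (nat \<Rightarrow> complex) \<Rightarrow> complex) \<Rightarrow> ((nat \<Rightarrow> complex) \<Rightarrow> complex) \<Rightarrow>
    (nat \<Rightarrow> complex) \<Rightarrow> complex" where
  "pull g F = (\<lambda>z. F (tuple n (\<lambda>i. g i z)))"

lemma lift_hol: "lift g \<Longrightarrow> i < n \<Longrightarrow> hol0 (g i)"
  by (simp add: lift_def)

lemma lift_cong: "lift g \<Longrightarrow> i < n \<Longrightarrow> cong_mod I (\<pi> (\<lambda>z. z i)) (g i)"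
  by (simp add: lift_def)

lemma lift_origin: "lift g \<Longrightarrow> i < n \<Longrightarrow> g i origin = q i"
  using cong_I_origin[OF lift_cong] pi_value[OF hol_coord[OF q]] by simp

lemma pull_hol: "lift g \<Longrightarrow> hol n q F \<Longrightarrow> hol0 (pull g F)"
  unfolding pull_def by (rule hol_compose) (auto simp: lift_hol lift_origin)

lemma pull_origin: "lift g \<Longrightarrow> pull g F origin = F q"
  unfolding pull_def using tuple_eqI[OF q] lift_origin by simp

lemma filterlim_pull: "lift g \<Longrightarrow> filterlim (\<lambda>z. tuple n (\<lambda>i. g i z)) (nbhds n q) (nbhds 2 origin)"
  by (rule filterlim_tuple[OF q lift_hol lift_origin])

lemma pull_Hadamard:
  assumes g: "lift g" and F: "eventually (\<lambda>z. F z = F q + (\<Sum>i<n. (z i - q i) * G i z)) (nbhds n q)"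
  shows "eventually (\<lambda>z. pull g F z = F q + (\<Sum>i<n. (g i z - q i) * pull g (G i) z)) (nbhds 2 origin)"
  using eventually_compose_filterlim[OF F filterlim_pull[OF g]]
  by eventually_elim (simp add: pull_def tuple_def)

lemma pull_pd:
  assumes g: "lift g" and F: "hol n q F" and j: "j < 2"
  shows "pd j (pull g F) origin = (\<Sum>i<n. pd i F q * pd j (g i) origin)"
  unfolding pull_def by (rule pd_compose[OF F lift_hol[OF g] lift_origin[OF g] j])

text \<open>The ideal I + m^k. For k = N it is I itself.\<close>

definition mod_pow :: "nat \<Rightarrow> ((nat \<Rightarrow> complex) \<Rightarrow> complex) \<Rightarrow> bool" where
  "mod_pow k f \<longleftrightarrow> (\<exists>u v. I u \<and> max_pow k v \<and> eventually (\<lambda>z. f z = u z + v z) (nbhds 2 origin))"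

lemma germ_ideal_mod_pow: "germ_ideal 2 origin (mod_pow k)"
proof
  show "mod_pow k (\<lambda>_. 0)"
    unfolding mod_pow_def using I.zero max_pow.zero by (intro exI[of _ "\<lambda>_. 0"]) simp
  fix f g assume "mod_pow k f" and "mod_pow k g"
  then obtain u v u' v' where *: "I u" "I u'" "max_pow k v" "max_pow k v'"
    "eventually (\<lambda>z. f z = u z + v z) (nbhds 2 origin)" "eventually (\<lambda>z. g z = u' z + v' z) (nbhds 2 origin)"
    unfolding mod_pow_def by blast
  have "eventually (\<lambda>z. f z + g z = (u z + u' z) + (v z + v' z)) (nbhds 2 origin)"
    using *(5,6) by eventually_elim simp
  then show "mod_pow k (\<lambda>z. f z + g z)"
    unfolding mod_pow_def using I.add[OF *(1,2)] max_pow.add[OF *(3,4)] by blast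
next
  fix a f assume a: "hol0 a" and "mod_pow k f"
  then obtain u v where *: "I u" "max_pow k v" "eventually (\<lambda>z. f z = u z + v z) (nbhds 2 origin)"
    unfolding mod_pow_def by blast
  have "eventually (\<lambda>z. a z * f z = a z * u z + a z * v z) (nbhds 2 origin)"
    using *(3) by eventually_elim (simp add: algebra_simps)
  then show "mod_pow k (\<lambda>z. a z * f z)"
    unfolding mod_pow_def using I.mult[OF a *(1)] max_pow.mult[OF a *(2)] by blast
next
  fix f g assume "mod_pow k f" and fg: "eventually (\<lambda>z. f z = g z) (nbhds 2 origin)"
  then obtain u v where *: "I u" "max_pow k v" "eventually (\<lambda>z. f z = u z + v z) (nbhds 2 origin)"
    unfolding mod_pow_def by blast
  have "eventually (\<lambda>z. g z = u z + v z) (nbhds 2 origin)"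
    using *(3) fg by eventually_elim simp
  then show "mod_pow k g" unfolding mod_pow_def using * by blast
qed simp

sublocale mod_pow: germ_ideal 2 origin "mod_pow k" for k
  by (rule germ_ideal_mod_pow)

lemma I_imp_mod_pow: "I f \<Longrightarrow> mod_pow k f"
  unfolding mod_pow_def using max_pow.zero by (intro exI[of _ f] exI[of _ "\<lambda>_. 0"]) simp

lemma mod_pow_vanishing_mult:
  assumes "hol0 a" "a origin = 0" "mod_pow k f"
  shows "mod_pow (Suc k) (\<lambda>z. a z * f z)"
proof -
  obtain u v where *: "I u" "max_pow k v" "eventually (\<lambda>z. f z = u z + v z) (nbhds 2 origin)"
    using assms(3) unfolding mod_pow_def by blast
  have "eventually (\<lambda>z. a z * f z = a z * u z + a z * v z) (nbhds 2 origin)"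
    using *(3) by eventually_elim (simp add: algebra_simps)
  then show ?thesis
    unfolding mod_pow_def using I.mult[OF assms(1) *(1)] max_pow_vanishing_mult[OF assms(1,2) *(2)] by blast
qed

text \<open>The quotient map is pullback along any lift of the coordinates: both agree on coordinates,
  hence, by repeated Taylor expansion, modulo every power of the maximal ideal, and some power
  lies in \<open>I\<close>.\<close>

lemma pi_eq_pull:
  assumes g: "lift g" and F: "hol n q F"
  shows "cong_mod I (\<pi> F) (pull g F)"
proof -
  have "cong_mod (mod_pow k) (\<pi> F) (pull g F)" if "hol n q F" for k F
    using that
  proof (induction k arbitrary: F)
    case 0
    have h: "hol0 (\<lambda>z. \<pi> F z - pull g F z)" by (intro hol_diff pi_hol pull_hol[OF g] 0)
    then show ?case
      unfolding cong_mod_def mod_pow_def using I.zero by (intro exI[of _ "\<lambda>_. 0"] exI[of _ "\<lambda>z. \<pi> F z - pull g F z"]) simp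
  next
    case (Suc k)
    obtain G where G: "\<And>i. i < n \<Longrightarrow> hol n q (G i)"
      and ev: "eventually (\<lambda>z. F z = F q + (\<Sum>i<n. (z i - q i) * G i z)) (nbhds n q)"
      using Hadamard[OF Suc.prems] by blast
    have c: "hol n q (\<lambda>z. z i - q i)" for i using q by (intro hol_intros)
    have s: "hol n q (\<lambda>z. F q + (\<Sum>i<n. (z i - q i) * G i z))"
      using G q by (intro hol_intros) auto
    have pc: "cong_mod I (\<pi> (\<lambda>z. z i - q i)) (\<lambda>z. g i z - q i)" if "i < n" for i
      using I.cong_trans[OF pi_add[OF hol_coord[OF q] hol_const[OF q]] I.cong_add[OF lift_cong[OF g that] pi_const],
          of "- q i"] by simp
    have gh: "hol0 (\<lambda>z. g i z - q i)" "g i origin - q i = 0" if "i < n" for i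
      using that lift_hol[OF g] lift_origin[OF g] by (auto intro!: hol_intros)
    have 1: "cong_mod I (\<pi> F) (\<lambda>z. F q + (\<Sum>i<n. (g i z - q i) * \<pi> (G i) z))"
    proof -
      have "cong_mod I (\<pi> F) (\<pi> (\<lambda>z. F q + (\<Sum>i<n. (z i - q i) * G i z)))"
        by (rule pi_cong[OF Suc.prems s ev])
      moreover have "cong_mod I (\<pi> (\<lambda>z. F q + (\<Sum>i<n. (z i - q i) * G i z)))
          (\<lambda>z. \<pi> (\<lambda>_. F q) z + (\<Sum>i<n. \<pi> (\<lambda>z. z i - q i) z * \<pi> (G i) z))"
        by (rule pi_combination) (use G c q in \<open>auto intro: hol_const\<close>)
      moreover have "cong_mod I (\<lambda>z. \<pi> (\<lambda>_. F q) z + (\<Sum>i<n. \<pi> (\<lambda>z. z i - q i) z * \<pi> (G i) z))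
          (\<lambda>z. F q + (\<Sum>i<n. (g i z - q i) * \<pi> (G i) z))"
        using G c by (intro I.cong_add I.cong_sum I.cong_mult pi_const pc I.cong_refl pi_hol) auto
      ultimately show ?thesis using I.cong_trans by blast
    qed
    then have 1: "cong_mod (mod_pow (Suc k)) (\<pi> F) (\<lambda>z. F q + (\<Sum>i<n. (g i z - q i) * \<pi> (G i) z))"
      unfolding cong_mod_def by (rule I_imp_mod_pow)
    have 2: "cong_mod (mod_pow (Suc k)) (pull g F) (\<lambda>z. F q + (\<Sum>i<n. (g i z - q i) * pull g (G i) z))"
      by (rule mod_pow.cong_eventually[OF pull_Hadamard[OF g ev]])
    \<comment> \<open>Each factor g i - q i vanishes at the origin and so raises the order of
      agreement of the Hadamard quotients by one.\<close>
    have "mod_pow (Suc k) (\<lambda>z. \<Sum>i<n. (g i z - q i) * (\<pi> (G i) z - pull g (G i) z))"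
    proof (intro mod_pow.sum mod_pow_vanishing_mult)
      fix i assume "i \<in> {..<n}"
      then have i: "i < n" by simp
      show "mod_pow k (\<lambda>z. \<pi> (G i) z - pull g (G i) z)"
        using Suc.IH[OF G[OF i]] by (simp add: cong_mod_def)
    qed (use gh in auto)
    then have 3: "cong_mod (mod_pow (Suc k)) (\<lambda>z. F q + (\<Sum>i<n. (g i z - q i) * \<pi> (G i) z))
        (\<lambda>z. F q + (\<Sum>i<n. (g i z - q i) * pull g (G i) z))"
      by (simp add: cong_mod_def sum_subtractf right_diff_distrib)
    show ?case using mod_pow.cong_trans[OF mod_pow.cong_trans[OF 1 3] mod_pow.cong_sym[OF 2]] .
  qed
  \<comment> \<open>At order N the part in m^N is absorbed by I.\<close>
  from this[OF F, of N] show ?thesis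
    unfolding cong_mod_def mod_pow_def
  proof (elim exE conjE)
    fix u v assume *: "I u" "max_pow N v" "eventually (\<lambda>z. \<pi> F z - pull g F z = u z + v z) (nbhds 2 origin)"
    have "eventually (\<lambda>z. u z + v z = \<pi> F z - pull g F z) (nbhds 2 origin)"
      using *(3) by eventually_elim simp
    then show "I (\<lambda>z. \<pi> F z - pull g F z)" by (rule I.cong[OF I.add[OF *(1) N[OF *(2)]]])
  qed
qed

text \<open>\<open>pull g\<close> represents the same isomorphism as \<open>\<pi>\<close>, so it
  detects J in the same way.\<close>

lemma pull_mem: "lift g \<Longrightarrow> hol n q F \<Longrightarrow> I (pull g F) \<longleftrightarrow> J F"
  using pi_eq_pull pi_ker I.cong_mem by blast

lemma J_generator: "i < n \<Longrightarrow> J (pd i \<Phi>)"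
  by (rule ideal_gen_generator[OF q])

lemma pull_pd_Phi: "lift g \<Longrightarrow> i < n \<Longrightarrow> I (pull g (pd i \<Phi>))"
  using pull_mem J_generator hol_pd[OF Phi] by blast

text \<open>The image of a partial derivative of \<Phi> lies in I, hence in m^2, and
  \<open>\<pi>\<close> preserves values.\<close>

lemma critical_point: "i < n \<Longrightarrow> pd i \<Phi> q = 0"
  using pi_value[OF hol_pd[OF Phi]] I_imp_max_pow_2 max_pow_2_iff pi_ker[OF hol_pd[OF Phi]] J_generator
  by metis

lemma lift_pi_coord: "lift (\<lambda>i. \<pi> (\<lambda>z. z i))"
  unfolding lift_def using pi_hol[OF hol_coord[OF q]] I.cong_refl by blast

lemma plane_coordinate_preimages:
  obtains X where "\<And>i. i < 2 \<Longrightarrow> hol n q (X i)" "\<And>i. i < 2 \<Longrightarrow> cong_mod I (\<pi> (X i)) (\<lambda>z. z i)"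
proof -
  have "\<exists>X. \<forall>i. hol n q (X i) \<and> cong_mod I (\<pi> (X i)) (\<lambda>z. z i)"
    by (rule choice) (use pi_surj hol_coord[OF origin_in_coord_space] in blast)
  then show ?thesis using that by blast
qed

text \<open>X \<circ> g agrees with the coordinate z i modulo I, hence to first order. For the two
  coordinates together this says that the differential of X is a left inverse of that of
  \<open>g\<close>.\<close>

lemma pull_preimage:
  assumes g: "lift g" and X: "hol n q X" and c: "cong_mod I (\<pi> X) (\<lambda>z. z i)" and i: "i < 2"
  shows "hol0 (pull g X)" "max_pow 2 (\<lambda>z. z i - pull g X z)" "pull g X origin = 0" "X q = 0"
    "j < 2 \<Longrightarrow> pd j (pull g X) origin = (if i = j then 1 else 0)"
proof -
  show h: "hol0 (pull g X)" by (rule pull_hol[OF g X])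
  have "cong_mod I (\<lambda>z. z i) (pull g X)"
    using I.cong_trans[OF I.cong_sym[OF c] pi_eq_pull[OF g X]] .
  then show m: "max_pow 2 (\<lambda>z. z i - pull g X z)"
    unfolding cong_mod_def by (rule I_imp_max_pow_2)
  show o: "pull g X origin = 0" using m max_pow_2_iff by auto
  show "X q = 0" using o pull_origin[OF g] by simp
  show "pd j (pull g X) origin = (if i = j then 1 else 0)" if j: "j < 2"
  proof -
    have "pd j (\<lambda>z. z i - pull g X z) origin = 0" using m max_pow_2_iff j by blast
    then show ?thesis using j h by (simp add: pd_diff[of 2] hol_coord split: if_splits)
  qed
qed

text \<open>After Hadamard expansion of both pullbacks the error consists of (G s \<circ> g' - pd s
  F q)(g' s - g s) and (g s - q s)(G s \<circ> g' - G s \<circ> g). In each product the first factor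
  vanishes at the origin and the second lies in I.\<close>

lemma first_order:
  assumes g: "lift g" "lift g'" and F: "hol n q F"
  shows "cong_mod mI (pull g' F) (\<lambda>z. pull g F z + (\<Sum>s<n. pd s F q * (g' s z - g s z)))"
proof -
  obtain G where G: "\<And>i. i < n \<Longrightarrow> hol n q (G i)" "\<And>i. i < n \<Longrightarrow> G i q = pd i F q"
    and ev: "eventually (\<lambda>z. F z = F q + (\<Sum>i<n. (z i - q i) * G i z)) (nbhds n q)"
    using Hadamard_pd[OF F] by blast
  have h: "I (\<lambda>z. g' s z - g s z)" if "s < n" for s
    using I.cong_trans[OF I.cong_sym[OF lift_cong[OF g(2) that]] lift_cong[OF g(1) that]]
    by (simp add: cong_mod_def)
  have "mI (\<lambda>z. \<Sum>s<n. (pull g' (G s) z - pd s F q) * (g' s z - g s z) +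
      (g s z - q s) * (pull g' (G s) z - pull g (G s) z))"
  proof (intro mI.sum mI.add max_ideal_gen_mult)
    fix s assume "s \<in> {..<n}"
    then have s: "s < n" by simp
    show "hol0 (\<lambda>z. pull g' (G s) z - pd s F q)" "hol0 (\<lambda>z. g s z - q s)"
      using pull_hol[OF g(2) G(1)[OF s]] lift_hol[OF g(1) s] by (auto intro!: hol_intros)
    show "pull g' (G s) origin - pd s F q = 0" "g s origin - q s = 0"
      using pull_origin[OF g(2)] G(2)[OF s] lift_origin[OF g(1) s] by auto
    show "I (\<lambda>z. g' s z - g s z)" by (rule h[OF s])
    show "I (\<lambda>z. pull g' (G s) z - pull g (G s) z)"
      using I.cong_trans[OF I.cong_sym[OF pi_eq_pull[OF g(2) G(1)[OF s]]] pi_eq_pull[OF g(1) G(1)[OF s]]]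
      by (simp add: cong_mod_def)
  qed
  moreover have "eventually (\<lambda>z. (\<Sum>s<n. (pull g' (G s) z - pd s F q) * (g' s z - g s z) +
      (g s z - q s) * (pull g' (G s) z - pull g (G s) z)) =
      pull g' F z - (pull g F z + (\<Sum>s<n. pd s F q * (g' s z - g s z)))) (nbhds 2 origin)"
    using pull_Hadamard[OF g(1) ev] pull_Hadamard[OF g(2) ev]
  proof eventually_elim
    case (elim z)
    have "(\<Sum>s<n. (pull g' (G s) z - pd s F q) * (g' s z - g s z) +
        (g s z - q s) * (pull g' (G s) z - pull g (G s) z)) =
        (\<Sum>s<n. (g' s z - q s) * pull g' (G s) z - (g s z - q s) * pull g (G s) z -
          pd s F q * (g' s z - g s z))"
      by (intro sum.cong) (auto simp: algebra_simps)
    then show ?case using elim by (simp add: sum_subtractf)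
  qed
  ultimately show ?thesis unfolding cong_mod_def by (rule mI.cong)
qed

text \<open>The pullbacks of the preimages of \<open>x\<close> and \<open>y\<close> differ from \<open>x\<close> and \<open>y\<close> by terms of order two, so
  they generate the maximal ideal, too.\<close>

lemma vanishing_combination:
  assumes g: "lift g" and X: "\<And>i. i < 2 \<Longrightarrow> hol n q (X i)" "\<And>i. i < 2 \<Longrightarrow> cong_mod I (\<pi> (X i)) (\<lambda>z. z i)"
    and f: "hol0 f" "f origin = 0"
  shows "ideal_gen 2 origin 2 (\<lambda>i. pull g (X i)) f"
proof -
  interpret V: germ_ideal 2 origin "ideal_gen 2 origin 2 (\<lambda>i. pull g (X i))"
    by (rule germ_ideal_ideal_gen) simp
  have coord: "ideal_gen 2 origin 2 (\<lambda>i. pull g (X i)) (\<lambda>z. z i)" if "i < 2" for i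
  proof (rule V.Nakayama[where k = 2 and w = "\<lambda>i z. z i"])
    fix i :: nat assume i: "i < 2"
    have "max_pow (Suc 1) (\<lambda>z. z i - pull g (X i) z)"
      using pull_preimage(2)[OF g X(1)[OF i] X(2)[OF i] i] by (simp add: numeral_2_eq_2)
    then obtain a b where ab: "max_pow 1 a" "max_pow 1 b"
      "eventually (\<lambda>z. z i - pull g (X i) z = z 0 * a z + z 1 * b z) (nbhds 2 origin)"
      unfolding max_pow.simps(2)[of 1] by blast
    let ?m = "\<lambda>j::nat. if j = 0 then a else b"
    have ev: "eventually (\<lambda>z. pull g (X i) z = z i - (\<Sum>j<2. ?m j z * z j)) (nbhds 2 origin)"
      using ab(3) by eventually_elim (simp add: numeral_2_eq_2 algebra_simps)
    have V: "ideal_gen 2 origin 2 (\<lambda>i. pull g (X i)) (\<lambda>z. z i - (\<Sum>j<2. ?m j z * z j))"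
      by (rule V.cong[OF ideal_gen_generator[OF origin_in_coord_space i] ev])
    have "\<forall>j<2. hol0 (?m j) \<and> ?m j origin = 0"
      using ab max_pow_1_iff by simp
    then show "\<exists>\<mu>. (\<forall>j<2. hol0 (\<mu> j) \<and> \<mu> j origin = 0) \<and>
        ideal_gen 2 origin 2 (\<lambda>i. pull g (X i)) (\<lambda>z. z i - (\<Sum>j<2. \<mu> j z * z j))"
      using V by (intro exI[of _ ?m] conjI)
  qed (rule that)
  obtain G where G: "\<And>i::nat. i < 2 \<Longrightarrow> hol0 (G i)" "\<And>i. i < 2 \<Longrightarrow> G i origin = pd i f origin"
    and ev: "eventually (\<lambda>z. f z = f origin + z 0 * G 0 z + z 1 * G 1 z) (nbhds 2 origin)"
    using Hadamard_plane[OF f(1)] by blast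
  have "ideal_gen 2 origin 2 (\<lambda>i. pull g (X i)) (\<lambda>z. z 0 * G 0 z + z 1 * G 1 z)"
    using coord G by (intro V.add V.mult_right) auto
  then show ?thesis
    by (rule V.cong) (use ev f(2) in \<open>auto elim: eventually_mono\<close>)
qed

text \<open>Surjectivity of the quotient map gives F \<circ> g = f only modulo I. Expanding
  repeatedly in the generators X i \<circ> g of the maximal ideal reaches any order, in particular N
  + 1 and so congruence modulo mI.\<close>

lemma pull_approximates:
  assumes g: "lift g" and f: "hol0 f"
  shows "\<exists>F. hol n q F \<and> max_pow k (\<lambda>z. f z - pull g F z)"
  using f
proof (induction k arbitrary: f)
  case 0
  show ?case
    using hol_const[OF q, of 0] hol_diff[OF 0 pull_hol[OF g hol_const[OF q, of 0]]] by auto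
next
  case (Suc k)
  obtain X where X: "\<And>i. i < 2 \<Longrightarrow> hol n q (X i)" "\<And>i. i < 2 \<Longrightarrow> cong_mod I (\<pi> (X i)) (\<lambda>z. z i)"
    using plane_coordinate_preimages by blast
  have h: "hol0 (\<lambda>z. f z - f origin)" using Suc.prems by (intro hol_intros) auto
  obtain a where a: "\<forall>i<2. hol0 (a i)"
    "eventually (\<lambda>z. f z - f origin = (\<Sum>i<2. a i z * pull g (X i) z)) (nbhds 2 origin)"
    using vanishing_combination[OF g X h] unfolding ideal_gen_def by auto
  have "\<exists>F. \<forall>i. i < 2 \<longrightarrow> hol n q (F i) \<and> max_pow k (\<lambda>z. a i z - pull g (F i) z)"
    by (rule choice) (use Suc.IH a(1) in blast)
  then obtain F where F: "\<And>i. i < 2 \<Longrightarrow> hol n q (F i)" "\<And>i. i < 2 \<Longrightarrow> max_pow k (\<lambda>z. a i z - pull g (F i) z)"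
    by blast
  \<comment> \<open>In f - f(0) = \<Sum> a i (X i \<circ> g) the coefficients are replaced by their
    approximations F i \<circ> g; the vanishing factors X i \<circ> g improve the error by one
    order.\<close>
  let ?F = "\<lambda>z. f origin + (\<Sum>i<2. X i z * F i z)"
  have "hol n q ?F" using F X q by (intro hol_intros) auto
  moreover have "max_pow (Suc k) (\<lambda>z. \<Sum>i<2. pull g (X i) z * (a i z - pull g (F i) z))"
  proof (intro max_pow.sum max_pow_vanishing_mult)
    fix i :: nat assume "i \<in> {..<2}"
    then have i: "i < 2" by simp
    show "hol0 (pull g (X i))" "pull g (X i) origin = 0"
      using pull_preimage[OF g X(1)[OF i] X(2)[OF i] i] by auto
    show "max_pow k (\<lambda>z. a i z - pull g (F i) z)" by (rule F(2)[OF i])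
  qed
  then have "max_pow (Suc k) (\<lambda>z. f z - pull g ?F z)"
  proof (rule max_pow.cong)
    show "eventually (\<lambda>z. (\<Sum>i<2. pull g (X i) z * (a i z - pull g (F i) z)) = f z - pull g ?F z)
        (nbhds 2 origin)"
      using a(2)
    proof eventually_elim
      case (elim z)
      have "(\<Sum>i<2. pull g (X i) z * (a i z - pull g (F i) z)) =
          (\<Sum>i<2. a i z * pull g (X i) z) - (pull g ?F z - f origin)"
        by (simp add: pull_def sum_subtractf algebra_simps)
      also have "\<dots> = (f z - f origin) - (pull g ?F z - f origin)"
        using elim by simp
      finally show ?case by simp
    qed
  qed
  ultimately show ?case by blast
qed

text \<open>A preimage of f modulo I would be worthless here, since F = 0 is one. A preimage F
  modulo mI still lies in J, and pulling back its expression in the partial derivatives of \<Phi>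
  gives the combination.\<close>

lemma pull_partials_generate:
  assumes g: "lift g" and f: "I f"
  shows "\<exists>b. (\<forall>i<n. hol0 (b i)) \<and> cong_mod mI f (\<lambda>z. \<Sum>i<n. b i z * pull g (pd i \<Phi>) z)"
proof -
  obtain F where F: "hol n q F" "max_pow (Suc N) (\<lambda>z. f z - pull g F z)"
    using pull_approximates[OF g I_hol[OF f]] by blast
  have m: "cong_mod mI f (pull g F)"
    unfolding cong_mod_def by (rule max_pow_Suc_imp_mI[OF F(2)])
  then have "cong_mod I f (pull g F)"
    unfolding cong_mod_def by (rule max_ideal_gen_imp_ideal_gen)
  then have "J F" using f I.cong_mem pull_mem[OF g F(1)] by blast
  then obtain b where b: "\<forall>i<n. hol n q (b i)"
    "eventually (\<lambda>z. F z = (\<Sum>i<n. b i z * pd i \<Phi> z)) (nbhds n q)"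
    unfolding ideal_gen_def by blast
  have "eventually (\<lambda>z. pull g F z = (\<Sum>i<n. pull g (b i) z * pull g (pd i \<Phi>) z)) (nbhds 2 origin)"
    using eventually_compose_filterlim[OF b(2) filterlim_pull[OF g]] by (simp add: pull_def)
  then have "cong_mod mI f (\<lambda>z. \<Sum>i<n. pull g (b i) z * pull g (pd i \<Phi>) z)"
    by (intro mI.cong_trans[OF m] mI.cong_eventually)
  moreover have "\<forall>i<n. hol0 (pull g (b i))" using pull_hol[OF g] b(1) by blast
  ultimately show ?thesis by (intro exI[of _ "\<lambda>i. pull g (b i)"] conjI)
qed

text \<open>The condition on \<open>v\<close> says that the linear form \<Sum> v i (z i - q i) pulls
  back into m^2. Corrected by products X i R i of functions that vanish at \<open>q\<close>, it
  pulls back into I, so it belongs to J. Linear parts at \<open>q\<close> of elements of J are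
  combinations of rows of the Hessian, because \<open>q\<close> is a critical point.\<close>

lemma Hessian_image:
  assumes g: "lift g" and v: "\<And>j. j < 2 \<Longrightarrow> (\<Sum>i<n. v i * pd j (g i) origin) = 0"
  shows "\<exists>k. \<forall>l<n. v l = (\<Sum>i<n. k i * pd l (pd i \<Phi>) q)"
proof -
  obtain X where X: "\<And>i. i < 2 \<Longrightarrow> hol n q (X i)" "\<And>i. i < 2 \<Longrightarrow> cong_mod I (\<pi> (X i)) (\<lambda>z. z i)"
    using plane_coordinate_preimages by blast
  note P = pull_preimage[OF g X]
  define f where "f = (\<lambda>z. \<Sum>i<n. v i * (g i z - q i))"
  have gh: "hol0 (\<lambda>z. g i z - q i)" if "i < n" for i
    using lift_hol[OF g that] by (intro hol_intros) auto
  have f: "hol0 f" unfolding f_def by (intro hol_sum hol_mult hol_const) (auto intro: gh)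
  have fo: "f origin = 0" unfolding f_def using lift_origin[OF g] by simp
  obtain a where a: "\<forall>i<2. hol0 (a i)"
    "eventually (\<lambda>z. f z = (\<Sum>i<2. a i z * pull g (X i) z)) (nbhds 2 origin)"
    using vanishing_combination[OF g X f fo] unfolding ideal_gen_def by auto
  \<comment> \<open>The first derivatives of \<open>f\<close> vanish by the choice of
    \<open>v\<close>, and those of X i \<circ> g form the identity matrix; comparison isolates the
    value of \<open>a j\<close>.\<close>
  have ao: "a j origin = 0" if j: "j < 2" for j
  proof -
    have "pd j f origin = (\<Sum>i<n. pd j (\<lambda>_. v i) origin * (g i origin - q i) + v i * pd j (\<lambda>z. g i z - q i) origin)"
      unfolding f_def using gh j by (intro pd_linear_combination[of _ 2]) (auto intro: hol_const)
    also have "\<dots> = (\<Sum>i<n. v i * pd j (g i) origin)"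
      using j lift_hol[OF g] by (intro sum.cong refl) (auto simp: pd_diff[of 2] hol_const)
    finally have 0: "pd j f origin = 0" using v[OF j] by simp
    have "pd j f origin = pd j (\<lambda>z. \<Sum>i<2. a i z * pull g (X i) z) origin"
      by (rule pd_cong[OF a(2) _ j]) simp
    also have "\<dots> = (\<Sum>i<2. pd j (a i) origin * pull g (X i) origin + a i origin * pd j (pull g (X i)) origin)"
      using a(1) j P(1) by (intro pd_linear_combination[of _ 2]) auto
    also have "\<dots> = (\<Sum>i<2. if i = j then a i origin else 0)"
      using j P(3,5) by (intro sum.cong refl) auto
    finally show ?thesis using 0 j by simp
  qed
  have "\<exists>R. \<forall>i. i < 2 \<longrightarrow> hol n q (R i) \<and> cong_mod I (\<pi> (R i)) (a i)"
    by (rule choice) (use pi_surj a(1) in blast)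
  then obtain R where R: "\<And>i. i < 2 \<Longrightarrow> hol n q (R i)" "\<And>i. i < 2 \<Longrightarrow> cong_mod I (\<pi> (R i)) (a i)"
    by blast
  have Rq: "R i q = 0" if "i < 2" for i
    using cong_I_origin[OF R(2)[OF that]] pi_value[OF R(1)[OF that]] ao[OF that] by simp
  \<comment> \<open>X i and R i both vanish at \<open>q\<close>, so the correction does not change
    the linear part \<open>v\<close>.\<close>
  define F where "F = (\<lambda>z. (\<Sum>i<n. v i * (z i - q i)) - (\<Sum>i<2. X i z * R i z))"
  have F1: "hol n q (\<lambda>z. \<Sum>i<n. v i * (z i - q i))" using q by (intro hol_intros) auto
  have F2: "hol n q (\<lambda>z. \<Sum>i<2. X i z * R i z)" using q X R by (intro hol_intros) auto
  have F: "hol n q F" unfolding F_def by (rule hol_diff[OF F1 F2])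
  have "I (\<lambda>z. \<Sum>i<2. pull g (X i) z * (a i z - pull g (R i) z))"
  proof (intro I.sum I.mult)
    fix i :: nat assume "i \<in> {..<2}"
    then have i: "i < 2" by simp
    show "hol0 (pull g (X i))" by (rule P(1)[OF i i i])
    show "I (\<lambda>z. a i z - pull g (R i) z)"
      using I.cong_trans[OF I.cong_sym[OF R(2)[OF i]] pi_eq_pull[OF g R(1)[OF i]]] by (simp add: cong_mod_def)
  qed
  moreover have "eventually (\<lambda>z. (\<Sum>i<2. pull g (X i) z * (a i z - pull g (R i) z)) = pull g F z) (nbhds 2 origin)"
    using a(2)
  proof eventually_elim
    case (elim z)
    have "pull g F z = f z - (\<Sum>i<2. pull g (X i) z * pull g (R i) z)"
      by (simp add: pull_def F_def f_def tuple_def)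
    then show ?case using elim by (simp add: sum_subtractf algebra_simps)
  qed
  ultimately have "I (pull g F)" by (rule I.cong)
  then have "J F" using pull_mem[OF g F] by blast
  then obtain b where b: "\<forall>i<n. hol n q (b i)"
    "eventually (\<lambda>z. F z = (\<Sum>i<n. b i z * pd i \<Phi> z)) (nbhds n q)"
    unfolding ideal_gen_def by blast
  have "v l = (\<Sum>i<n. b i q * pd l (pd i \<Phi>) q)" if l: "l < n" for l
  proof -
    have "pd l F q = pd l (\<lambda>z. \<Sum>i<n. b i z * pd i \<Phi> z) q"
      by (rule pd_cong[OF b(2) q l])
    also have "\<dots> = (\<Sum>i<n. pd l (b i) q * pd i \<Phi> q + b i q * pd l (pd i \<Phi>) q)"
      using b(1) l q hol_pd[OF Phi] by (intro pd_linear_combination[of _ n]) auto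
    also have "\<dots> = (\<Sum>i<n. b i q * pd l (pd i \<Phi>) q)"
      using critical_point by (intro sum.cong) auto
    finally have 1: "pd l F q = (\<Sum>i<n. b i q * pd l (pd i \<Phi>) q)" .
    have "pd l F q = pd l (\<lambda>z. \<Sum>i<n. v i * (z i - q i)) q - pd l (\<lambda>z. \<Sum>i<2. X i z * R i z) q"
      unfolding F_def by (rule pd_diff[OF F1 F2 l])
    also have "pd l (\<lambda>z. \<Sum>i<2. X i z * R i z) q = (\<Sum>i<2. pd l (X i) q * R i q + X i q * pd l (R i) q)"
      using X R l q by (intro pd_linear_combination[of _ n]) auto
    also have "\<dots> = 0" using P(4) Rq by (intro sum.neutral) auto
    also have "pd l (\<lambda>z. \<Sum>i<n. v i * (z i - q i)) q =
        (\<Sum>i<n. pd l (\<lambda>_. v i) q * (q i - q i) + v i * pd l (\<lambda>z. z i - q i) q)"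
      using l q by (intro pd_linear_combination[of _ n] hol_intros) auto
    also have "\<dots> = (\<Sum>i<n. if i = l then v i else 0)"
      using l q by (intro sum.cong refl) (auto simp: pd_diff[of n] hol_const hol_coord)
    finally show ?thesis using 1 l by simp
  qed
  then show ?thesis by (intro exI[of _ "\<lambda>i. b i q"]) simp
qed

section \<open>The pulled-back function and the ideal of its partial derivatives\<close>

lemma pull_Phi_pd:
  assumes g: "lift g" and j: "j < 2"
  shows "eventually (\<lambda>z. pd j (pull g \<Phi>) z = (\<Sum>i<n. pull g (pd i \<Phi>) z * pd j (g i) z)) (nbhds 2 origin)"
proof -
  have "eventually (\<lambda>z. hol n (tuple n (\<lambda>i. g i z)) \<Phi>) (nbhds 2 origin)"
    using hol_eventually[OF Phi] filterlim_pull[OF g] by (rule eventually_compose_filterlim)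
  moreover have "eventually (\<lambda>z. \<forall>i\<in>{..<n}. hol 2 z (g i)) (nbhds 2 origin)"
    using lift_hol[OF g] by (intro eventually_ball_finite) (auto intro: hol_eventually)
  ultimately show ?thesis
  proof eventually_elim
    case (elim z)
    then show ?case
      unfolding pull_def by (intro pd_compose[OF _ _ _ j]) (auto simp: tuple_def)
  qed
qed

text \<open>The function stays the pullback along the given \<open>g\<close>. The corrected lift g'
  serves only to supply generators of I that are, modulo mI, combinations of the partial derivatives
  of this function.\<close>

lemma pull_Phi_critical:
  assumes g: "lift g"
  shows "hol0 (pull g \<Phi>)" "\<And>j. j < 2 \<Longrightarrow> I (pd j (pull g \<Phi>))"
    "\<And>j. j < 2 \<Longrightarrow> ideal_gen 2 origin 2 (\<lambda>i. pd i (pull g \<Phi>)) (w j)"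
proof -
  let ?\<phi> = "pull g \<Phi>" and ?e = "\<lambda>i. pull g (pd i \<Phi>)"
  let ?V = "ideal_gen 2 origin 2 (\<lambda>i. pd i ?\<phi>)"
  define D where "D = (\<lambda>j i. pd j (g i) origin)"
  show "hol0 ?\<phi>" by (rule pull_hol[OF g Phi])
  have e: "I (?e i)" "hol0 (?e i)" if "i < n" for i
    using pull_pd_Phi[OF g that] I_hol by auto
  have gpd: "hol0 (pd j (g i))" if "i < n" "j < 2" for i j
    by (rule hol_pd[OF lift_hol[OF g that(1)] that(2)])
  show I\<phi>: "I (pd j ?\<phi>)" if j: "j < 2" for j
  proof (rule I.cong)
    show "I (\<lambda>z. \<Sum>i<n. ?e i z * pd j (g i) z)"
      using e gpd j by (intro I.sum I.mult_right) auto
    show "eventually (\<lambda>z. (\<Sum>i<n. ?e i z * pd j (g i) z) = pd j ?\<phi> z) (nbhds 2 origin)"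
      using pull_Phi_pd[OF g j] by eventually_elim simp
  qed
  \<comment> \<open>Replacing the derivatives of \<open>g\<close> by their values at the origin
    costs an element of mI, because each ?e i lies in I.\<close>
  have c\<phi>: "cong_mod mI (\<lambda>z. \<Sum>i<n. ?e i z * D j i) (pd j ?\<phi>)" if j: "j < 2" for j
  proof -
    have "mI (\<lambda>z. \<Sum>i<n. (pd j (g i) z - D j i) * ?e i z)"
      using gpd j e by (intro mI.sum max_ideal_gen_mult hol_diff hol_const) (auto simp: D_def)
    then have "cong_mod mI (\<lambda>z. \<Sum>i<n. ?e i z * pd j (g i) z) (\<lambda>z. \<Sum>i<n. ?e i z * D j i)"
      unfolding cong_mod_def by (rule mI.ext) (simp add: sum_subtractf algebra_simps)
    then show ?thesis
      using mI.cong_trans[OF mI.cong_eventually[OF pull_Phi_pd[OF g j]]] mI.cong_sym by blast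
  qed
  obtain X where X: "\<And>i. i < 2 \<Longrightarrow> hol n q (X i)" "\<And>i. i < 2 \<Longrightarrow> cong_mod I (\<pi> (X i)) (\<lambda>z. z i)"
    using plane_coordinate_preimages by blast
  define U where "U = (\<lambda>i l. pd l (X i) q)"
  \<comment> \<open>The differential \<open>U\<close> of X at \<open>q\<close> is a left inverse of
    the differential \<open>D\<close> of \<open>g\<close> at the origin.\<close>
  have UD: "(\<Sum>l<n. U i l * D j l) = (if i = j then 1 else 0)" if "i < 2" "j < 2" for i j
    using pull_preimage(5)[OF g X(1)[OF that(1)] X(2)[OF that(1)] that]
      pull_pd[OF g X(1)[OF that(1)] that(2)] by (simp add: U_def D_def)
  text \<open>\<open>P i\<close> is the projection of the \<open>i\<close>-th unit vector to the annihilator of the two rows of \<open>D\<close>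
    along the span of the two rows of \<open>U\<close>.\<close>
  define P where "P = (\<lambda>i l. (if l = i then 1 else 0) - (\<Sum>m<2. D m i * U m l))"
  have "\<exists>k. \<forall>i. i < n \<longrightarrow> (\<forall>l<n. P i l = (\<Sum>s<n. k i s * pd l (pd s \<Phi>) q))"
  proof (rule choice, intro allI)
    fix i
    show "\<exists>k. i < n \<longrightarrow> (\<forall>l<n. P i l = (\<Sum>s<n. k s * pd l (pd s \<Phi>) q))"
    proof (cases "i < n")
      case i: True
      have "(\<Sum>l<n. P i l * pd j (g l) origin) = 0" if j: "j < 2" for j
      proof -
        have "(\<Sum>l<n. P i l * D j l) =
            (\<Sum>l<n. (if l = i then D j l else 0) - (\<Sum>m<2. D m i * (U m l * D j l)))"
          unfolding P_def by (intro sum.cong) (auto simp: left_diff_distrib sum_distrib_right mult.assoc)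
        also have "\<dots> = D j i - (\<Sum>l<n. \<Sum>m<2. D m i * (U m l * D j l))"
          using i by (simp add: sum_subtractf)
        also have "(\<Sum>l<n. \<Sum>m<2. D m i * (U m l * D j l)) = (\<Sum>m<2. D m i * (\<Sum>l<n. U m l * D j l))"
          by (subst sum.swap) (simp add: sum_distrib_left)
        also have "\<dots> = (\<Sum>m<2. if m = j then D m i else 0)"
          using UD j by (intro sum.cong) auto
        finally show ?thesis using j by (simp add: D_def)
      qed
      from Hessian_image[OF g this] show ?thesis by blast
    qed simp
  qed
  then obtain k where k: "\<And>i l. i < n \<Longrightarrow> l < n \<Longrightarrow> P i l = (\<Sum>s<n. k i s * pd l (pd s \<Phi>) q)" by blast
  \<comment> \<open>By the choice of \<open>k\<close>, the Hessian sends this correction to - \<Sum>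
    ?e i P i. To first order ?e l thus becomes ?e l - \<Sum> ?e i P i l, and by the definition of
    \<open>P\<close> only the combinations \<Sum> ?e i D m i with weights U m l survive.\<close>
  define g' where "g' = (\<lambda>s z. g s z - (\<Sum>i<n. k i s * ?e i z))"
  have Ih: "I (\<lambda>z. \<Sum>i<n. k i s * ?e i z)" for s using e by (intro I.sum I.scale) auto
  have g': "lift g'"
    unfolding lift_def
  proof (intro allI impI conjI)
    fix s assume s: "s < n"
    show "hol0 (g' s)" unfolding g'_def using lift_hol[OF g s] I_hol[OF Ih] by (rule hol_diff)
    have "cong_mod I (g s) (g' s)"
      unfolding cong_mod_def by (rule I.ext[OF Ih[of s]]) (simp add: g'_def)
    then show "cong_mod I (\<pi> (\<lambda>z. z s)) (g' s)" using I.cong_trans[OF lift_cong[OF g s]] by blast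
  qed
  have e': "cong_mod mI (pull g' (pd l \<Phi>)) (\<lambda>z. \<Sum>m<2. U m l * pd m ?\<phi> z)" if l: "l < n" for l
  proof -
    \<comment> \<open>\<open>first_order\<close> and \<open>Hessian_image\<close> produce the mixed
      derivatives in opposite orders.\<close>
    have s: "pd s (pd l \<Phi>) q = pd l (pd s \<Phi>) q" if "s < n" for s
      by (rule pd_commute[OF Phi that l])
    have "?e l z + (\<Sum>s<n. pd s (pd l \<Phi>) q * (g' s z - g s z)) = (\<Sum>m<2. U m l * (\<Sum>i<n. ?e i z * D m i))" for z
    proof -
      have "(\<Sum>s<n. pd s (pd l \<Phi>) q * (g' s z - g s z)) =
          - (\<Sum>s<n. \<Sum>i<n. ?e i z * (k i s * pd l (pd s \<Phi>) q))"
        unfolding sum_negf[symmetric]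
        by (intro sum.cong refl) (simp add: g'_def s sum_distrib_left sum_negf algebra_simps)
      also have "(\<Sum>s<n. \<Sum>i<n. ?e i z * (k i s * pd l (pd s \<Phi>) q)) = (\<Sum>i<n. ?e i z * P i l)"
        by (subst sum.swap) (simp add: k l sum_distrib_left)
      also have "\<dots> = (\<Sum>i<n. (if i = l then ?e i z else 0) - (\<Sum>m<2. U m l * (?e i z * D m i)))"
        unfolding P_def by (intro sum.cong) (auto simp: right_diff_distrib sum_distrib_left mult_ac)
      also have "\<dots> = ?e l z - (\<Sum>i<n. \<Sum>m<2. U m l * (?e i z * D m i))"
        using l by (simp add: sum_subtractf)
      also have "(\<Sum>i<n. \<Sum>m<2. U m l * (?e i z * D m i)) = (\<Sum>m<2. U m l * (\<Sum>i<n. ?e i z * D m i))"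
        by (subst sum.swap) (simp add: sum_distrib_left)
      finally show ?thesis by simp
    qed
    then have 1: "cong_mod mI (pull g' (pd l \<Phi>)) (\<lambda>z. \<Sum>m<2. U m l * (\<Sum>i<n. ?e i z * D m i))"
      using first_order[OF g g' hol_pd[OF Phi l]] by simp
    have "mI (\<lambda>z. \<Sum>m<2. U m l * ((\<Sum>i<n. ?e i z * D m i) - pd m ?\<phi> z))"
      using c\<phi> by (intro mI.sum mI.scale) (auto simp: cong_mod_def)
    then have "cong_mod mI (\<lambda>z. \<Sum>m<2. U m l * (\<Sum>i<n. ?e i z * D m i)) (\<lambda>z. \<Sum>m<2. U m l * pd m ?\<phi> z)"
      unfolding cong_mod_def by (simp add: right_diff_distrib sum_subtractf)
    then show ?thesis by (rule mI.cong_trans[OF 1])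
  qed
  interpret V: germ_ideal 2 origin ?V by (rule germ_ideal_ideal_gen) simp
  show "?V (w j)" if j: "j < 2" for j
  \<comment> \<open>\<open>w j\<close> is a combination of the pullbacks along g', hence of the
    partial derivatives of the pulled-back function, up to an element of mI. That element is a
    combination of the \<open>w i\<close> with coefficients vanishing at the origin.\<close>
  proof (rule V.Nakayama[OF _ j])
    fix j :: nat assume j: "j < 2"
    have "I (w j)" by (rule ideal_gen_generator[OF origin_in_coord_space j])
    then obtain b where b: "\<forall>i<n. hol0 (b i)"
      and c1: "cong_mod mI (w j) (\<lambda>z. \<Sum>i<n. b i z * pull g' (pd i \<Phi>) z)"
      using pull_partials_generate[OF g'] by blast
    let ?v = "\<lambda>z. \<Sum>i<n. b i z * (\<Sum>m<2. U m i * pd m ?\<phi> z)"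
    have "mI (\<lambda>z. \<Sum>i<n. b i z * (pull g' (pd i \<Phi>) z - (\<Sum>m<2. U m i * pd m ?\<phi> z)))"
      using b e' by (intro mI.sum mI.mult) (auto simp: cong_mod_def)
    then have "cong_mod mI (\<lambda>z. \<Sum>i<n. b i z * pull g' (pd i \<Phi>) z) ?v"
      unfolding cong_mod_def by (simp add: right_diff_distrib sum_subtractf)
    from mI.cong_trans[OF c1 this] have "mI (\<lambda>z. w j z - ?v z)"
      unfolding cong_mod_def .
    then obtain \<mu> where \<mu>: "\<forall>i<2. hol0 (\<mu> i) \<and> \<mu> i origin = 0"
      "eventually (\<lambda>z. w j z - ?v z = (\<Sum>i<2. \<mu> i z * w i z)) (nbhds 2 origin)"
      unfolding max_ideal_gen_def by blast
    have "?V ?v"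
      using b by (intro V.sum V.mult V.scale ideal_gen_generator[OF origin_in_coord_space]) auto
    then have "?V (\<lambda>z. w j z - (\<Sum>i<2. \<mu> i z * w i z))"
      by (rule V.cong) (use \<mu>(2) in \<open>auto elim!: eventually_mono simp: algebra_simps\<close>)
    then show "\<exists>\<mu>. (\<forall>i<2. hol0 (\<mu> i) \<and> \<mu> i origin = 0) \<and> ?V (\<lambda>z. w j z - (\<Sum>i<2. \<mu> i z * w i z))"
      using \<mu>(1) by (intro exI[of _ \<mu>] conjI)
  qed
qed

end

lemma (in milnor_lift) exists_critical:
  "\<exists>\<phi>. hol0 \<phi> \<and> (\<forall>j<2. ideal_gen 2 origin 2 w (pd j \<phi>)) \<and>
    (\<forall>j<2. ideal_gen 2 origin 2 (\<lambda>i. pd i \<phi>) (w j))"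
  using pull_Phi_critical[OF lift_pi_coord] by blast

section \<open>Stalks of zero schemes in a chart\<close>

locale chart_at =
  fixes M :: "'m manifold" and c :: "'m chart" and p :: 'm
  assumes manifold: "complex_manifold M" and chart: "c \<in> man_atlas M" and p: "p \<in> chart_dom c"
begin

abbreviation "n \<equiv> chart_dim c"
abbreviation "\<kappa> \<equiv> chart_map c"
abbreviation "\<iota> \<equiv> chart_inv c"
abbreviation "q \<equiv> chart_map c p"

lemma openin_dom: "openin (man_top M) (chart_dom c)"
  using manifold chart unfolding complex_manifold_def by blast

lemma openin_image: "openin (complex_space n) (\<kappa> ` chart_dom c)"
  using manifold chart unfolding complex_manifold_def by blast

lemma homeomorphic_chart: "homeomorphic_map (subtopology (man_top M) (chart_dom c))
    (subtopology (complex_space n) (\<kappa> ` chart_dom c)) \<kappa>"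
  using manifold chart unfolding complex_manifold_def by blast

lemma dom_subset: "chart_dom c \<subseteq> topspace (man_top M)"
  using openin_dom openin_subset by blast

lemma p_topspace: "p \<in> topspace (man_top M)"
  using dom_subset p by blast

lemma inj_chart: "inj_on \<kappa> (chart_dom c)"
  using homeomorphic_imp_injective_map[OF homeomorphic_chart] dom_subset
  by (simp add: topspace_subtopology inf.absorb2)

lemma inv_map: "x \<in> chart_dom c \<Longrightarrow> \<iota> (\<kappa> x) = x"
  unfolding chart_inv_def by (rule inv_into_f_f[OF inj_chart])

lemma map_inv: "z \<in> \<kappa> ` chart_dom c \<Longrightarrow> \<kappa> (\<iota> z) = z"
  unfolding chart_inv_def by (rule f_inv_into_f)

lemma map_coord_space: "x \<in> chart_dom c \<Longrightarrow> \<kappa> x \<in> coord_space n"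
  using openin_complex_space_subset[OF openin_image] by blast

lemma q: "q \<in> coord_space n"
  using map_coord_space p by blast

lemma openin_image_iff:
  assumes "V \<subseteq> chart_dom c"
  shows "openin (complex_space n) (\<kappa> ` V) \<longleftrightarrow> openin (man_top M) V"
proof -
  have "openin (subtopology (complex_space n) (\<kappa> ` chart_dom c)) (\<kappa> ` V) \<longleftrightarrow>
      openin (subtopology (man_top M) (chart_dom c)) V"
    using homeomorphic_map_openness[OF homeomorphic_chart, of V] assms dom_subset
    by (simp add: topspace_subtopology inf.absorb2)
  then show ?thesis
    using assms by (simp add: openin_open_subtopology openin_dom openin_image image_mono)
qed

lemma openin_preimage:
  assumes "openin (complex_space n) S"
  shows "openin (man_top M) {x \<in> chart_dom c. \<kappa> x \<in> S}"
proof -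
  have "\<kappa> ` {x \<in> chart_dom c. \<kappa> x \<in> S} = \<kappa> ` chart_dom c \<inter> S" by blast
  then show ?thesis
    using openin_image_iff[of "{x \<in> chart_dom c. \<kappa> x \<in> S}"] openin_Int[OF openin_image assms] by auto
qed

lemma eventually_chart:
  "eventually P (nhdsin (man_top M) p) \<longleftrightarrow> eventually (\<lambda>z. P (\<iota> z)) (nbhds n q)"
proof
  assume "eventually P (nhdsin (man_top M) p)"
  then obtain V where V: "openin (man_top M) V" "p \<in> V" "\<forall>x\<in>V. P x"
    using p_topspace unfolding eventually_nhdsin by blast
  have "openin (complex_space n) (\<kappa> ` (V \<inter> chart_dom c))"
    using openin_image_iff[of "V \<inter> chart_dom c"] openin_Int[OF V(1) openin_dom] by auto
  moreover have "\<forall>z\<in>\<kappa> ` (V \<inter> chart_dom c). P (\<iota> z)" using V(3) inv_map by auto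
  ultimately show "eventually (\<lambda>z. P (\<iota> z)) (nbhds n q)"
    unfolding eventually_nbhds[OF q] using V(2) p by blast
next
  assume "eventually (\<lambda>z. P (\<iota> z)) (nbhds n q)"
  then obtain S where S: "openin (complex_space n) S" "q \<in> S" "\<forall>z\<in>S. P (\<iota> z)"
    unfolding eventually_nbhds[OF q] by blast
  have "\<forall>x\<in>{x \<in> chart_dom c. \<kappa> x \<in> S}. P x" using S(3) inv_map by force
  then show "eventually P (nhdsin (man_top M) p)"
    unfolding eventually_nhdsin using openin_preimage[OF S(1)] S(2) p by blast
qed

lemma eventually_map_inv: "eventually (\<lambda>z. z \<in> \<kappa> ` chart_dom c) (nbhds n q)"
  unfolding eventually_nbhds[OF q] using openin_image p by blast

lemma hol_chart_fun:
  assumes "holomorphic_fun M W f" "p \<in> W"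
  shows "hol n q (\<lambda>z. f (\<iota> z))"
proof -
  have "holomorphic_n n (\<kappa> ` (chart_dom c \<inter> W)) (\<lambda>z. f (\<iota> z))" and W: "openin (man_top M) W"
    using assms chart unfolding holomorphic_fun_def by auto
  moreover have "openin (complex_space n) (\<kappa> ` (chart_dom c \<inter> W))"
    using openin_image_iff[of "chart_dom c \<inter> W"] openin_Int[OF openin_dom W] by auto
  ultimately show ?thesis using holomorphic_n_imp_hol p assms(2) by blast
qed

lemma hol_transition:
  assumes "c' \<in> man_atlas M" "p \<in> chart_dom c'" "i < chart_dim c'"
  shows "hol n q (\<lambda>z. chart_map c' (\<iota> z) i)"
proof -
  have "holomorphic_n n (\<kappa> ` (chart_dom c \<inter> chart_dom c')) (\<lambda>z. chart_map c' (\<iota> z) i)"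
    using manifold chart assms unfolding complex_manifold_def by blast
  moreover have "openin (man_top M) (chart_dom c')"
    using manifold assms(1) unfolding complex_manifold_def by blast
  then have "openin (complex_space n) (\<kappa> ` (chart_dom c \<inter> chart_dom c'))"
    using openin_image_iff[of "chart_dom c \<inter> chart_dom c'"] openin_Int[OF openin_dom] by auto
  ultimately show ?thesis using holomorphic_n_imp_hol p assms(2) by blast
qed

end

text \<open>Seen in another chart, the function is \<open>F\<close> composed with a transition map,
  so holomorphy follows from \<open>hol_compose\<close>; \<open>tuple\<close> is inserted only to
  match the form of that lemma.\<close>

lemma (in chart_at) holomorphic_fun_of_chart:
  assumes F: "openin (complex_space n) S" "holomorphic_n n S F" "S \<subseteq> \<kappa> ` chart_dom c"
  shows "holomorphic_fun M {x \<in> chart_dom c. \<kappa> x \<in> S} (\<lambda>x. F (\<kappa> x))"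
  unfolding holomorphic_fun_def
proof (intro conjI ballI)
  show "openin (man_top M) {x \<in> chart_dom c. \<kappa> x \<in> S}" by (rule openin_preimage[OF F(1)])
  fix c' assume c': "c' \<in> man_atlas M"
  show "holomorphic_n (chart_dim c') (chart_map c' ` (chart_dom c' \<inter> {x \<in> chart_dom c. \<kappa> x \<in> S}))
      (\<lambda>z. F (\<kappa> (chart_inv c' z)))"
  proof (rule hol_imp_holomorphic_n)
    fix z assume "z \<in> chart_map c' ` (chart_dom c' \<inter> {x \<in> chart_dom c. \<kappa> x \<in> S})"
    then obtain x where x: "x \<in> chart_dom c'" "x \<in> chart_dom c" "\<kappa> x \<in> S" "z = chart_map c' x" by blast
    interpret c': chart_at M c' x using manifold c' x(1) by unfold_locales
    have h: "hol n (\<kappa> x) F" by (rule holomorphic_n_imp_hol[OF F(2,1) x(3)])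
    have "hol (chart_dim c') z (\<lambda>z. F (tuple n (\<lambda>i. \<kappa> (chart_inv c' z) i)))"
    proof (rule hol_compose[OF h])
      show "z \<in> coord_space (chart_dim c')" using c'.q x(4) by simp
      show "hol (chart_dim c') z (\<lambda>z. \<kappa> (chart_inv c' z) i)" if "i < n" for i
        using c'.hol_transition[OF chart x(2) that] x(4) by simp
      show "\<kappa> (chart_inv c' z) i = \<kappa> x i" for i
        using c'.inv_map[OF x(1)] x(4) by simp
    qed
    moreover have "eventually (\<lambda>z. chart_inv c' z \<in> chart_dom c) (nbhds (chart_dim c') z)"
    proof -
      have "eventually (\<lambda>y. y \<in> chart_dom c) (nhdsin (man_top M) x)"
        unfolding eventually_nhdsin using openin_dom x(2) by blast
      then show ?thesis using c'.eventually_chart x(4) by simp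
    qed
    then have "eventually (\<lambda>z. F (tuple n (\<lambda>i. \<kappa> (chart_inv c' z) i)) = F (\<kappa> (chart_inv c' z)))
        (nbhds (chart_dim c') z)"
      by eventually_elim (simp only: tuple_coord_space[OF map_coord_space])
    ultimately show "hol (chart_dim c') z (\<lambda>z. F (\<kappa> (chart_inv c' z)))" by (rule hol_cong)
  qed
qed

section \<open>The local ring at a point in coordinates\<close>

context chart_at
begin

definition chart_germ :: "((nat \<Rightarrow> complex) \<Rightarrow> complex) \<Rightarrow> ('m \<Rightarrow> complex) set" where
  "chart_germ F = germ M p (\<lambda>x. F (\<kappa> x))"

lemma ex_holomorphic_fun:
  assumes "hol n q F"
  shows "\<exists>W. p \<in> W \<and> holomorphic_fun M W (\<lambda>x. F (\<kappa> x))"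
proof -
  obtain S where S: "openin (complex_space n) S" "q \<in> S" "holomorphic_n n S F"
    using assms by (auto simp: hol_def)
  have "holomorphic_n n (S \<inter> \<kappa> ` chart_dom c) F" by (rule holomorphic_n_subset[OF S(3)]) simp
  from holomorphic_fun_of_chart[OF openin_Int[OF S(1) openin_image] this]
  show ?thesis
    using p S(2) by (intro exI[of _ "{x \<in> chart_dom c. \<kappa> x \<in> S \<inter> \<kappa> ` chart_dom c}"]) auto
qed

lemma germ_eq_chart_germ: "germ M p f = chart_germ (\<lambda>z. f (\<iota> z))"
  unfolding chart_germ_def germ_eq_iff eventually_chart
  using eventually_map_inv by eventually_elim (simp add: map_inv)

lemma chart_germ_eq_iff: "chart_germ F = chart_germ G \<longleftrightarrow> eventually (\<lambda>z. F z = G z) (nbhds n q)"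
proof -
  have "eventually (\<lambda>z. (F (\<kappa> (\<iota> z)) = G (\<kappa> (\<iota> z))) = (F z = G z)) (nbhds n q)"
    using eventually_map_inv by eventually_elim (simp add: map_inv)
  then show ?thesis
    unfolding chart_germ_def germ_eq_iff eventually_chart by (rule eventually_subst)
qed

lemma carrier_local_ring: "carrier (local_ring M p) = {chart_germ F | F. hol n q F}"
proof (intro equalityI subsetI)
  fix x assume "x \<in> carrier (local_ring M p)"
  then obtain f W where "x = germ M p f" "p \<in> W" "holomorphic_fun M W f"
    by (auto simp: local_ring_def)
  then show "x \<in> {chart_germ F | F. hol n q F}"
    using germ_eq_chart_germ hol_chart_fun by blast
next
  fix x assume "x \<in> {chart_germ F | F. hol n q F}"
  then show "x \<in> carrier (local_ring M p)"
    using ex_holomorphic_fun by (auto simp: local_ring_def chart_germ_def)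
qed

lemma chart_germ_carrier: "hol n q F \<Longrightarrow> chart_germ F \<in> carrier (local_ring M p)"
  using carrier_local_ring by blast

lemma chart_germ_add: "chart_germ F \<oplus>\<^bsub>local_ring M p\<^esub> chart_germ G = chart_germ (\<lambda>z. F z + G z)"
  by (simp add: local_ring_def chart_germ_def germ_add)

lemma chart_germ_mult: "chart_germ F \<otimes>\<^bsub>local_ring M p\<^esub> chart_germ G = chart_germ (\<lambda>z. F z * G z)"
  by (simp add: local_ring_def chart_germ_def germ_mult)

lemma chart_germ_zero: "\<zero>\<^bsub>local_ring M p\<^esub> = chart_germ (\<lambda>_. 0)"
  by (simp add: local_ring_def chart_germ_def)

lemma chart_germ_one: "\<one>\<^bsub>local_ring M p\<^esub> = chart_germ (\<lambda>_. 1)"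
  by (simp add: local_ring_def chart_germ_def)

sublocale R: cring "local_ring M p"
  by (rule cring_local_ring[OF p_topspace])

lemma chart_germ_minus:
  assumes "hol n q F" "hol n q G"
  shows "chart_germ F \<ominus>\<^bsub>local_ring M p\<^esub> chart_germ G = chart_germ (\<lambda>z. F z - G z)"
proof -
  have "chart_germ (\<lambda>z. F z - G z) \<oplus>\<^bsub>local_ring M p\<^esub> chart_germ G \<ominus>\<^bsub>local_ring M p\<^esub> chart_germ G =
      chart_germ (\<lambda>z. F z - G z)"
    using chart_germ_carrier[OF assms(2)] chart_germ_carrier[OF hol_diff[OF assms]]
    by (simp add: R.minus_eq R.a_assoc R.r_neg)
  then show ?thesis by (simp add: chart_germ_add)
qed

end

text \<open>\<open>zero_ideal\<close> is generated by the coefficients in all charts at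
  \<open>p\<close>, while \<open>w\<close> lists those of the chart \<open>c\<close> in coordinates.
  The assumption \<open>generators\<close> expresses independence of the chart; it is met by the
  single chart of a plane domain and, for differentials, by the chain rule.\<close>

locale chart_form = chart_at M c p for M :: "'m manifold" and c p +
  fixes \<omega> :: "'m one_form" and w :: "nat \<Rightarrow> (nat \<Rightarrow> complex) \<Rightarrow> complex"
  assumes w: "i < n \<Longrightarrow> hol n q (w i)"
    and w_generator: "i < n \<Longrightarrow> chart_germ (w i) = germ M p (\<omega> c i)"
    and generators: "c' \<in> man_atlas M \<Longrightarrow> p \<in> chart_dom c' \<Longrightarrow> i < chart_dim c' \<Longrightarrow>
      \<exists>F. germ M p (\<omega> c' i) = chart_germ F \<and> ideal_gen n q n w F"
begin

abbreviation "I \<equiv> ideal_gen n q n w"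

sublocale I: germ_ideal n q I
  by (rule germ_ideal_ideal_gen[OF q])

lemma I_hol:
  assumes "I F"
  shows "hol n q F"
proof -
  obtain a where a: "\<forall>i<n. hol n q (a i)" "eventually (\<lambda>z. F z = (\<Sum>i<n. a i z * w i z)) (nbhds n q)"
    using assms unfolding ideal_gen_def by blast
  have "hol n q (\<lambda>z. \<Sum>i<n. a i z * w i z)" using a w q by (intro hol_intros) auto
  moreover have "eventually (\<lambda>z. (\<Sum>i<n. a i z * w i z) = F z) (nbhds n q)"
    using a(2) by eventually_elim simp
  ultimately show ?thesis by (rule hol_cong)
qed

lemma ideal_chart_germs: "ideal {chart_germ F | F. I F} (local_ring M p)" (is "ideal ?K ?R")
proof (rule idealI)
  show "ring ?R" by (rule R.ring_axioms)
  show "subgroup ?K (add_monoid ?R)"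
  proof (rule R.add.subgroupI)
    show "?K \<subseteq> carrier ?R" using I_hol chart_germ_carrier by blast
    show "?K \<noteq> {}" using I.zero by blast
    fix a assume "a \<in> ?K"
    then obtain F where F: "a = chart_germ F" "I F" by blast
    show "\<ominus>\<^bsub>?R\<^esub> a \<in> ?K"
    proof -
      have "\<ominus>\<^bsub>?R\<^esub> a = \<zero>\<^bsub>?R\<^esub> \<ominus>\<^bsub>?R\<^esub> a"
        using F I_hol[OF F(2)] by (simp add: R.minus_eq chart_germ_carrier)
      also have "\<dots> = chart_germ (\<lambda>z. 0 - F z)"
        unfolding F(1) chart_germ_zero by (rule chart_germ_minus[OF hol_const[OF q] I_hol[OF F(2)]])
      finally show ?thesis using I.diff[OF I.zero F(2)] by blast
    qed
    fix b assume "b \<in> ?K"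
    then show "a \<oplus>\<^bsub>?R\<^esub> b \<in> ?K" using F I.add by (auto simp: chart_germ_add)
  qed
  fix a x assume "a \<in> ?K" "x \<in> carrier ?R"
  then obtain F G where F: "a = chart_germ F" "I F" "x = chart_germ G" "hol n q G"
    unfolding carrier_local_ring by blast
  show "x \<otimes>\<^bsub>?R\<^esub> a \<in> ?K" using F I.mult[OF F(4,2)] by (auto simp: chart_germ_mult)
  show "a \<otimes>\<^bsub>?R\<^esub> x \<in> ?K" using F I.mult_right[OF F(2,4)] by (auto simp: chart_germ_mult)
qed

lemma zero_ideal_eq: "zero_ideal M \<omega> p = {chart_germ F | F. I F}" (is "_ = ?K")
proof
  let ?R = "local_ring M p"
  let ?G = "{germ M p (\<omega> c i) | c i. c \<in> man_atlas M \<and> p \<in> chart_dom c \<and> i < chart_dim c}"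
  have G: "?G \<subseteq> ?K"
  proof
    fix x assume "x \<in> ?G"
    then obtain c' i where "x = germ M p (\<omega> c' i)" "c' \<in> man_atlas M" "p \<in> chart_dom c'" "i < chart_dim c'"
      by blast
    with generators[of c' i] show "x \<in> ?K" by blast
  qed
  show "zero_ideal M \<omega> p \<subseteq> ?K"
    unfolding zero_ideal_def by (rule R.genideal_minimal[OF ideal_chart_germs G])
  have Gc: "?G \<subseteq> carrier ?R" using G ideal.Icarr[OF ideal_chart_germs] by blast
  interpret Z: ideal "zero_ideal M \<omega> p" ?R
    unfolding zero_ideal_def by (rule R.genideal_ideal[OF Gc])
  show "?K \<subseteq> zero_ideal M \<omega> p"
  proof
    fix x assume "x \<in> ?K"
    then obtain F where F: "x = chart_germ F" "I F" by blast
    then obtain a where a: "\<forall>i<n. hol n q (a i)" "eventually (\<lambda>z. F z = (\<Sum>i<n. a i z * w i z)) (nbhds n q)"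
      unfolding ideal_gen_def by blast
    have "chart_germ (\<lambda>z. \<Sum>i<m. a i z * w i z) \<in> zero_ideal M \<omega> p" if "m \<le> n" for m
      using that
    proof (induction m)
      case 0
      then show ?case using Z.zero_closed by (simp add: chart_germ_zero)
    next
      case (Suc m)
      have m: "m < n" using Suc.prems by simp
      have "germ M p (\<omega> c m) \<in> ?G" using chart p m by blast
      then have "chart_germ (w m) \<in> zero_ideal M \<omega> p"
        unfolding w_generator[OF m] zero_ideal_def using R.genideal_self[OF Gc] by blast
      then have "chart_germ (a m) \<otimes>\<^bsub>?R\<^esub> chart_germ (w m) \<in> zero_ideal M \<omega> p"
        using a(1) m by (intro Z.I_l_closed chart_germ_carrier) auto
      then have "chart_germ (\<lambda>z. \<Sum>i<m. a i z * w i z) \<oplus>\<^bsub>?R\<^esub> chart_germ (\<lambda>z. a m z * w m z) \<in> zero_ideal M \<omega> p"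
        using Suc m by (intro Z.a_closed) (auto simp: chart_germ_mult)
      then show ?case by (simp add: chart_germ_add)
    qed
    from this[of n] show "x \<in> zero_ideal M \<omega> p"
      using F(1) a(2) chart_germ_eq_iff[of F "\<lambda>z. \<Sum>i<n. a i z * w i z"] by simp
  qed
qed

lemma chart_germ_mem_iff: "chart_germ F \<in> zero_ideal M \<omega> p \<longleftrightarrow> I F"
proof
  assume "chart_germ F \<in> zero_ideal M \<omega> p"
  then obtain G where "chart_germ F = chart_germ G" "I G" unfolding zero_ideal_eq by blast
  then show "I F" using I.cong[of G F] chart_germ_eq_iff[of G F] by simp
qed (auto simp: zero_ideal_eq)

sublocale Z: ideal "zero_ideal M \<omega> p" "local_ring M p"
  using ideal_chart_germs by (simp add: zero_ideal_eq)

text \<open>The section over the one-point set \<open>{p}\<close> defined by \<open>F\<close>. As a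
  function extensional on \<open>{p}\<close> it carries the same information as one coset of the
  zero ideal.\<close>

definition sec :: "((nat \<Rightarrow> complex) \<Rightarrow> complex) \<Rightarrow> 'm \<Rightarrow> ('m \<Rightarrow> complex) set set" where
  "sec F = restrict (zero_class M \<omega> (\<lambda>x. F (\<kappa> x))) {p}"

abbreviation "stalk \<equiv> crs_sheaf (zero_scheme M \<omega>) {p}"

lemma sec_p: "sec F p = zero_ideal M \<omega> p +>\<^bsub>local_ring M p\<^esub> chart_germ F"
  by (simp add: sec_def zero_class_def chart_germ_def)

lemma sec_eq_iff:
  assumes "hol n q F" "hol n q G"
  shows "sec F = sec G \<longleftrightarrow> cong_mod I F G"
proof -
  have "sec F = sec G \<longleftrightarrow> sec F p = sec G p"
    unfolding sec_def by (auto simp: fun_eq_iff restrict_def)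
  also have "\<dots> \<longleftrightarrow> chart_germ F \<ominus>\<^bsub>local_ring M p\<^esub> chart_germ G \<in> zero_ideal M \<omega> p"
    unfolding sec_p
    using R.quotient_eq_iff_same_a_r_cos[OF Z.ideal_axioms chart_germ_carrier chart_germ_carrier] assms by blast
  finally show ?thesis
    unfolding chart_germ_minus[OF assms] chart_germ_mem_iff cong_mod_def .
qed

text \<open>Over \<open>{p}\<close> the local condition on sections concerns the point
  \<open>p\<close> only, so every class of a germ is a section.\<close>

lemma carrier_stalk: "carrier stalk = {sec F | F. hol n q F}"
proof (intro equalityI subsetI)
  fix s assume "s \<in> carrier stalk"
  then obtain W f where s: "s \<in> extensional {p}" "p \<in> W" "holomorphic_fun M W f" "s p = zero_class M \<omega> f p"
    by (auto simp: zero_scheme_def)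
  have "zero_class M \<omega> f p = sec (\<lambda>z. f (\<iota> z)) p"
    unfolding sec_p zero_class_def germ_eq_chart_germ ..
  then have "s = sec (\<lambda>z. f (\<iota> z))"
    using s(1,4) by (auto simp: fun_eq_iff sec_def extensional_def)
  then show "s \<in> {sec F | F. hol n q F}" using hol_chart_fun[OF s(3,2)] by blast
next
  fix s assume "s \<in> {sec F | F. hol n q F}"
  then obtain F where F: "s = sec F" "hol n q F" by blast
  then obtain W where "p \<in> W" "holomorphic_fun M W (\<lambda>x. F (\<kappa> x))" using ex_holomorphic_fun by blast
  then show "s \<in> carrier stalk" unfolding F(1) by (auto simp: zero_scheme_def sec_def)
qed

lemma sec_carrier: "hol n q F \<Longrightarrow> sec F \<in> carrier stalk"
  unfolding carrier_stalk by blast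

lemma sec_add:
  assumes "hol n q F" "hol n q G"
  shows "sec F \<oplus>\<^bsub>stalk\<^esub> sec G = sec (\<lambda>z. F z + G z)"
proof -
  have "sec F p \<oplus>\<^bsub>local_ring M p Quot zero_ideal M \<omega> p\<^esub> sec G p = sec (\<lambda>z. F z + G z) p"
    unfolding sec_p using Z.a_rcos_sum[OF chart_germ_carrier[OF assms(1)] chart_germ_carrier[OF assms(2)]]
    by (simp add: FactRing_def chart_germ_add)
  then show ?thesis by (auto simp: fun_eq_iff sec_def zero_scheme_def)
qed

lemma sec_mult:
  assumes "hol n q F" "hol n q G"
  shows "sec F \<otimes>\<^bsub>stalk\<^esub> sec G = sec (\<lambda>z. F z * G z)"
proof -
  have "sec F p \<otimes>\<^bsub>local_ring M p Quot zero_ideal M \<omega> p\<^esub> sec G p = sec (\<lambda>z. F z * G z) p"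
    unfolding sec_p using Z.rcoset_mult_add[OF chart_germ_carrier[OF assms(1)] chart_germ_carrier[OF assms(2)]]
    by (simp add: FactRing_def chart_germ_mult)
  then show ?thesis by (auto simp: fun_eq_iff sec_def zero_scheme_def)
qed

lemma sec_const: "crs_const (zero_scheme M \<omega>) {p} a = sec (\<lambda>_. a)"
  by (simp add: zero_scheme_def sec_def)

lemma mem_zero_set_iff: "p \<in> zero_set M \<omega> \<longleftrightarrow> \<not> I (\<lambda>_. 1)"
proof -
  have "zero_ideal M \<omega> p = carrier (local_ring M p) \<longleftrightarrow> \<one>\<^bsub>local_ring M p\<^esub> \<in> zero_ideal M \<omega> p"
    using Z.one_imp_carrier R.one_closed by auto
  then show ?thesis
    unfolding zero_set_def using p_topspace by (simp add: chart_germ_one chart_germ_mem_iff)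
qed

lemma mem_zero_set_iff_vanishing: "p \<in> zero_set M \<omega> \<longleftrightarrow> (\<forall>i<n. w i q = 0)"
proof -
  have "I (\<lambda>_. 1) \<longleftrightarrow> (\<exists>i<n. w i q \<noteq> 0)"
  proof
    assume "I (\<lambda>_. 1)"
    then obtain a where "eventually (\<lambda>z. 1 = (\<Sum>i<n. a i z * w i z)) (nbhds n q)"
      unfolding ideal_gen_def by blast
    from eventually_nbhds_self[OF this q] have "(\<Sum>i<n. a i q * w i q) \<noteq> 0" by simp
    then obtain i where "i < n" "a i q * w i q \<noteq> 0" by (meson lessThan_iff sum.neutral)
    then show "\<exists>i<n. w i q \<noteq> 0" by auto
  next
    assume "\<exists>i<n. w i q \<noteq> 0"
    then obtain i where i: "i < n" "w i q \<noteq> 0" by blast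
    have "I (\<lambda>z. inverse (w i z) * w i z)"
      by (rule I.mult[OF hol_inverse[OF w[OF i(1)] i(2)] ideal_gen_generator[OF q i(1)]])
    moreover have "eventually (\<lambda>z. inverse (w i z) * w i z = 1) (nbhds n q)"
      using hol_eventually_nonzero[OF w[OF i(1)] i(2)] by eventually_elim simp
    ultimately show "I (\<lambda>_. 1)" by (rule I.cong)
  qed
  then show ?thesis unfolding mem_zero_set_iff by blast
qed

end

text \<open>By the chain rule, the partial derivatives in the chart \<open>c\<close> generate those in every other chart.\<close>

lemma (in chart_at) chart_form_differential:
  assumes \<Phi>: "holomorphic_fun M (topspace (man_top M)) \<Phi>"
  shows "chart_form M c p (differential \<Phi>) (\<lambda>i. pd i (\<lambda>z. \<Phi> (\<iota> z)))"
proof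
  let ?F = "\<lambda>z. \<Phi> (\<iota> z)"
  have F: "hol n q ?F" by (rule hol_chart_fun[OF \<Phi> p_topspace])
  show "hol n q (pd i ?F)" if "i < n" for i by (rule hol_pd[OF F that])
  show "chart_germ (pd i ?F) = germ M p (differential \<Phi> c i)" if "i < n" for i
    unfolding chart_germ_def by (simp add: differential_def chart_partial_def[abs_def] pd_def)
  fix c' i assume c': "c' \<in> man_atlas M" "p \<in> chart_dom c'" and i: "i < chart_dim c'"
  interpret c': chart_at M c' p using manifold c' by unfold_locales
  \<comment> \<open>\<open>?a j\<close> is an entry of the Jacobian of the transition map from
    \<open>c'\<close> to \<open>c\<close>, and \<open>?b j\<close> is the same entry as a function
    of the coordinates of \<open>c\<close>.\<close>
  let ?a = "\<lambda>j z'. pd i (\<lambda>z. \<kappa> (chart_inv c' z) j) z'"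
  let ?b = "\<lambda>j z. ?a j (tuple (chart_dim c') (\<lambda>s. chart_map c' (\<iota> z) s))"
  have b: "hol n q (?b j)" if j: "j < n" for j
  proof (rule hol_compose[OF _ q])
    show "hol (chart_dim c') (chart_map c' p) (?a j)"
      by (rule hol_pd[OF c'.hol_transition[OF chart p j] i])
    show "hol n q (\<lambda>z. chart_map c' (\<iota> z) s)" if "s < chart_dim c'" for s
      by (rule hol_transition[OF c' that])
    show "chart_map c' (\<iota> q) s = chart_map c' p s" for s
      using inv_map[OF p] by simp
  qed
  let ?G = "\<lambda>z. \<Sum>j<n. ?b j z * pd j ?F z"
  have "ideal_gen n q n (\<lambda>i. pd i ?F) ?G"
    unfolding ideal_gen_def using b by (intro exI[of _ ?b]) auto
  moreover have "germ M p (differential \<Phi> c' i) = chart_germ ?G"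
    unfolding chart_germ_def germ_eq_iff
  proof -
    have "eventually (\<lambda>x. x \<in> chart_dom c \<inter> chart_dom c') (nhdsin (man_top M) p)"
      unfolding eventually_nhdsin using openin_Int[OF openin_dom c'.openin_dom] p c'(2) by blast
    then show "eventually (\<lambda>x. differential \<Phi> c' i x = ?G (\<kappa> x)) (nhdsin (man_top M) p)"
    proof eventually_elim
      case (elim x)
      interpret x: chart_at M c x using manifold chart elim by unfold_locales auto
      interpret x': chart_at M c' x using manifold c' elim by unfold_locales auto
      have xt: "x \<in> topspace (man_top M)" using x.p_topspace .
      have Fx: "hol n (\<kappa> x) ?F" by (rule x.hol_chart_fun[OF \<Phi> xt])
      have tr: "hol (chart_dim c') (chart_map c' x) (\<lambda>z. \<kappa> (chart_inv c' z) j)" if "j < n" for j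
        by (rule x'.hol_transition[OF chart _ that]) (use elim in blast)
      have "eventually (\<lambda>y. y \<in> chart_dom c) (nhdsin (man_top M) x)"
        unfolding eventually_nhdsin using openin_dom elim by blast
      then have "eventually (\<lambda>z. chart_inv c' z \<in> chart_dom c) (nbhds (chart_dim c') (chart_map c' x))"
        using x'.eventually_chart by simp
      then have ev: "eventually (\<lambda>z. \<Phi> (chart_inv c' z) = ?F (tuple n (\<lambda>j. \<kappa> (chart_inv c' z) j)))
          (nbhds (chart_dim c') (chart_map c' x))"
        by eventually_elim (simp only: tuple_coord_space[OF map_coord_space] inv_map)
      have "differential \<Phi> c' i x = pd i (\<lambda>z. \<Phi> (chart_inv c' z)) (chart_map c' x)"
        by (simp add: differential_def chart_partial_def pd_def)
      also have "\<dots> = pd i (\<lambda>z. ?F (tuple n (\<lambda>j. \<kappa> (chart_inv c' z) j))) (chart_map c' x)"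
        by (rule pd_cong[OF ev x'.q i])
      also have "\<dots> = (\<Sum>j<n. pd j ?F (\<kappa> x) * ?a j (chart_map c' x))"
        by (rule pd_compose[OF Fx tr _ i]) (use elim x'.inv_map in auto)
      also have "\<dots> = ?G (\<kappa> x)"
        using inv_map[of x] elim tuple_coord_space[OF x'.map_coord_space[of x]] by (simp add: mult.commute)
      finally show ?case .
    qed
  qed
  ultimately show "\<exists>F. germ M p (differential \<Phi> c' i) = chart_germ F \<and> ideal_gen n q n (\<lambda>i. pd i ?F) F"
    by blast
qed

section \<open>From formal power series to germs\<close>

definition monomial :: "nat \<Rightarrow> nat \<Rightarrow> (nat \<Rightarrow> complex) \<Rightarrow> complex" where
  "monomial i j = (\<lambda>z. z 0 ^ i * z 1 ^ j)"

lemma monomial_hol: "hol0 (monomial i j)"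
  unfolding monomial_def by (intro hol_intros) auto

lemma monomial_max_pow: "max_pow (i + j) (monomial i j)"
proof (induction i)
  case 0
  show ?case
  proof (induction j)
    case 0
    show ?case by (simp add: monomial_def hol_const)
  next
    case (Suc j)
    have "max_pow (Suc (0 + j)) (\<lambda>z. z 1 * monomial 0 j z)"
      by (rule max_pow_vanishing_mult[OF _ _ Suc]) (auto intro: hol_coord)
    then show ?case by (simp add: monomial_def del: max_pow.simps)
  qed
next
  case (Suc i)
  have "max_pow (Suc (i + j)) (\<lambda>z. z 0 * monomial i j z)"
    by (rule max_pow_vanishing_mult[OF _ _ Suc]) (auto intro: hol_coord)
  then show ?case by (simp add: monomial_def mult.assoc del: max_pow.simps)
qed

text \<open>The N + 1 monomials of degree N are the finite generating set on which Nakayama's lemma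
  operates below.\<close>

lemma max_pow_monomials:
  "max_pow N f \<Longrightarrow> ideal_gen 2 origin (Suc N) (\<lambda>i. monomial i (N - i)) f"
proof (induction N arbitrary: f)
  case 0
  then show ?case
    unfolding ideal_gen_def by (intro exI[of _ "\<lambda>_. f"]) (auto simp: monomial_def)
next
  case (Suc N)
  let ?V = "ideal_gen 2 origin (Suc (Suc N)) (\<lambda>i. monomial i (Suc N - i))"
  interpret V: germ_ideal 2 origin ?V by (rule germ_ideal_ideal_gen) simp
  have g: "?V (monomial i (Suc N - i))" if "i < Suc (Suc N)" for i
    by (rule ideal_gen_generator[OF origin_in_coord_space that])
  obtain a b where ab: "max_pow N a" "max_pow N b"
    "eventually (\<lambda>z. f z = z 0 * a z + z 1 * b z) (nbhds 2 origin)"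
    using Suc.prems by auto
  have sh: "?V (\<lambda>z. z e * c z)" if c: "max_pow N c" and e: "e < 2" for c e
  proof -
    obtain d where d: "\<forall>i<Suc N. hol0 (d i)"
      "eventually (\<lambda>z. c z = (\<Sum>i<Suc N. d i z * monomial i (N - i) z)) (nbhds 2 origin)"
      using Suc.IH[OF c] unfolding ideal_gen_def by blast
    have m: "?V (\<lambda>z. z e * monomial i (N - i) z)" if "i < Suc N" for i
    proof (cases "e = 0")
      case True
      then show ?thesis
        using that by (intro V.ext[OF g[of "Suc i"]]) (auto simp: monomial_def)
    next
      case False
      then have "e = 1" using e by simp
      then show ?thesis
        using that by (intro V.ext[OF g[of i]]) (auto simp: monomial_def Suc_diff_le)
    qed
    have "?V (\<lambda>z. \<Sum>i<Suc N. d i z * (z e * monomial i (N - i) z))"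
      using d(1) by (intro V.sum V.mult m) auto
    then show ?thesis
    proof (rule V.cong)
      show "eventually (\<lambda>z. (\<Sum>i<Suc N. d i z * (z e * monomial i (N - i) z)) = z e * c z) (nbhds 2 origin)"
        using d(2) by eventually_elim (simp add: sum_distrib_left algebra_simps)
    qed
  qed
  have "?V (\<lambda>z. z 0 * a z + z 1 * b z)" using sh ab by (intro V.add) auto
  then show ?case by (rule V.cong) (use ab(3) in \<open>auto elim: eventually_mono\<close>)
qed

lemma max_pow_Suc_monomials:
  assumes "max_pow (Suc N) f"
  shows "max_ideal_gen 2 origin (Suc N) (\<lambda>i. monomial i (N - i)) f"
proof -
  let ?V = "max_ideal_gen 2 origin (Suc N) (\<lambda>i. monomial i (N - i))"
  interpret V: germ_ideal 2 origin ?V by (rule germ_ideal_max_ideal_gen) simp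
  obtain a b where ab: "max_pow N a" "max_pow N b"
    "eventually (\<lambda>z. f z = z 0 * a z + z 1 * b z) (nbhds 2 origin)"
    using assms by auto
  have "?V (\<lambda>z. z 0 * a z + z 1 * b z)"
    using ab by (intro V.add max_ideal_gen_mult hol_coord max_pow_monomials) auto
  then show ?thesis by (rule V.cong) (use ab(3) in \<open>auto elim: eventually_mono\<close>)
qed

section \<open>Truncation of formal power series\<close>

definition trunc :: "nat \<Rightarrow> fps2 \<Rightarrow> (nat \<Rightarrow> complex) \<Rightarrow> complex" where
  "trunc N F = (\<lambda>z. \<Sum>(i, j)\<in>{(i, j). i + j \<le> N}. fps2_coeff F i j * monomial i j z)"

lemma finite_triangle: "finite {(i, j). i + j \<le> (N::nat)}"
  by (rule finite_subset[of _ "{..N} \<times> {..N}"]) auto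

lemma trunc_hol: "hol0 (trunc N F)"
  unfolding trunc_def split_beta
  by (intro hol_sum hol_mult hol_const monomial_hol origin_in_coord_space)

lemma fps2_section_eq:
  "fps2_section d N F (z 0, z 1) = (\<Sum>k=d..N. \<Sum>i\<le>k. fps2_coeff F i (k - i) * monomial i (k - i) z)"
  by (simp add: fps2_section_def monomial_def mult.assoc)

lemma fps2_coeff_eq_0_if_hom_part: "hom_part k F = 0 \<Longrightarrow> i + j = k \<Longrightarrow> fps2_coeff F i j = 0"
proof -
  assume "hom_part k F = 0" and k: "i + j = k"
  then have "fps_nth (fps_nth (hom_part k F) i) j = 0" by simp
  then show ?thesis using k by (simp add: hom_part_def)
qed

text \<open>Truncation starts in degree 0 so that it makes sense for the arbitrary coefficients of a
  formal relation. For series of order at least \<open>d\<close> it gives the polynomial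
  coefficients of \<sigma>.\<close>

lemma trunc_eq_section:
  assumes "\<forall>k<d. hom_part k F = 0"
  shows "trunc N F z = fps2_section d N F (z 0, z 1)"
proof -
  let ?t = "\<lambda>k. \<Sum>i\<le>k. fps2_coeff F i (k - i) * monomial i (k - i) z"
  have "trunc N F z = (\<Sum>k\<le>N. ?t k)"
    unfolding trunc_def by (rule sum.triangle_reindex_eq)
  also have "\<dots> = (\<Sum>k=d..N. ?t k)"
  proof (rule sum.mono_neutral_right)
    show "\<forall>k\<in>{..N} - {d..N}. ?t k = 0"
    proof
      fix k assume "k \<in> {..N} - {d..N}"
      then have "hom_part k F = 0" using assms by auto
      then show "?t k = 0" using fps2_coeff_eq_0_if_hom_part by (intro sum.neutral) auto
    qed
  qed auto
  finally show ?thesis unfolding fps2_section_eq .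
qed

lemma section_max_pow:
  assumes "m \<le> d"
  shows "max_pow m (\<lambda>z. fps2_section d N F (z 0, z 1))"
  unfolding fps2_section_eq
proof (intro max_pow.sum max_pow.scale)
  fix k i assume "k \<in> {d..N}" "i \<in> {..k}"
  then show "max_pow m (monomial i (k - i))"
    using max_pow_mono[of k "monomial i (k - i)" m] monomial_max_pow[of i "k - i"] assms by simp
qed

lemma fps2_coeff_mult:
  "fps2_coeff (F * G) p q = (\<Sum>i\<le>p. \<Sum>j\<le>q. fps2_coeff F i j * fps2_coeff G (p - i) (q - j))"
  by (simp add: fps2_coeff_def fps_mult_nth fps_sum_nth atMost_atLeast0)

lemma trunc_add: "trunc N (F + G) z = trunc N F z + trunc N G z"
  by (simp add: trunc_def fps2_coeff_def sum.distrib split_beta algebra_simps)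

text \<open>The product of truncations has the same terms of degree at most N as the product of the
  series; each surplus term is a monomial of degree at least N + 1.\<close>

lemma trunc_mult:
  "max_pow (Suc N) (\<lambda>z. trunc N F z * trunc N G z - trunc N (F * G) z)"
proof -
  let ?D = "{(i, j). i + j \<le> N}"
  let ?E = "{((i, j), (k, l)). i + j + k + l \<le> N}"
  define t where "t = (\<lambda>((i, j), (k, l)) z. fps2_coeff F i j * fps2_coeff G k l * monomial (i + k) (j + l) z)"
  have E: "?E \<subseteq> ?D \<times> ?D" by auto
  have fin: "finite (?D \<times> ?D)" using finite_triangle by blast
  have "trunc N F z * trunc N G z = (\<Sum>x\<in>?D \<times> ?D. t x z)" for z
    unfolding trunc_def sum_product sum.cartesian_product
    by (intro sum.cong) (auto simp: t_def monomial_def power_add)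
  moreover have "trunc N (F * G) z = (\<Sum>x\<in>?E. t x z)" for z
  proof -
    have "trunc N (F * G) z = (\<Sum>(p, q)\<in>?D. \<Sum>(i, j)\<in>{..p} \<times> {..q}.
        fps2_coeff F i j * fps2_coeff G (p - i) (q - j) * monomial p q z)"
      unfolding trunc_def fps2_coeff_mult
      by (intro sum.cong) (auto simp: sum.cartesian_product sum_distrib_right split_beta)
    also have "\<dots> = (\<Sum>((p, q), (i, j))\<in>(SIGMA (p, q):?D. {..p} \<times> {..q}).
        fps2_coeff F i j * fps2_coeff G (p - i) (q - j) * monomial p q z)"
      by (subst sum.Sigma[symmetric]) (auto simp: finite_triangle split_beta)
    \<comment> \<open>(p, q) is the exponent of the product and (i, j) that of the first factor,
      leaving (p - i, q - j) for the second.\<close>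
    also have "\<dots> = (\<Sum>x\<in>?E. t x z)"
      by (rule sum.reindex_bij_witness[where
          j = "\<lambda>((p, q), (i, j)). ((i, j), (p - i, q - j))" and
          i = "\<lambda>((i, j), (k, l)). ((i + k, j + l), (i, j))"]) (auto simp: t_def)
    finally show ?thesis .
  qed
  ultimately have "trunc N F z * trunc N G z - trunc N (F * G) z = (\<Sum>x\<in>?D \<times> ?D - ?E. t x z)" for z
    using sum_diff[OF fin E, of "\<lambda>x. t x z"] by simp
  moreover have "max_pow (Suc N) (\<lambda>z. \<Sum>x\<in>?D \<times> ?D - ?E. t x z)"
  proof (rule max_pow.sum)
    fix x assume "x \<in> ?D \<times> ?D - ?E"
    then obtain i j k l where x: "x = ((i, j), (k, l))" "Suc N \<le> i + k + (j + l)" by auto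
    show "max_pow (Suc N) (t x)"
      unfolding x(1) t_def prod.case by (intro max_pow.scale max_pow_mono[OF monomial_max_pow x(2)])
  qed
  ultimately show ?thesis by simp
qed

lemma trunc_monomial:
  assumes "i + j \<le> N"
  shows "trunc N (fps2_x ^ i * fps2_y ^ j) z = monomial i j z"
proof -
  have c: "fps2_coeff (fps2_x ^ i * fps2_y ^ j) k l = (if (k, l) = (i, j) then 1 else 0)" for k l
  proof -
    have "fps2_y ^ j = fps_const (fps_X ^ j)"
      by (simp add: fps2_y_def fps_const_power)
    then show ?thesis
      by (auto simp: fps2_coeff_def fps2_x_def fps_X_power_mult_nth fps_X_power_iff)
  qed
  have "trunc N (fps2_x ^ i * fps2_y ^ j) z =
      (\<Sum>x\<in>{(i, j). i + j \<le> N}. if x = (i, j) then monomial i j z else 0)"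
    unfolding trunc_def c by (intro sum.cong refl) (auto split: if_splits)
  then show ?thesis using assms finite_triangle[of N] by simp
qed

lemma monomial_in_ideal_power:
  "fps2_x ^ i * fps2_y ^ j \<in> ideal_power fps2_ring fps2_max_ideal (i + j)"
proof -
  interpret R: cring fps2_ring by (rule cring_fps2_ring)
  have g: "fps2_x \<in> fps2_max_ideal" "fps2_y \<in> fps2_max_ideal"
    unfolding fps2_max_ideal_def using R.genideal_self[of "{fps2_x, fps2_y}"] by (auto simp: fps2_ring_def)
  have s: "x * f \<in> ideal_power fps2_ring fps2_max_ideal (Suc n)"
    if "x \<in> fps2_max_ideal" "f \<in> ideal_power fps2_ring fps2_max_ideal n" for x f n
    using ideal_prod.prod[of x fps2_max_ideal f "ideal_power fps2_ring fps2_max_ideal n" fps2_ring] that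
    by (simp add: ideal_power_def fps2_ring_def)
  have j: "fps2_y ^ j \<in> ideal_power fps2_ring fps2_max_ideal j"
  proof (induction j)
    case 0
    show ?case by (simp add: ideal_power_def fps2_ring_def)
  qed (use s g in auto)
  show ?thesis
  proof (induction i)
    case (Suc i)
    then show ?case using s[OF g(1) Suc] by (simp add: mult.assoc)
  qed (use j in simp)
qed

lemma genideal_fps2_pair:
  assumes "F \<in> genideal fps2_ring {A, B}"
  shows "\<exists>a b. F = a * A + b * B"
proof -
  interpret R: cring fps2_ring by (rule cring_fps2_ring)
  let ?K = "{a * A + b * B | a b. True}"
  have m: "\<ominus>\<^bsub>fps2_ring\<^esub> x = - x" for x
    by (rule R.minus_equality) (simp_all add: fps2_ring_def)
  have K: "a * A + b * B \<in> ?K" for a b by blast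
  have "ideal ?K fps2_ring"
  proof (rule idealI)
    show "subgroup ?K (add_monoid fps2_ring)"
    proof (rule R.add.subgroupI)
      fix x y assume "x \<in> ?K" "y \<in> ?K"
      then obtain a b c d where x: "x = a * A + b * B" "y = c * A + d * B" by blast
      have e: "- x = (- a) * A + (- b) * B" "x + y = (a + c) * A + (b + d) * B"
        unfolding x by (simp_all add: algebra_simps)
      have "- x \<in> ?K" unfolding e(1) by (rule K)
      then show "\<ominus>\<^bsub>fps2_ring\<^esub> x \<in> ?K" unfolding m .
      have "x + y \<in> ?K" unfolding e(2) by (rule K)
      then show "x \<oplus>\<^bsub>fps2_ring\<^esub> y \<in> ?K" by (simp add: fps2_ring_def)
    qed (auto simp: fps2_ring_def)
    fix x y assume "x \<in> ?K"
    then obtain a b where x: "x = a * A + b * B" by blast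
    have e: "y * x = (y * a) * A + (y * b) * B"
      unfolding x by (simp add: algebra_simps)
    have "y * x \<in> ?K" unfolding e by (rule K)
    then show "y \<otimes>\<^bsub>fps2_ring\<^esub> x \<in> ?K" "x \<otimes>\<^bsub>fps2_ring\<^esub> y \<in> ?K"
      by (simp_all add: fps2_ring_def mult.commute)
  qed (rule R.ring_axioms)
  moreover have "A = 1 * A + 0 * B" "B = 0 * A + 1 * B" by simp_all
  then have "{A, B} \<subseteq> ?K" by blast
  ultimately have "genideal fps2_ring {A, B} \<subseteq> ?K" by (rule R.genideal_minimal)
  then show ?thesis using assms by blast
qed

text \<open>The passage from formal series to germs. Truncating a formal relation x^i y^(N-i) = a A
  + b B leaves an error in m^(N+1), which is m times the ideal of the monomials of degree N.
  Nakayama's lemma for these monomials removes the error.\<close>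

lemma max_pow_le_section_ideal:
  assumes A: "\<forall>k<d. hom_part k A = 0" and B: "\<forall>k<d. hom_part k B = 0"
    and N: "ideal_power fps2_ring fps2_max_ideal N \<subseteq> genideal fps2_ring {A, B}"
    and f: "max_pow N f"
  shows "ideal_gen 2 origin 2 (\<lambda>i z. fps2_section d N (if i = 0 then A else B) (z 0, z 1)) f"
    (is "ideal_gen 2 origin 2 ?w f")
proof -
  interpret V: germ_ideal 2 origin "ideal_gen 2 origin 2 ?w" by (rule germ_ideal_ideal_gen) simp
  have "ideal_gen 2 origin 2 ?w (monomial i (N - i))" if "i < Suc N" for i
  proof (rule V.Nakayama[where k = "Suc N" and w = "\<lambda>i. monomial i (N - i)", OF _ that])
    fix i assume "i < Suc N"
    then have i: "i + (N - i) = N" by simp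
    let ?F = "fps2_x ^ i * fps2_y ^ (N - i)"
    have "?F \<in> genideal fps2_ring {A, B}"
      using N monomial_in_ideal_power[of i "N - i"] i by auto
    then obtain a b where ab: "?F = a * A + b * B" using genideal_fps2_pair by blast
    let ?g = "\<lambda>z. trunc N a z * trunc N A z + trunc N b z * trunc N B z"
    have "max_pow (Suc N) (\<lambda>z. (trunc N a z * trunc N A z - trunc N (a * A) z) +
        (trunc N b z * trunc N B z - trunc N (b * B) z))"
      by (intro max_pow.add trunc_mult)
    then have "max_pow (Suc N) (\<lambda>z. - ((trunc N a z * trunc N A z - trunc N (a * A) z) +
        (trunc N b z * trunc N B z - trunc N (b * B) z)))"
      by (rule max_pow.uminus)
    then have "max_pow (Suc N) (\<lambda>z. monomial i (N - i) z - ?g z)"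
    proof (rule max_pow.ext)
      fix z
      have "monomial i (N - i) z = trunc N ?F z" using trunc_monomial[of i "N - i" N z] i by simp
      also have "\<dots> = trunc N (a * A) z + trunc N (b * B) z" unfolding ab by (rule trunc_add)
      finally show "- ((trunc N a z * trunc N A z - trunc N (a * A) z) +
          (trunc N b z * trunc N B z - trunc N (b * B) z)) = monomial i (N - i) z - ?g z" by simp
    qed
    then obtain \<mu> where \<mu>: "\<forall>j<Suc N. hol0 (\<mu> j) \<and> \<mu> j origin = 0"
      "eventually (\<lambda>z. monomial i (N - i) z - ?g z = (\<Sum>j<Suc N. \<mu> j z * monomial j (N - j) z)) (nbhds 2 origin)"
      using max_pow_Suc_monomials unfolding max_ideal_gen_def by blast
    have "ideal_gen 2 origin 2 ?w (\<lambda>z. trunc N a z * ?w 0 z + trunc N b z * ?w 1 z)"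
      by (intro V.add V.mult trunc_hol ideal_gen_generator[OF origin_in_coord_space, of 0 2 ?w]
          ideal_gen_generator[OF origin_in_coord_space, of 1 2 ?w]) auto
    then have "ideal_gen 2 origin 2 ?w (\<lambda>z. monomial i (N - i) z - (\<Sum>j<Suc N. \<mu> j z * monomial j (N - j) z))"
    proof (rule V.cong)
      show "eventually (\<lambda>z. trunc N a z * ?w 0 z + trunc N b z * ?w 1 z =
          monomial i (N - i) z - (\<Sum>j<Suc N. \<mu> j z * monomial j (N - j) z)) (nbhds 2 origin)"
        using \<mu>(2)
        by eventually_elim (simp add: trunc_eq_section[OF A] trunc_eq_section[OF B] algebra_simps)
    qed
    then show "\<exists>\<mu>. (\<forall>j<Suc N. hol0 (\<mu> j) \<and> \<mu> j origin = 0) \<and>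
        ideal_gen 2 origin 2 ?w (\<lambda>z. monomial i (N - i) z - (\<Sum>j<Suc N. \<mu> j z * monomial j (N - j) z))"
      using \<mu>(1) by (intro exI[of _ \<mu>] conjI)
  qed
  moreover obtain a where a: "\<forall>i<Suc N. hol0 (a i)"
    "eventually (\<lambda>z. f z = (\<Sum>i<Suc N. a i z * monomial i (N - i) z)) (nbhds 2 origin)"
    using max_pow_monomials[OF f] unfolding ideal_gen_def by blast
  ultimately have "ideal_gen 2 origin 2 ?w (\<lambda>z. \<Sum>i<Suc N. a i z * monomial i (N - i) z)"
    by (intro V.sum V.mult) auto
  then show ?thesis by (rule V.cong) (use a(2) in \<open>auto elim: eventually_mono\<close>)
qed

section \<open>Open subsets of the plane\<close>

definition plane_coord :: "complex \<times> complex \<Rightarrow> nat \<Rightarrow> complex" where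
  "plane_coord p = (\<lambda>i. if i = 0 then fst p else if i = 1 then snd p else 0)"

lemma plane_chart_simps [simp]:
  "chart_dim (plane_chart U) = 2" "chart_dom (plane_chart U) = U"
  "chart_map (plane_chart U) = plane_coord"
  "man_atlas (plane_open U) = {plane_chart U}" "man_top (plane_open U) = top_of_set U"
  by (simp_all add: plane_chart_def plane_open_def plane_coord_def fun_eq_iff split_beta)

lemma plane_coord_apply [simp]: "plane_coord p 0 = fst p" "plane_coord p (Suc 0) = snd p"
  by (simp_all add: plane_coord_def)

lemma plane_coord_origin: "plane_coord (0, 0) = origin"
  by (simp add: plane_coord_def fun_eq_iff)

lemma chart_at_plane: "open U \<Longrightarrow> p \<in> U \<Longrightarrow> chart_at (plane_open U) (plane_chart U) p"
  by standard (auto intro: complex_manifold_plane_open)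

lemma chart_form_plane:
  assumes "open U" "p \<in> U" and ab: "\<And>i::nat. i < 2 \<Longrightarrow> hol 2 (plane_coord p) (\<lambda>z. (if i = 0 then a else b) (z 0, z 1))"
  shows "chart_form (plane_open U) (plane_chart U) p (plane_form a b) (\<lambda>i z. (if i = 0 then a else b) (z 0, z 1))"
proof -
  interpret chart_at "plane_open U" "plane_chart U" p by (rule chart_at_plane[OF assms(1,2)])
  have g: "chart_germ (\<lambda>z. (if i = 0 then a else b) (z 0, z 1)) = germ (plane_open U) p (plane_form a b c i)"
    for c :: "(complex \<times> complex) chart" and i :: nat
    by (cases "i = 0") (simp_all add: chart_germ_def plane_form_def)
  show ?thesis
  proof
    show "\<exists>F. germ (plane_open U) p (plane_form a b c' i) = chart_germ F \<and>
        ideal_gen n q n (\<lambda>i z. (if i = 0 then a else b) (z 0, z 1)) F"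
      if "i < chart_dim c'" "c' \<in> man_atlas (plane_open U)" for c' i
      using that ideal_gen_generator[OF q, of i n "\<lambda>i z. (if i = 0 then a else b) (z 0, z 1)"] g[of i c']
      by (intro exI[of _ "\<lambda>z. (if i = 0 then a else b) (z 0, z 1)"] conjI) auto
  qed (use ab g in simp_all)
qed

lemma hol_section:
  assumes "q \<in> coord_space n"
  shows "hol n q (\<lambda>z. fps2_section d N F (z i, z j))"
  unfolding fps2_section_def using assms by (simp, intro hol_intros)

lemma open_if_openin_zariski: "openin zariski U \<Longrightarrow> open U"
  unfolding zariski_def openin_topology_generated_by_iff
proof (induction rule: generate_topology_on.induct)
  case (Basis S)
  then obtain P where S: "S = {p. poly_xy P p \<noteq> 0}" by blast
  have "continuous_on UNIV (\<lambda>p. poly_xy P p)"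
  proof -
    have "poly_xy P p = (\<Sum>i\<le>degree P. poly (coeff P i) (snd p) * fst p ^ i)" for p
      by (simp add: poly_xy_def split_beta poly_altdef[of P] poly_sum)
    then show ?thesis by (simp add: continuous_intros)
  qed
  then have "open ((\<lambda>p. poly_xy P p) -` (- {0}))" by (intro open_vimage) auto
  then show ?case unfolding S by (simp add: vimage_def)
qed auto

text \<open>This applies to corresponding isolated points: the sections over \<open>{p}\<close> are then the stalk at \<open>p\<close>.\<close>

lemma milnor_lift_of_isomorphism:
  assumes X: "chart_form X cX p \<omega> w" and cX: "chart_dim cX = 2" "chart_map cX p = origin"
    and Y: "chart_form M c y (differential \<Phi>) (\<lambda>i. pd i (\<lambda>z. \<Phi> (chart_inv c z)))"
    and \<Phi>: "hol (chart_dim c) (chart_map c y) (\<lambda>z. \<Phi> (chart_inv c z))"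
    and w: "\<And>i. i < 2 \<Longrightarrow> max_pow 2 (w i)"
    and N: "\<And>f. max_pow N f \<Longrightarrow> ideal_gen 2 origin 2 w f"
    and iso: "\<psi> \<in> ring_iso (crs_sheaf (zero_scheme M (differential \<Phi>)) {y}) (crs_sheaf (zero_scheme X \<omega>) {p})"
    and const: "\<And>a. \<psi> (crs_const (zero_scheme M (differential \<Phi>)) {y} a) = crs_const (zero_scheme X \<omega>) {p} a"
  shows "\<exists>\<pi>. milnor_lift (chart_dim c) (chart_map c y) (\<lambda>z. \<Phi> (chart_inv c z)) w N \<pi>"
proof -
  interpret X: chart_form X cX p \<omega> w by (rule X)
  interpret Y: chart_form M c y "differential \<Phi>" "\<lambda>i. pd i (\<lambda>z. \<Phi> (chart_inv c z))" by (rule Y)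
  note [simp] = cX
  have \<psi>: "\<psi> \<in> ring_hom Y.stalk X.stalk" "bij_betw \<psi> (carrier Y.stalk) (carrier X.stalk)"
    using iso by (auto simp: ring_iso_def)
  \<comment> \<open>Choosing one germ for each image need not respect sums or products, but the
    induced classes do. This is why \<open>milnor_lift\<close> speaks of congruences.\<close>
  have "\<exists>\<pi>. \<forall>F. hol Y.n Y.q F \<longrightarrow> hol0 (\<pi> F) \<and> \<psi> (Y.sec F) = X.sec (\<pi> F)"
  proof (rule choice, intro allI)
    fix F
    show "\<exists>f. hol Y.n Y.q F \<longrightarrow> hol0 f \<and> \<psi> (Y.sec F) = X.sec f"
    proof (cases "hol Y.n Y.q F")
      case True
      then have "\<psi> (Y.sec F) \<in> carrier X.stalk"
        using ring_hom_closed[OF \<psi>(1) Y.sec_carrier] by blast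
      then show ?thesis unfolding X.carrier_stalk by auto
    qed simp
  qed
  then obtain \<pi> where \<pi>: "\<And>F. hol Y.n Y.q F \<Longrightarrow> hol0 (\<pi> F)"
    "\<And>F. hol Y.n Y.q F \<Longrightarrow> \<psi> (Y.sec F) = X.sec (\<pi> F)" by blast
  have eq: "cong_mod (ideal_gen 2 origin 2 w) f g" if "hol0 f" "hol0 g" "X.sec f = X.sec g" for f g
    using X.sec_eq_iff[of f g] that by simp
  have c: "\<psi> (Y.sec (\<lambda>_. a)) = X.sec (\<lambda>_. a)" for a
    using const[of a] unfolding X.sec_const Y.sec_const .
  have "milnor_lift Y.n Y.q (\<lambda>z. \<Phi> (chart_inv c z)) w N \<pi>"
  proof
    fix F G assume F: "hol Y.n Y.q F" and G: "hol Y.n Y.q G"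
    show "cong_mod (ideal_gen 2 origin 2 w) (\<pi> (\<lambda>z. F z + G z)) (\<lambda>z. \<pi> F z + \<pi> G z)"
    proof (rule eq)
      have "X.sec (\<pi> (\<lambda>z. F z + G z)) = \<psi> (Y.sec F \<oplus>\<^bsub>Y.stalk\<^esub> Y.sec G)"
        unfolding Y.sec_add[OF F G] by (rule \<pi>(2)[OF hol_add[OF F G], symmetric])
      also have "\<dots> = X.sec (\<pi> F) \<oplus>\<^bsub>X.stalk\<^esub> X.sec (\<pi> G)"
        using ring_hom_add[OF \<psi>(1) Y.sec_carrier[OF F] Y.sec_carrier[OF G]] \<pi>(2)[OF F] \<pi>(2)[OF G] by simp
      also have "\<dots> = X.sec (\<lambda>z. \<pi> F z + \<pi> G z)"
        by (rule X.sec_add) (simp_all add: \<pi>(1) F G)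
      finally show "X.sec (\<pi> (\<lambda>z. F z + G z)) = X.sec (\<lambda>z. \<pi> F z + \<pi> G z)" .
    qed (intro \<pi>(1) hol_add F G)+
    show "cong_mod (ideal_gen 2 origin 2 w) (\<pi> (\<lambda>z. F z * G z)) (\<lambda>z. \<pi> F z * \<pi> G z)"
    proof (rule eq)
      have "X.sec (\<pi> (\<lambda>z. F z * G z)) = \<psi> (Y.sec F \<otimes>\<^bsub>Y.stalk\<^esub> Y.sec G)"
        unfolding Y.sec_mult[OF F G] by (rule \<pi>(2)[OF hol_mult[OF F G], symmetric])
      also have "\<dots> = X.sec (\<pi> F) \<otimes>\<^bsub>X.stalk\<^esub> X.sec (\<pi> G)"
        using ring_hom_mult[OF \<psi>(1) Y.sec_carrier[OF F] Y.sec_carrier[OF G]] \<pi>(2)[OF F] \<pi>(2)[OF G] by simp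
      also have "\<dots> = X.sec (\<lambda>z. \<pi> F z * \<pi> G z)"
        by (rule X.sec_mult) (simp_all add: \<pi>(1) F G)
      finally show "X.sec (\<pi> (\<lambda>z. F z * G z)) = X.sec (\<lambda>z. \<pi> F z * \<pi> G z)" .
    qed (intro \<pi>(1) hol_mult F G)+
  next
    fix a
    have h: "hol Y.n Y.q (\<lambda>_. a)" by (rule hol_const[OF Y.q])
    show "cong_mod (ideal_gen 2 origin 2 w) (\<pi> (\<lambda>_. a)) (\<lambda>_. a)"
      by (rule eq[OF \<pi>(1)[OF h]]) (use \<pi>(2)[OF h] c in \<open>auto intro: hol_const\<close>)
  next
    fix F assume F: "hol Y.n Y.q F"
    have z: "hol Y.n Y.q (\<lambda>_. 0)" "hol0 (\<lambda>_. 0)"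
      by (rule hol_const[OF Y.q], rule hol_const[OF origin_in_coord_space])
    have "ideal_gen 2 origin 2 w (\<pi> F) \<longleftrightarrow> X.sec (\<pi> F) = X.sec (\<lambda>_. 0)"
      using X.sec_eq_iff[of "\<pi> F" "\<lambda>_. 0"] \<pi>(1)[OF F] z by (simp add: cong_mod_def)
    also have "\<dots> \<longleftrightarrow> \<psi> (Y.sec F) = \<psi> (Y.sec (\<lambda>_. 0))"
      by (simp only: \<pi>(2)[OF F] c)
    also have "\<dots> \<longleftrightarrow> Y.sec F = Y.sec (\<lambda>_. 0)"
      using inj_on_eq_iff[OF bij_betw_imp_inj_on[OF \<psi>(2)] Y.sec_carrier[OF F] Y.sec_carrier[OF z(1)]] .
    also have "\<dots> \<longleftrightarrow> ideal_gen Y.n Y.q Y.n (\<lambda>i. pd i (\<lambda>z. \<Phi> (chart_inv c z))) F"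
      using Y.sec_eq_iff[OF F z(1)] by (simp add: cong_mod_def)
    finally show "ideal_gen 2 origin 2 w (\<pi> F) \<longleftrightarrow> ideal_gen Y.n Y.q Y.n (\<lambda>i. pd i (\<lambda>z. \<Phi> (chart_inv c z))) F" .
  next
    fix f assume f: "hol0 f"
    have "X.sec f \<in> \<psi> ` carrier Y.stalk"
      using X.sec_carrier[of f] f bij_betw_imp_surj_on[OF \<psi>(2)] by simp
    then obtain F where F: "hol Y.n Y.q F" "X.sec f = \<psi> (Y.sec F)"
      unfolding Y.carrier_stalk by blast
    then show "\<exists>F. hol Y.n Y.q F \<and> cong_mod (ideal_gen 2 origin 2 w) (\<pi> F) f"
      using eq[OF \<pi>(1)[OF F(1)] f] \<pi>(2)[OF F(1)] by (intro exI[of _ F]) simp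
  qed (use \<Phi> w N \<pi>(1) in auto)
  then show ?thesis by blast
qed

text \<open>Near the origin x^N and y^N are combinations of the coefficients, so a common zero of
  the coefficients has both coordinates zero.\<close>

lemma isolated_zero:
  assumes U: "open U" "(0, 0) \<in> U"
    and h: "\<And>(i::nat) q. i < 2 \<Longrightarrow> q \<in> coord_space 2 \<Longrightarrow> hol 2 q (\<lambda>z. (if i = 0 then a else b) (z 0, z 1))"
    and w: "w = (\<lambda>i z. (if i = 0 then a else b) (z 0, z 1))" "\<And>i. i < 2 \<Longrightarrow> w i origin = 0"
    and N: "\<And>f. max_pow N f \<Longrightarrow> ideal_gen 2 origin 2 w f"
  shows "(0, 0) \<in> zero_set (plane_open U) (plane_form a b)"
    "openin (subtopology (top_of_set U) (zero_set (plane_open U) (plane_form a b))) {(0, 0)}"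
proof -
  let ?Z = "zero_set (plane_open U) (plane_form a b)"
  have Z: "p \<in> ?Z \<longleftrightarrow> (\<forall>i<2. w i (plane_coord p) = 0)" if "p \<in> U" for p
  proof -
    interpret chart_at "plane_open U" "plane_chart U" p by (rule chart_at_plane[OF U(1) that])
    interpret chart_form "plane_open U" "plane_chart U" p "plane_form a b" w
      unfolding w by (rule chart_form_plane[OF U(1) that h]) (use q in auto)
    show ?thesis using mem_zero_set_iff_vanishing by simp
  qed
  show 0: "(0, 0) \<in> ?Z" using Z[OF U(2)] w(2) by (simp add: plane_coord_origin)
  interpret chart_at "plane_open U" "plane_chart U" "(0, 0)" by (rule chart_at_plane[OF U])
  have "max_pow N (monomial N 0)" "max_pow N (monomial 0 N)"
    using monomial_max_pow[of N 0] monomial_max_pow[of 0 N] by auto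
  then obtain \<alpha> \<beta> where
    "eventually (\<lambda>z. monomial N 0 z = (\<Sum>i<2. \<alpha> i z * w i z)) (nbhds 2 origin)"
    "eventually (\<lambda>z. monomial 0 N z = (\<Sum>i<2. \<beta> i z * w i z)) (nbhds 2 origin)"
    using N unfolding ideal_gen_def by meson
  moreover have "eventually (\<lambda>z. z \<in> plane_coord ` U) (nbhds 2 origin)"
    using eventually_map_inv by (simp add: plane_coord_origin)
  ultimately have "eventually (\<lambda>z. (\<forall>i<2. w i (plane_coord (\<iota> z)) = 0) \<longrightarrow> \<iota> z = (0, 0)) (nbhds 2 origin)"
  proof eventually_elim
    case (elim z)
    have z: "plane_coord (\<iota> z) = z" using map_inv elim(3) by simp
    show ?case
    proof
      assume "\<forall>i<2. w i (plane_coord (\<iota> z)) = 0"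
      then have "monomial N 0 z = 0" "monomial 0 N z = 0" using elim(1,2) z by auto
      then have "z 0 = 0" "z 1 = 0" by (auto simp: monomial_def)
      then have "fst (\<iota> z) = 0" "snd (\<iota> z) = 0"
        using plane_coord_apply[of "\<iota> z"] by (simp_all add: z)
      then show "\<iota> z = (0, 0)" by (simp add: prod_eq_iff)
    qed
  qed
  then have "eventually (\<lambda>p. (\<forall>i<2. w i (plane_coord p) = 0) \<longrightarrow> p = (0, 0)) (nhdsin (top_of_set U) (0, 0))"
    using eventually_chart[of "\<lambda>p. (\<forall>i<2. w i (plane_coord p) = 0) \<longrightarrow> p = (0, 0)"]
    by (simp add: plane_coord_origin)
  then obtain V where V: "openin (top_of_set U) V" "(0, 0) \<in> V"
    "\<And>p. p \<in> V \<Longrightarrow> (\<forall>i<2. w i (plane_coord p) = 0) \<Longrightarrow> p = (0, 0)"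
    using U(2) unfolding eventually_nhdsin by auto
  have "V \<subseteq> U" using openin_imp_subset[OF V(1)] .
  then have "{(0, 0)} = V \<inter> ?Z" using V(2,3) 0 Z by blast
  then show "openin (subtopology (top_of_set U) ?Z) {(0, 0)}"
    using V(1) unfolding openin_subtopology by blast
qed

text \<open>Equality of the two ideals at the origin amounts to finitely many relations between
  generators. These persist at nearby points, so the stalks agree on a whole neighbourhood
  \<open>W\<close>.\<close>

lemma critical_locus_of_germ:
  assumes U: "open U" "(0, 0) \<in> U"
    and h: "\<And>(i::nat) q. i < 2 \<Longrightarrow> q \<in> coord_space 2 \<Longrightarrow> hol 2 q (\<lambda>z. (if i = 0 then a else b) (z 0, z 1))"
    and w: "w = (\<lambda>i z. (if i = 0 then a else b) (z 0, z 1))"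
    and \<phi>: "hol0 \<phi>" "\<forall>j<2. ideal_gen 2 origin 2 w (pd j \<phi>)"
      "\<forall>j<2. ideal_gen 2 origin 2 (\<lambda>i. pd i \<phi>) (w j)"
  shows "\<exists>W \<Phi>. open W \<and> (0, 0) \<in> W \<and> W \<subseteq> U \<and> holomorphic_fun (plane_open W) W \<Phi> \<and>
    (\<forall>p\<in>W. zero_ideal (plane_open W) (differential \<Phi>) p = zero_ideal (plane_open W) (plane_form a b) p)"
proof -
  interpret U: chart_at "plane_open U" "plane_chart U" "(0, 0)" by (rule chart_at_plane[OF U])
  have "eventually (\<lambda>z. \<forall>j\<in>{..<2}. ideal_gen 2 z 2 w (pd j \<phi>)) (nbhds 2 origin)"
    "eventually (\<lambda>z. \<forall>j\<in>{..<2}. ideal_gen 2 z 2 (\<lambda>i. pd i \<phi>) (w j)) (nbhds 2 origin)"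
    using \<phi>(2,3) by (intro eventually_ball_finite ballI ideal_gen_eventually; simp)+
  then have "eventually (\<lambda>z. hol 2 z \<phi> \<and> (\<forall>j\<in>{..<2}. ideal_gen 2 z 2 w (pd j \<phi>)) \<and>
      (\<forall>j\<in>{..<2}. ideal_gen 2 z 2 (\<lambda>i. pd i \<phi>) (w j))) (nbhds 2 origin)"
    using hol_eventually[OF \<phi>(1)] by eventually_elim blast
  then obtain S where S0: "openin (complex_space 2) S" "origin \<in> S"
    "\<forall>z\<in>S. hol 2 z \<phi> \<and> (\<forall>j\<in>{..<2}. ideal_gen 2 z 2 w (pd j \<phi>)) \<and>
      (\<forall>j\<in>{..<2}. ideal_gen 2 z 2 (\<lambda>i. pd i \<phi>) (w j))"
    unfolding eventually_nbhds[OF origin_in_coord_space] by blast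
  then have S: "openin (complex_space 2) S" "origin \<in> S" "\<And>z. z \<in> S \<Longrightarrow> hol 2 z \<phi>"
    "\<And>z j. z \<in> S \<Longrightarrow> j < 2 \<Longrightarrow> ideal_gen 2 z 2 w (pd j \<phi>)"
    "\<And>z j. z \<in> S \<Longrightarrow> j < 2 \<Longrightarrow> ideal_gen 2 z 2 (\<lambda>i. pd i \<phi>) (w j)"
    by auto
  define W where "W = {p \<in> U. plane_coord p \<in> S}"
  have "openin (top_of_set U) W" using U.openin_preimage[of S] S(1) by (simp add: W_def)
  then have W: "open W" "W \<subseteq> U" "(0, 0) \<in> W"
    using U S(2) openin_open_eq[OF U(1)] by (auto simp: W_def plane_coord_origin)
  define \<Phi> where "\<Phi> = (\<lambda>p. \<phi> (plane_coord p))"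
  let ?F = "\<lambda>z. \<Phi> (chart_inv (plane_chart W) z)"
  \<comment> \<open>\<open>chart_inv\<close> is a choice of preimage and is arbitrary off the image
    of \<open>W\<close>; \<open>?F\<close> and \<phi> are therefore compared near points of this
    image.\<close>
  have ev: "eventually (\<lambda>z. ?F z = \<phi> z) (nbhds 2 (plane_coord p))" if p: "p \<in> W" for p
  proof -
    interpret chart_at "plane_open W" "plane_chart W" p by (rule chart_at_plane[OF W(1) p])
    have "eventually (\<lambda>z. z \<in> plane_coord ` W) (nbhds 2 (plane_coord p))"
      using eventually_map_inv by simp
    then show ?thesis by eventually_elim (use map_inv in \<open>simp add: \<Phi>_def\<close>)
  qed
  have "holomorphic_n 2 (plane_coord ` W) ?F"
  proof (rule hol_imp_holomorphic_n)
    fix z assume "z \<in> plane_coord ` W"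
    then obtain p where p: "p \<in> W" "z = plane_coord p" by blast
    have "eventually (\<lambda>z. \<phi> z = ?F z) (nbhds 2 z)" using ev[OF p(1)] p(2) by (auto elim: eventually_mono)
    moreover have "hol 2 z \<phi>" using S(3) p by (simp add: W_def)
    ultimately show "hol 2 z ?F" by (rule hol_cong[rotated])
  qed
  then have hol\<Phi>: "holomorphic_fun (plane_open W) W \<Phi>" by (simp add: holomorphic_fun_def)
  moreover have "zero_ideal (plane_open W) (differential \<Phi>) p = zero_ideal (plane_open W) (plane_form a b) p"
    if pW: "p \<in> W" for p
  proof -
    interpret chart_at "plane_open W" "plane_chart W" p by (rule chart_at_plane[OF W(1) pW])
    interpret D: chart_form "plane_open W" "plane_chart W" p "differential \<Phi>" "\<lambda>i. pd i ?F"
      by (rule chart_form_differential) (use hol\<Phi> in simp)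
    interpret F: chart_form "plane_open W" "plane_chart W" p "plane_form a b" w
      unfolding w by (rule chart_form_plane[OF W(1) pW h]) (use q in auto)
    have q2: "plane_coord p \<in> coord_space 2" using q by simp
    have pS: "plane_coord p \<in> S" using pW by (simp add: W_def)
    have pd: "eventually (\<lambda>z. pd i ?F z = pd i \<phi> z) (nbhds 2 (plane_coord p))" if "i < 2" for i
      by (rule pd_cong_eventually[OF ev[OF pW] q2 that])
    have 1: "F.I (pd i ?F)" if i: "i < 2" for i
      by (rule F.I.cong[of "pd i \<phi>"]) (use S(4)[OF pS i] pd[OF i] in \<open>auto elim: eventually_mono\<close>)
    have 2: "D.I (w i)" if i: "i < 2" for i
    proof -
      have "D.I (pd j \<phi>)" if j: "j < 2" for j
      proof (rule D.I.cong)
        show "D.I (pd j ?F)" by (rule ideal_gen_generator[OF q]) (use j in simp)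
      qed (use pd[OF j] in simp)
      then show ?thesis using ideal_gen_trans[OF q2 _ S(5)[OF pS i]] by simp
    qed
    have "D.I G \<longleftrightarrow> F.I G" for G
      using ideal_gen_trans[OF q2, of 2 2 w "\<lambda>i. pd i ?F" G] ideal_gen_trans[OF q2, of 2 2 "\<lambda>i. pd i ?F" w G] 1 2
      by auto
    then show ?thesis unfolding D.zero_ideal_eq F.zero_ideal_eq by simp
  qed
  ultimately show ?thesis using W by blast
qed

theorem proposition4:
  fixes d N :: nat
    and A B C D :: fps2
    and U :: "(complex \<times> complex) set"
    and \<sigma> :: "(complex \<times> complex) one_form"
  assumes "d \<ge> 18"
    and "fps2_dx (hom_part 1 C) + fps2_dy (hom_part 1 D) \<noteq> 0"
    and "\<forall>k<d. hom_part k A = 0"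
    and "\<forall>k<d. hom_part k B = 0"
    and "fps2_dy A - fps2_dx B = C * A + D * B"
    and "ideal_power fps2_ring fps2_max_ideal N \<subseteq> genideal fps2_ring {A, B}"
    and "\<sigma> = plane_form (fps2_section d N A) (fps2_section d N B)"
    and "openin zariski U"
    and "(0, 0) \<in> U"
    and "almost_closed (plane_open U) \<sigma>"
    and "krull_dim (subtopology zariski (zero_set (plane_open U) \<sigma>)) = 0"
    and "\<not> (\<exists>W \<Phi>. open W \<and> (0, 0) \<in> W \<and> W \<subseteq> U \<and>
               holomorphic_fun (plane_open W) W \<Phi> \<and>
               (\<forall>p\<in>W. zero_ideal (plane_open W) (differential \<Phi>) p =
                       zero_ideal (plane_open W) \<sigma> p))"
  shows "\<not> (\<exists>(M :: 'm manifold) \<Phi>. complex_manifold M \<and>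
             holomorphic_fun M (topspace (man_top M)) \<Phi> \<and>
             crs_isomorphic (zero_scheme (plane_open U) \<sigma>) (zero_scheme M (differential \<Phi>)))"
proof
  assume "\<exists>(M :: 'm manifold) \<Phi>. complex_manifold M \<and> holomorphic_fun M (topspace (man_top M)) \<Phi> \<and>
    crs_isomorphic (zero_scheme (plane_open U) \<sigma>) (zero_scheme M (differential \<Phi>))"
  then obtain M :: "'m manifold" and \<Phi> where M: "complex_manifold M"
    and \<Phi>: "holomorphic_fun M (topspace (man_top M)) \<Phi>"
    and "crs_isomorphic (zero_scheme (plane_open U) \<sigma>) (zero_scheme M (differential \<Phi>))" by blast
  let ?X = "zero_scheme (plane_open U) \<sigma>" and ?Y = "zero_scheme M (differential \<Phi>)"
  obtain h \<psi> where h: "homeomorphic_map (crs_top ?X) (crs_top ?Y) h"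
    and \<psi>: "\<forall>V. openin (crs_top ?Y) V \<longrightarrow>
      \<psi> V \<in> ring_iso (crs_sheaf ?Y V) (crs_sheaf ?X {x \<in> topspace (crs_top ?X). h x \<in> V}) \<and>
      (\<forall>a. \<psi> V (crs_const ?Y V a) = crs_const ?X {x \<in> topspace (crs_top ?X). h x \<in> V} a)"
    using \<open>crs_isomorphic ?X ?Y\<close> unfolding crs_isomorphic_def Let_def
    by (elim exE conjE) (rule that)
  let ?a = "fps2_section d N A" and ?b = "fps2_section d N B"
  define w where "w = (\<lambda>i z. (if i = (0::nat) then ?a else ?b) (z (0::nat), z (1::nat)))"
  have U: "open U" "(0, 0) \<in> U" using open_if_openin_zariski assms by auto
  have hol: "hol 2 q (\<lambda>z. (if i = 0 then ?a else ?b) (z 0, z 1))" if "q \<in> coord_space 2" for i :: nat and q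
    using hol_section[OF that] by (cases "i = 0") simp_all
  \<comment> \<open>The coefficients of \<sigma> have no terms of degree below \<open>d\<close>, and
    \<open>d\<close> is at least 18, so they lie in m^2.\<close>
  have w2: "max_pow 2 (w i)" for i
    using section_max_pow[of 2 d N A] section_max_pow[of 2 d N B] assms(1)
    by (cases "i = 0") (simp_all add: w_def del: max_pow.simps)
  then have w0: "w i origin = 0" for i using max_pow_2_iff by blast
  have N: "ideal_gen 2 origin 2 w f" if "max_pow N f" for f
  proof -
    have "w = (\<lambda>i z. fps2_section d N (if i = 0 then A else B) (z 0, z 1))"
      by (auto simp: w_def fun_eq_iff)
    then show ?thesis using max_pow_le_section_ideal[OF assms(3,4,6) that] by simp
  qed
  have Z: "(0, 0) \<in> zero_set (plane_open U) \<sigma>" "openin (crs_top ?X) {(0, 0)}"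
    using isolated_zero[OF U hol w_def w0 N] by (simp_all add: assms(7) zero_scheme_def)
  have top: "(0, 0) \<in> topspace (crs_top ?X)"
    using Z(1) U(2) by (simp add: zero_scheme_def topspace_subtopology)
  \<comment> \<open>The origin is an open point of the first zero scheme, so its image is an open
    point of the second. By injectivity of \<open>h\<close> the isomorphism over this open point is
    one between the two stalks.\<close>
  let ?y = "h (0, 0)"
  have y: "openin (crs_top ?Y) {?y}"
    using homeomorphic_imp_open_map[OF h] Z(2) unfolding open_map_def by fastforce
  then have "?y \<in> topspace (man_top M)"
    using openin_subset[OF y] by (simp add: zero_scheme_def topspace_subtopology)
  then obtain c where c: "c \<in> man_atlas M" "?y \<in> chart_dom c"
    using M unfolding complex_manifold_def by blast
  interpret Y: chart_at M c ?y using M c by unfold_locales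
  have "{x \<in> topspace (crs_top ?X). h x \<in> {?y}} = {(0, 0)}"
    using homeomorphic_imp_injective_map[OF h] top by (auto dest: inj_onD)
  with \<psi>[rule_format, OF y] have iso: "\<psi> {?y} \<in> ring_iso (crs_sheaf ?Y {?y}) (crs_sheaf ?X {(0, 0)})"
    "\<And>a. \<psi> {?y} (crs_const ?Y {?y} a) = crs_const ?X {(0, 0)} a" by auto
  have form: "chart_form (plane_open U) (plane_chart U) (0, 0) \<sigma> w"
    unfolding assms(7) w_def by (rule chart_form_plane[OF U hol]) (simp add: plane_coord_origin)
  have "\<exists>\<pi>. milnor_lift (chart_dim c) (chart_map c ?y) (\<lambda>z. \<Phi> (chart_inv c z)) w N \<pi>"
    by (rule milnor_lift_of_isomorphism[OF form _ _ Y.chart_form_differential[OF \<Phi>]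
        Y.hol_chart_fun[OF \<Phi> Y.p_topspace] w2 _ iso]) (simp_all add: plane_coord_origin N)
  then obtain \<phi> where "hol0 \<phi>" "\<forall>j<2. ideal_gen 2 origin 2 w (pd j \<phi>)"
    "\<forall>j<2. ideal_gen 2 origin 2 (\<lambda>i. pd i \<phi>) (w j)"
    using milnor_lift.exists_critical by blast
  from critical_locus_of_germ[OF U hol w_def this] show False
    using assms(12) unfolding assms(7) by blast
qed

end
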